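(* Let $\mu$ be a probability measure on $\mathbf R^d$ and $p\in[1,2]$. The following are equivalent: (1) There exist $a,b\ge0$ such that for every $n\ge1$ and every measurable $A\subset(\mathbf R^d)^n$ with $\mu^n(A)\ge1/2$, \[\forall r\ge0,\qquad \mu^n\big(A+\sqrt r\,B_2+r^{1/p}B_p\big)\ge1-b\,e^{-ar}.\] (2) There is $C>0$ with $\mathcal T_{2,p}(\nu,\mu)\le C\,H(\nu\,|\,\mu)$ for all probability measures $\nu$ on $\mathbf R^d$. More precisely, if (1) holds with constants $a,b$ then (2) holds with $C=288/a$; conversely, if (2) holds with constant $C$ then (1) holds with $b=2$ and $a=1/(2C)$.
   Context: $B_2$ and $B_p$ are the unit balls of $(\mathbf R^d)^n\cong\mathbf R^{dn}$ for the $\ell^2$ and $\ell^p$ norms respectively. $\alpha_p(u)=\min(|u|^2,|u|^p)$. For probability measures $\nu_1,\nu_2$ on $(\mathbf R^d)^n$, $\mathcal T_{2,p}(\nu_1,\nu_2)=\inf_\pi\int\sum_{i=1}^n\sum_{j=1}^d\alpha_p(x^i_j-y^i_j)\,d\pi(x,y)$, the infimum over couplings of $\nu_1,\nu_2$, where $x=(x^1,\dots,x^n)$, $x^i=(x^i_1,\dots,x^i_d)\in\mathbf R^d$ (in (2), $n=1$). $H(\nu\,|\,\mu)=\int\log\frac{d\nu}{d\mu}d\nu$ if $\nu\ll\mu$, else $+\infty$.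
   Formalization: In (1), and in the implication giving C=288/a, the constant a is required to be strictly positive: with a=0 and b=1, (1) holds for every μ, so the equivalence would fail, and 288/a is undefined. *)

theory Defs
  imports "HOL-Probability.Probability"
begin

text \<open>Points of (R^d)^n are functions from {..<n} to real^'d, extensional
  (value undefined outside {..<n}), i.e. elements of the space of the product
  measure PiM {..<n} (\<lambda>_. mu).\<close>

definition lp_norm :: "nat \<Rightarrow> real \<Rightarrow> (nat \<Rightarrow> real^'d) \<Rightarrow> real" where
  "lp_norm n p y = (\<Sum>i<n. \<Sum>j\<in>UNIV. \<bar>y i $ j\<bar> powr p) powr (1 / p)"

definition unit_ball_p :: "nat \<Rightarrow> real \<Rightarrow> (nat \<Rightarrow> real^'d) set" where
  "unit_ball_p n p = {y \<in> PiE {..<n} (\<lambda>_. UNIV). lp_norm n p y \<le> 1}"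

definition mink_sum :: "nat \<Rightarrow> (nat \<Rightarrow> real^'d) set \<Rightarrow> (nat \<Rightarrow> real^'d) set \<Rightarrow> (nat \<Rightarrow> real^'d) set" where
  "mink_sum n S T = {restrict (\<lambda>i. x i + y i) {..<n} | x y. x \<in> S \<and> y \<in> T}"

definition scale_set :: "nat \<Rightarrow> real \<Rightarrow> (nat \<Rightarrow> real^'d) set \<Rightarrow> (nat \<Rightarrow> real^'d) set" where
  "scale_set n c S = {restrict (\<lambda>i. c *\<^sub>R y i) {..<n} | y. y \<in> S}"

definition alpha_p :: "real \<Rightarrow> real \<Rightarrow> real" where
  "alpha_p p u = min (\<bar>u\<bar>\<^sup>2) (\<bar>u\<bar> powr p)"

definition couplings :: "'a measure \<Rightarrow> 'b measure \<Rightarrow> ('a \<times> 'b) measure set" where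
  "couplings \<nu>1 \<nu>2 = {\<pi>. prob_space \<pi> \<and> sets \<pi> = sets (\<nu>1 \<Otimes>\<^sub>M \<nu>2) \<and>
      distr \<pi> \<nu>1 fst = \<nu>1 \<and> distr \<pi> \<nu>2 snd = \<nu>2}"

definition transport_cost :: "real \<Rightarrow> (real^'d) measure \<Rightarrow> (real^'d) measure \<Rightarrow> ennreal" where
  "transport_cost p \<nu>1 \<nu>2 = (INF \<pi> \<in> couplings \<nu>1 \<nu>2.
      \<integral>\<^sup>+ xy. ennreal (\<Sum>j\<in>UNIV. alpha_p p (fst xy $ j - snd xy $ j)) \<partial>\<pi>)"

text \<open>Relative entropy H(nu | mu) = int log (d nu / d mu) d nu if nu << mu, else +infinity.
  The integral is split into positive and negative parts (the negative part is
  always finite, being at most 1/e).\<close>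
definition rel_entropy :: "'a measure \<Rightarrow> 'a measure \<Rightarrow> ereal" where
  "rel_entropy \<nu> \<mu> =
    (if absolutely_continuous \<mu> \<nu> then
       (let f = (\<lambda>x. enn2real (RN_deriv \<mu> \<nu> x)) in
        enn2ereal (\<integral>\<^sup>+ x. ennreal (max 0 (ln (f x))) \<partial>\<nu>)
        - enn2ereal (\<integral>\<^sup>+ x. ennreal (max 0 (- ln (f x))) \<partial>\<nu>))
     else \<infinity>)"

definition concentration :: "(real^'d) measure \<Rightarrow> real \<Rightarrow> real \<Rightarrow> real \<Rightarrow> bool" where
  "concentration \<mu> p a b \<longleftrightarrow>
    (\<forall>n\<ge>1. \<forall>A \<in> sets (PiM {..<n} (\<lambda>_. \<mu>)).
       measure (PiM {..<n} (\<lambda>_. \<mu>)) A \<ge> 1/2 \<longrightarrow>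
       (\<forall>r\<ge>0. outer_measure_of (PiM {..<n} (\<lambda>_. \<mu>))
                 (mink_sum n (mink_sum n A (scale_set n (sqrt r) (unit_ball_p n 2)))
                             (scale_set n (r powr (1/p)) (unit_ball_p n p)))
               \<ge> ennreal (1 - b * exp (- a * r))))"

definition transport_entropy :: "(real^'d) measure \<Rightarrow> real \<Rightarrow> real \<Rightarrow> bool" where
  "transport_entropy \<mu> p C \<longleftrightarrow>
    (\<forall>\<nu>. prob_space \<nu> \<and> sets \<nu> = sets (borel :: (real^'d) measure) \<longrightarrow>
       enn2ereal (transport_cost p \<nu> \<mu>) \<le> ereal C * rel_entropy \<nu> \<mu>)"

end

theory Submission
  imports Defs
begin

text \<open>From transport to concentration: testing the inequality on densities proportional to
  \<open>exp (f / C)\<close> and using weak duality twice gives Maurey's property (tau): if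
  \<open>f x \<le> g y + cost\<close>, then \<open>\<integral> exp f * \<integral> exp (- g) \<le> 1\<close>. This property tensorises, and applied
  to a function which is small on \<open>A\<close> and large far away from \<open>A\<close> it is the concentration
  inequality. Measurability of infimum convolutions is avoided by discretising space into small
  cubes, the discretisation error being absorbed by a slightly larger radius.

  From concentration to transport: apply concentration on \<open>n\<close> copies to the set where
  \<open>\<phi> (y 1) + \<dots> + \<phi> (y n)\<close> is at most its mean plus \<open>n \<eta>\<close>. Since the enlargement by \<open>r\<close> costs at most
  \<open>4 r\<close>, the tails of \<open>f (x 1) + \<dots> + f (x n)\<close> are exponentially small whenever
  \<open>f x \<le> \<phi> y + \<kappa> cost (x - y)\<close>; integrating them, taking \<open>n\<close>-th roots and letting \<open>n\<close> tend to
  infinity bounds \<open>\<integral> exp (t f)\<close> by \<open>exp (t \<integral> \<phi>)\<close>. With the Gibbs variational principle this is the dual form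
  of the transport inequality, from which couplings are recovered by Kantorovich duality for
  finitely supported approximations.\<close>

section \<open>Costs\<close>

text \<open>The cost obeys no triangle inequality: for p = 2 it is a square. Its substitute is
  subadditivity of \<open>sqrt (alpha_p p u)\<close>, which by Cauchy-Schwarz lets a displacement be
  cut into k pieces at the price of a factor k. This is the source of the numerical constants. Two
  steps through an intermediate point turn C into 2 C, hence a = 1 / (2 C), and b = 2 is the inverse
  of the mass 1/2 of \<open>A\<close>. Conversely, the two balls give 2 (r + r) = 4 r; rounding both
  arguments of the cost cuts it into three pieces, once for the potentials and once for the
  coupling. With an exponent equal to half of the critical a / (4 * 3), this gives 3 * 24 / a = 72 /
  a, within 288 / a. The constant b is one fixed factor while the dimension grows, so it does not
  survive the n-th root, and C depends on a alone. Two different discretisations occur: a grid,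
  whose countably many cells make every function on a finite product measurable, and simple
  functions, whose finite range turns duality into a compactness argument in finitely many
  variables.\<close>

lemma alpha_p_nonneg: "0 \<le> alpha_p p u"
  by (simp add: alpha_p_def)

lemma alpha_p_zero: "alpha_p p 0 = 0"
  by (simp add: alpha_p_def)

lemma alpha_p_minus: "alpha_p p (- u) = alpha_p p u"
  by (simp add: alpha_p_def)

lemma alpha_p_abs: "alpha_p p \<bar>u\<bar> = alpha_p p u"
  by (simp add: alpha_p_def)

lemma borel_measurable_alpha_p [measurable]: "alpha_p p \<in> borel_measurable borel"
  unfolding alpha_p_def by measurable

lemma alpha_p_mono: "0 \<le> p \<Longrightarrow> \<bar>u\<bar> \<le> \<bar>v\<bar> \<Longrightarrow> alpha_p p u \<le> alpha_p p v"
  unfolding alpha_p_def by (intro min.mono power_mono powr_mono2) auto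

lemma alpha_p_le_1: "\<bar>u\<bar> \<le> 1 \<Longrightarrow> p \<le> 2 \<Longrightarrow> alpha_p p u = u\<^sup>2"
proof (cases "u = 0")
  case False
  assume u: "\<bar>u\<bar> \<le> 1" and p: "p \<le> 2"
  have "\<bar>u\<bar> powr 2 \<le> \<bar>u\<bar> powr p"
    using u p False by (intro powr_mono') auto
  with False show ?thesis by (simp add: alpha_p_def powr_numeral)
qed (simp add: alpha_p_def)

lemma alpha_p_ge_1: "1 \<le> \<bar>u\<bar> \<Longrightarrow> p \<le> 2 \<Longrightarrow> alpha_p p u = \<bar>u\<bar> powr p"
  using powr_mono[of p 2 "\<bar>u\<bar>"] by (simp add: alpha_p_def powr_numeral)

lemma sqrt_alpha_p:
  assumes "0 < u"
  shows "sqrt (alpha_p p u) = u * min 1 (u powr (p / 2 - 1))"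
proof -
  have "u * min 1 (u powr (p / 2 - 1)) = min u (u powr (p / 2))"
    using assms by (simp add: min_mult_distrib_left powr_diff)
  moreover have "(min u (u powr (p / 2)))\<^sup>2 = alpha_p p u"
  proof -
    have "(u powr (p / 2))\<^sup>2 = u powr p"
      using assms by (simp add: power2_eq_square flip: powr_add)
    moreover have "u \<le> u powr (p / 2) \<longleftrightarrow> u\<^sup>2 \<le> (u powr (p / 2))\<^sup>2"
      using assms by (simp add: abs_le_square_iff[symmetric])
    ultimately show ?thesis using assms by (auto simp: alpha_p_def min_def)
  qed
  ultimately show ?thesis
    by (metis real_sqrt_abs abs_of_nonneg assms less_imp_le min_def powr_ge_zero)
qed

text \<open>Subadditivity holds because the function \<open>u \<mapsto> sqrt (alpha_p p u) / u\<close> is nonincreasing on the positive half-line.\<close>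

lemma sqrt_alpha_p_subadd:
  assumes "0 \<le> p" "p \<le> 2"
  shows "sqrt (alpha_p p (u + v)) \<le> sqrt (alpha_p p u) + sqrt (alpha_p p v)"
proof -
  have pos: "sqrt (alpha_p p (x + y)) \<le> sqrt (alpha_p p x) + sqrt (alpha_p p y)"
    if "0 < x" "0 < y" for x y :: real
  proof -
    define m where "m z = min 1 (z powr (p / 2 - 1))" for z :: real
    have m: "m (x + y) \<le> m x" "m (x + y) \<le> m y"
      unfolding m_def by (intro min.mono order_refl powr_mono2'; use that assms in simp)+
    have "(x + y) * m (x + y) \<le> x * m x + y * m y"
      unfolding distrib_right using m that by (intro add_mono mult_left_mono) auto
    then show ?thesis using that by (simp add: sqrt_alpha_p m_def)
  qed
  have "sqrt (alpha_p p (u + v)) \<le> sqrt (alpha_p p (\<bar>u\<bar> + \<bar>v\<bar>))"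
    using assms by (simp add: alpha_p_mono)
  also have "\<dots> \<le> sqrt (alpha_p p \<bar>u\<bar>) + sqrt (alpha_p p \<bar>v\<bar>)"
    by (cases "u = 0"; cases "v = 0") (auto simp: alpha_p_zero pos alpha_p_nonneg)
  finally show ?thesis by (simp add: alpha_p_abs)
qed

lemma alpha_p_add2:
  assumes "0 \<le> p" "p \<le> 2"
  shows "alpha_p p (u + v) \<le> 2 * (alpha_p p u + alpha_p p v)"
proof -
  define s where "s z = sqrt (alpha_p p z)" for z
  have s2: "alpha_p p z = (s z)\<^sup>2" and "0 \<le> s z" for z
    by (simp_all add: s_def alpha_p_nonneg)
  then have "(s (u + v))\<^sup>2 \<le> (s u + s v)\<^sup>2"
    using sqrt_alpha_p_subadd[OF assms, of u v] by (intro power_mono) (auto simp: s_def)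
  also have "\<dots> \<le> 2 * ((s u)\<^sup>2 + (s v)\<^sup>2)"
    using zero_le_power2[of "s u - s v"] by (simp add: power2_eq_square algebra_simps)
  finally show ?thesis by (simp add: s2)
qed

lemma alpha_p_add3:
  assumes "0 \<le> p" "p \<le> 2"
  shows "alpha_p p (u + v + w) \<le> 3 * (alpha_p p u + alpha_p p v + alpha_p p w)"
proof -
  define s where "s z = sqrt (alpha_p p z)" for z
  have s2: "alpha_p p z = (s z)\<^sup>2" and "0 \<le> s z" for z
    by (simp_all add: s_def alpha_p_nonneg)
  moreover have "s (u + v + w) \<le> s u + s v + s w"
    using sqrt_alpha_p_subadd[OF assms, of "u + v" w] sqrt_alpha_p_subadd[OF assms, of u v]
    by (simp add: s_def)
  ultimately have "(s (u + v + w))\<^sup>2 \<le> (s u + s v + s w)\<^sup>2"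
    by (intro power_mono) auto
  also have "\<dots> \<le> 3 * ((s u)\<^sup>2 + (s v)\<^sup>2 + (s w)\<^sup>2)"
    using zero_le_power2[of "s u - s v"] zero_le_power2[of "s u - s w"] zero_le_power2[of "s v - s w"]
    by (simp add: power2_eq_square algebra_simps)
  finally show ?thesis by (simp add: s2)
qed

definition cost :: "real \<Rightarrow> real^'d \<Rightarrow> real" where
  "cost p z = (\<Sum>j\<in>UNIV. alpha_p p (z $ j))"

lemma cost_nonneg: "0 \<le> cost p z"
  by (simp add: cost_def sum_nonneg alpha_p_nonneg)

lemma cost_minus: "cost p (- z) = cost p z"
  by (simp add: cost_def alpha_p_minus)

lemma cost_commute: "cost p (x - y) = cost p (y - x)"
  using cost_minus[of p "y - x"] by simp

lemma borel_measurable_cost [measurable]: "cost p \<in> borel_measurable borel"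
  unfolding cost_def by measurable

lemma cost_add2:
  assumes "0 \<le> p" "p \<le> 2"
  shows "cost p (u + v) \<le> 2 * (cost p u + cost p v)"
  unfolding cost_def sum.distrib[symmetric] sum_distrib_left
  by (intro sum_mono) (use alpha_p_add2[OF assms] in simp)

lemma cost_add3:
  assumes "0 \<le> p" "p \<le> 2"
  shows "cost p (u + v + w) \<le> 3 * (cost p u + cost p v + cost p w)"
  unfolding cost_def sum.distrib[symmetric] sum_distrib_left
  by (intro sum_mono) (use alpha_p_add3[OF assms] in simp)

lemma cost_triangle3:
  assumes "0 \<le> p" "p \<le> 2"
  shows "cost p (x - y) \<le> 3 * (cost p (x - x') + cost p (x' - y') + cost p (y - y'))"
  using cost_add3[OF assms, of "x - x'" "x' - y'" "y' - y"] by (simp add: cost_commute[of p y])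

lemma alpha_p_sum:
  assumes "0 \<le> p" "p \<le> 2" "finite I"
  shows "alpha_p p (\<Sum>i\<in>I. u i) \<le> real (card I) * (\<Sum>i\<in>I. alpha_p p (u i))"
proof -
  have "sqrt (alpha_p p (\<Sum>i\<in>I. u i)) \<le> (\<Sum>i\<in>I. sqrt (alpha_p p (u i)))"
    using assms(3)
  proof induction
    case (insert i I)
    then show ?case
      using sqrt_alpha_p_subadd[OF assms(1,2), of "u i" "\<Sum>i\<in>I. u i"] by simp
  qed (simp add: alpha_p_zero)
  then have "(sqrt (alpha_p p (\<Sum>i\<in>I. u i)))\<^sup>2 \<le> (\<Sum>i\<in>I. sqrt (alpha_p p (u i)))\<^sup>2"
    by (intro power_mono) (auto simp: alpha_p_nonneg)
  also have "\<dots> \<le> (\<Sum>i\<in>I. (sqrt (alpha_p p (u i)))\<^sup>2) * (\<Sum>i\<in>I. 1\<^sup>2)"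
    using Cauchy_Schwarz_ineq_sum[of "\<lambda>i. sqrt (alpha_p p (u i))" "\<lambda>_. 1" I] by simp
  finally show ?thesis by (simp add: alpha_p_nonneg mult.commute)
qed

lemma alpha_p_mult_le:
  assumes "1 \<le> k" "p \<le> 2"
  shows "alpha_p p (k * u) \<le> k\<^sup>2 * alpha_p p u"
proof -
  have "k powr p * \<bar>u\<bar> powr p \<le> k\<^sup>2 * \<bar>u\<bar> powr p"
    using assms powr_mono[of p 2 k] by (intro mult_right_mono) (auto simp: powr_numeral)
  then show ?thesis
    using assms by (auto simp: alpha_p_def abs_mult powr_mult power_mult_distrib min_mult_distrib_left
        intro: min.mono min.coboundedI2)
qed

text \<open>The cost is a sum over coordinates, while the approximation of points by simple
  functions is controlled in Euclidean norm. This bound and the converse below pass from one to the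
  other, each at the price of one factor of the dimension.\<close>

lemma alpha_p_norm_le_cost:
  fixes z :: "real^'d"
  assumes "0 \<le> p" "p \<le> 2"
  shows "alpha_p p (norm z) \<le> CARD('d) * cost p z"
proof -
  have "alpha_p p (norm z) \<le> alpha_p p (\<Sum>j\<in>UNIV. \<bar>z $ j\<bar>)"
    using assms norm_le_l1_cart[of z] by (intro alpha_p_mono) auto
  also have "\<dots> \<le> CARD('d) * cost p z"
    using alpha_p_sum[OF assms, of UNIV "\<lambda>j. \<bar>z $ j\<bar>"] by (simp add: cost_def alpha_p_abs)
  finally show ?thesis .
qed

lemma cost_le_alpha_p_norm:
  fixes z :: "real^'d"
  assumes "0 \<le> p"
  shows "cost p z \<le> CARD('d) * alpha_p p (norm z)"
proof -
  have "cost p z \<le> (\<Sum>j\<in>(UNIV::'d set). alpha_p p (norm z))"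
    unfolding cost_def using assms
    by (intro sum_mono alpha_p_mono) (auto simp: component_le_norm_cart)
  then show ?thesis by simp
qed

section \<open>Finite Kantorovich duality\<close>

text \<open>First-order optimality in one direction: near 0 the linear term dominates the quadratic
  one, so a negative slope would produce a negative increment.\<close>

lemma quadratic_nonneg_slope:
  fixes D e \<epsilon> :: real
  assumes "0 < \<epsilon>" "\<And>t. 0 < t \<Longrightarrow> t \<le> \<epsilon> \<Longrightarrow> 0 \<le> t * D + e * t\<^sup>2"
  shows "0 \<le> D"
proof (rule ccontr)
  assume D: "\<not> 0 \<le> D"
  \<comment> \<open>At this \<open>t\<close> the quadratic correction e t^2 is at most half of the
    linear gain -t D.\<close>
  define t where "t = min \<epsilon> (- D / (2 * (\<bar>e\<bar> + 1)))"
  have t: "0 < t" "t \<le> \<epsilon>" "t \<le> - D / (2 * (\<bar>e\<bar> + 1))"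
    using assms(1) D by (auto simp: t_def divide_neg_pos)
  have "e * t \<le> (\<bar>e\<bar> + 1) * t" using t(1) by (intro mult_right_mono) auto
  also have "\<dots> \<le> - D / 2" using t(3) by (simp add: field_simps)
  finally have "D + e * t < 0" using D by simp
  then have "t * (D + e * t) < 0" using t(1) by (intro mult_pos_neg) auto
  with assms(2)[OF t(1,2)] show False by (simp add: algebra_simps power2_eq_square)
qed

text \<open>Tychonoff for real-valued functions, whose topology is the product topology. In the
  applications all but finitely many factors are {0}, so that plans on a finite set form a compact
  set even if the underlying type is infinite.\<close>

lemma compact_box_fun:
  fixes B :: "'a \<Rightarrow> real set"
  assumes "\<And>i. compact (B i)"
  shows "compact (PiE UNIV B)"
proof -
  have "compactin (product_topology (\<lambda>_. euclidean) UNIV) (PiE UNIV B)"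
    using assms by (simp add: compactin_PiE)
  then show ?thesis by (simp add: euclidean_product_topology)
qed

lemma box_nonneg: "\<pi> \<in> PiE UNIV (\<lambda>z. if z \<in> T then {0..b} else {0}) \<Longrightarrow> 0 \<le> (\<pi> z :: real)"
  by (drule PiE_mem[of _ _ _ z]) (simp_all split: if_splits)

text \<open>Relaxing the marginal constraints to a quadratic penalty, the first-order conditions at a
  minimiser show that the scaled marginal defects are feasible dual potentials.\<close>

definition penalty where
  "penalty S p q c \<delta> \<pi> = (\<Sum>(s, t)\<in>S \<times> S. \<pi> (s, t) * c s t)
     + ((\<Sum>s\<in>S. ((\<Sum>t\<in>S. \<pi> (s, t)) - p s)\<^sup>2) + (\<Sum>t\<in>S. ((\<Sum>s\<in>S. \<pi> (s, t)) - q t)\<^sup>2)) / (2 * \<delta>)"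
  for p :: "'a \<Rightarrow> real"

text \<open>The penalty is quadratic, so the expansion in the added mass is exact. One row sum and
  one column sum move, and each contributes \<open>\<tau>\<^sup>2 / (2 * \<delta>)\<close>; this
  explains the coefficient \<open>1 / \<delta>\<close>.\<close>

lemma penalty_update:
  fixes p :: "'a \<Rightarrow> real"
  assumes S: "finite S" "x \<in> S" "y \<in> S"
  shows "penalty S p q c \<delta> (\<pi>((x, y) := \<pi> (x, y) + \<tau>)) = penalty S p q c \<delta> \<pi>
     + \<tau> * (c x y + ((\<Sum>t\<in>S. \<pi> (x, t)) - p x + ((\<Sum>s\<in>S. \<pi> (s, y)) - q y)) / \<delta>) + 1 / \<delta> * \<tau>\<^sup>2"
proof -
  let ?\<pi> = "\<pi>((x, y) := \<pi> (x, y) + \<tau>)"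
  have upd: "?\<pi> (s, t) = \<pi> (s, t) + (if s = x \<and> t = y then \<tau> else 0)" for s t
    by simp
  have rows: "(\<Sum>t\<in>S. ?\<pi> (s, t)) = (\<Sum>t\<in>S. \<pi> (s, t)) + (if s = x then \<tau> else 0)" for s
    unfolding upd sum.distrib using S by (cases "s = x") (simp_all add: sum.delta)
  have cols: "(\<Sum>s\<in>S. ?\<pi> (s, t)) = (\<Sum>s\<in>S. \<pi> (s, t)) + (if t = y then \<tau> else 0)" for t
    unfolding upd sum.distrib using S by (cases "t = y") (simp_all add: sum.delta)
  have costs: "(\<Sum>(s, t)\<in>S \<times> S. ?\<pi> (s, t) * c s t)
      = (\<Sum>(s, t)\<in>S \<times> S. \<pi> (s, t) * c s t) + \<tau> * c x y"
  proof -
    have "(\<Sum>(s, t)\<in>S \<times> S. ?\<pi> (s, t) * c s t)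
        = (\<Sum>(s, t)\<in>S \<times> S. \<pi> (s, t) * c s t + (if (s, t) = (x, y) then \<tau> * c x y else 0))"
      by (intro sum.cong refl) (auto simp: algebra_simps)
    also have "\<dots> = (\<Sum>(s, t)\<in>S \<times> S. \<pi> (s, t) * c s t)
        + (\<Sum>z\<in>S \<times> S. if z = (x, y) then \<tau> * c x y else 0)"
      by (simp add: sum.distrib case_prod_unfold prod_eq_iff)
    finally show ?thesis using S by (simp add: sum.delta)
  qed
  have sq: "(\<Sum>s\<in>S. (m s + (if s = z then \<tau> else 0) - r s)\<^sup>2)
      = (\<Sum>s\<in>S. (m s - r s)\<^sup>2) + 2 * \<tau> * (m z - r z) + \<tau>\<^sup>2" if "z \<in> S" for m r :: "'a \<Rightarrow> real" and z
  proof -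
    have "(\<Sum>s\<in>S. (m s + (if s = z then \<tau> else 0) - r s)\<^sup>2)
        = (\<Sum>s\<in>S. (m s - r s)\<^sup>2 + (if s = z then 2 * \<tau> * (m z - r z) + \<tau>\<^sup>2 else 0))"
      by (intro sum.cong refl) (auto simp: power2_eq_square algebra_simps)
    then show ?thesis using S that by (simp add: sum.distrib sum.delta)
  qed
  show ?thesis
    unfolding penalty_def rows cols costs sq[OF S(2)] sq[OF S(3)]
    by (cases "\<delta> = 0") (simp_all add: field_simps power2_eq_square)
qed

lemma continuous_on_coordinate: "continuous_on A (\<lambda>f. f i :: real)"
  by (rule continuous_on_subset[OF continuous_on_product_coordinates]) simp

lemma continuous_on_penalty: "0 < \<delta> \<Longrightarrow> continuous_on A (penalty S p q c \<delta>)"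
  unfolding penalty_def case_prod_unfold
  by (intro continuous_intros continuous_on_coordinate) simp

lemma penalised_minimiser:
  fixes p q :: "'a \<Rightarrow> real" and c :: "'a \<Rightarrow> 'a \<Rightarrow> real"
  assumes S: "finite S" and pq: "\<And>s. s \<in> S \<Longrightarrow> 0 \<le> p s" "\<And>s. s \<in> S \<Longrightarrow> 0 \<le> q s"
    "sum p S = 1" "sum q S = 1"
    and c: "\<And>s t. s \<in> S \<Longrightarrow> t \<in> S \<Longrightarrow> 0 \<le> c s t"
    and dual: "\<And>f g. (\<And>s t. s \<in> S \<Longrightarrow> t \<in> S \<Longrightarrow> f s - g t \<le> c s t)
        \<Longrightarrow> (\<Sum>s\<in>S. p s * f s) - (\<Sum>t\<in>S. q t * g t) \<le> V"
    and \<delta>: "0 < \<delta>"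
  shows "\<exists>\<pi> \<in> PiE UNIV (\<lambda>z. if z \<in> S \<times> S then {0..4} else {0}).
     (\<Sum>(s, t)\<in>S \<times> S. \<pi> (s, t) * c s t) \<le> V \<and>
     (\<Sum>s\<in>S. ((\<Sum>t\<in>S. \<pi> (s, t)) - p s)\<^sup>2) + (\<Sum>t\<in>S. ((\<Sum>s\<in>S. \<pi> (s, t)) - q t)\<^sup>2) \<le> \<delta> * V"
proof -
  \<comment> \<open>The upper bound 4 serves compactness only: entries of a minimiser are shown to
    be at most 3, so each of them can still be raised by 1 inside the box.\<close>
  define K where "K = PiE UNIV (\<lambda>z. if z \<in> S \<times> S then {0..4::real} else {0})"
  have "compact K" unfolding K_def by (intro compact_box_fun) auto
  moreover have zero: "(\<lambda>_. 0) \<in> K" by (auto simp: K_def)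
  ultimately obtain \<pi> where \<pi>: "\<pi> \<in> K"
    and min: "\<And>\<rho>. \<rho> \<in> K \<Longrightarrow> penalty S p q c \<delta> \<pi> \<le> penalty S p q c \<delta> \<rho>"
    using continuous_attains_inf[OF _ _ continuous_on_penalty[OF \<delta>], of K S p q c] by blast
  have \<pi>_nonneg: "0 \<le> \<pi> z" for z
    using \<pi> unfolding K_def by (rule box_nonneg)
  define r where "r s = (\<Sum>t\<in>S. \<pi> (s, t))" for s
  define k where "k t = (\<Sum>s\<in>S. \<pi> (s, t))" for t
  \<comment> \<open>By \<open>penalty_update\<close>, the derivative of the penalty in the entry (x,
    y) is \<open>c x y - (f x + h y)\<close>.\<close>
  define f where "f s = (p s - r s) / \<delta>" for s
  define h where "h t = (q t - k t) / \<delta>" for t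
  have le1: "p s \<le> 1" "q s \<le> 1" if "s \<in> S" for s
    using that S pq member_le_sum[of s S p] member_le_sum[of s S q] by auto
  have sq1: "(\<Sum>s\<in>S. (p s)\<^sup>2) \<le> 1" "(\<Sum>s\<in>S. (q s)\<^sup>2) \<le> 1"
    using le1 pq sum_mono[of S "\<lambda>s. (p s)\<^sup>2" p] sum_mono[of S "\<lambda>s. (q s)\<^sup>2" q]
    by (auto simp: power2_eq_square mult_left_le)
  \<comment> \<open>Comparison with the zero plan, whose penalty is at most
    \<open>1 / \<delta>\<close>: the square of a row defect is at most 2, so the row sum exceeds
    \<open>p x \<le> 1\<close> by at most 2.\<close>
  have bound: "\<pi> (x, y) \<le> 3" if xy: "x \<in> S" "y \<in> S" for x y
  proof -
    have "(r x - p x)\<^sup>2 / (2 * \<delta>) \<le> penalty S p q c \<delta> \<pi>"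
    proof -
      have "0 \<le> (\<Sum>(s, t)\<in>S \<times> S. \<pi> (s, t) * c s t)"
        using c \<pi>_nonneg by (intro sum_nonneg) auto
      moreover have "(r x - p x)\<^sup>2 \<le> (\<Sum>s\<in>S. (r s - p s)\<^sup>2)"
        using S xy by (intro member_le_sum) auto
      then have "(r x - p x)\<^sup>2 \<le> (\<Sum>s\<in>S. (r s - p s)\<^sup>2) + (\<Sum>t\<in>S. (k t - q t)\<^sup>2)"
        by (simp add: sum_nonneg add_increasing2)
      then have "(r x - p x)\<^sup>2 / (2 * \<delta>) \<le> ((\<Sum>s\<in>S. (r s - p s)\<^sup>2) + (\<Sum>t\<in>S. (k t - q t)\<^sup>2)) / (2 * \<delta>)"
        using \<delta> by (intro divide_right_mono) auto
      ultimately show ?thesis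
        unfolding penalty_def r_def[symmetric] k_def[symmetric] by linarith
    qed
    also have "\<dots> \<le> penalty S p q c \<delta> (\<lambda>_. 0)" by (rule min[OF zero])
    also have "\<dots> \<le> 2 / (2 * \<delta>)"
      unfolding penalty_def using \<delta> sq1
      by (simp del: divide_divide_eq_left add: divide_right_mono[of _ 2 "2 * \<delta>", simplified])
    finally have "(r x - p x)\<^sup>2 \<le> 2" using \<delta> by (simp add: field_simps)
    then have "(r x - p x)\<^sup>2 \<le> 2\<^sup>2" by simp
    then have "r x - p x \<le> 2" by (rule power2_le_imp_le) simp
    moreover have "\<pi> (x, y) \<le> r x"
      unfolding r_def using S xy \<pi>_nonneg by (intro member_le_sum[of y S "\<lambda>t. \<pi> (x, t)"]) auto
    ultimately show ?thesis using le1(1)[OF xy(1)] by simp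
  qed
  have upd: "0 \<le> \<tau> * (c x y - (f x + h y)) + 1 / \<delta> * \<tau>\<^sup>2"
    if xy: "x \<in> S" "y \<in> S" and \<tau>: "- \<pi> (x, y) \<le> \<tau>" "\<tau> \<le> 1" for x y \<tau>
  proof -
    have "\<pi>((x, y) := \<pi> (x, y) + \<tau>) \<in> K"
      unfolding K_def
    proof (rule PiE_I)
      fix z
      show "(\<pi>((x, y) := \<pi> (x, y) + \<tau>)) z \<in> (if z \<in> S \<times> S then {0..4} else {0})"
        using PiE_mem[OF \<pi>[unfolded K_def], of z] xy \<tau> bound[OF xy] by (cases "z = (x, y)") auto
    qed simp
    from min[OF this] show ?thesis
      unfolding penalty_update[OF S xy] r_def[symmetric] k_def[symmetric] f_def h_def
      by (simp add: add_divide_distrib diff_divide_distrib algebra_simps)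
  qed
  \<comment> \<open>Raising an entry is always admissible, which yields dual feasibility.\<close>
  have le: "f x + h y \<le> c x y" if "x \<in> S" "y \<in> S" for x y
    using quadratic_nonneg_slope[of 1 "c x y - (f x + h y)" "1 / \<delta>"] upd[OF that] \<pi>_nonneg[of "(x, y)"]
    by (meson diff_ge_0_iff_ge less_imp_le neg_le_0_iff_le order_trans zero_less_one)
  \<comment> \<open>Complementary slackness: a positive entry can also be lowered, so there the
    derivative vanishes.\<close>
  have eq: "\<pi> (x, y) * c x y = \<pi> (x, y) * (f x + h y)" if xy: "x \<in> S" "y \<in> S" for x y
  proof (cases "\<pi> (x, y) = 0")
    case False
    then have pos: "0 < \<pi> (x, y)" using \<pi>_nonneg[of "(x, y)"] by simp
    have "0 \<le> - (c x y - (f x + h y))"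
    proof (rule quadratic_nonneg_slope[OF pos])
      fix t assume "0 < t" "t \<le> \<pi> (x, y)"
      then show "0 \<le> t * - (c x y - (f x + h y)) + 1 / \<delta> * t\<^sup>2"
        using upd[OF xy, of "- t"] by (simp add: algebra_simps)
    qed
    with le[OF xy] show ?thesis by simp
  qed simp
  let ?E = "(\<Sum>s\<in>S. (r s - p s)\<^sup>2) + (\<Sum>t\<in>S. (k t - q t)\<^sup>2)"
  have "(\<Sum>(s, t)\<in>S \<times> S. \<pi> (s, t) * c s t) = (\<Sum>s\<in>S. \<Sum>t\<in>S. \<pi> (s, t) * (f s + h t))"
    unfolding sum.cartesian_product by (intro sum.cong refl) (auto simp: eq)
  also have "\<dots> = (\<Sum>s\<in>S. \<Sum>t\<in>S. \<pi> (s, t) * f s) + (\<Sum>t\<in>S. \<Sum>s\<in>S. \<pi> (s, t) * h t)"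
    by (simp add: distrib_left sum.distrib sum.swap[of "\<lambda>s t. \<pi> (s, t) * h t"])
  also have "\<dots> = (\<Sum>s\<in>S. r s * f s) + (\<Sum>t\<in>S. k t * h t)"
    by (simp add: r_def k_def sum_distrib_right)
  \<comment> \<open>Since \<open>r s = p s - \<delta> * f s\<close>, and likewise for the columns,
    replacing the actual marginals by the prescribed ones leaves exactly the term
    \<open>?E / \<delta>\<close>. The remaining dual value is at most \<open>V\<close>, so the same
    inequality bounds both the cost and the defects.\<close>
  also have "\<dots> = (\<Sum>s\<in>S. p s * f s) + (\<Sum>t\<in>S. q t * h t) - ?E / \<delta>"
  proof -
    have "r s * f s = p s * f s - (r s - p s)\<^sup>2 / \<delta>" "k s * h s = q s * h s - (k s - q s)\<^sup>2 / \<delta>" for s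
      using \<delta> by (simp_all add: f_def h_def field_simps power2_eq_square)
    then show ?thesis by (simp add: sum_subtractf sum_divide_distrib add_divide_distrib)
  qed
  also have "\<dots> \<le> V - ?E / \<delta>"
    using dual[of f "\<lambda>t. - h t"] le by (simp add: sum_negf)
  finally have main: "(\<Sum>(s, t)\<in>S \<times> S. \<pi> (s, t) * c s t) \<le> V - ?E / \<delta>" .
  have "0 \<le> ?E" by (simp add: sum_nonneg)
  moreover have "0 \<le> (\<Sum>(s, t)\<in>S \<times> S. \<pi> (s, t) * c s t)"
    using c \<pi>_nonneg by (intro sum_nonneg) auto
  ultimately have "(\<Sum>(s, t)\<in>S \<times> S. \<pi> (s, t) * c s t) \<le> V" "?E / \<delta> \<le> V"
    using main divide_nonneg_pos[OF _ \<delta>, of ?E] by linarith+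
  then have "(\<Sum>(s, t)\<in>S \<times> S. \<pi> (s, t) * c s t) \<le> V" "?E \<le> \<delta> * V"
    using \<delta> by (simp_all add: pos_divide_le_eq mult.commute)
  then show ?thesis using \<pi> unfolding K_def r_def k_def by blast
qed

text \<open>Instead of following penalised minimisers to a limit, the total violation
  \<open>F\<close> (squared marginal defects plus the excess of the cost over \<open>V\<close>) is
  minimised over the compact box. The plans of \<open>penalised_minimiser\<close> make
  \<open>F\<close> arbitrarily small, so its attained minimum is 0 and the minimiser is an exact
  plan of cost at most \<open>V\<close>.\<close>

lemma finite_kantorovich_duality:
  fixes p q :: "'a \<Rightarrow> real" and c :: "'a \<Rightarrow> 'a \<Rightarrow> real"
  assumes S: "finite S" and pq: "\<And>s. s \<in> S \<Longrightarrow> 0 \<le> p s" "\<And>s. s \<in> S \<Longrightarrow> 0 \<le> q s"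
    "sum p S = 1" "sum q S = 1"
    and c: "\<And>s t. s \<in> S \<Longrightarrow> t \<in> S \<Longrightarrow> 0 \<le> c s t"
    and dual: "\<And>f g. (\<And>s t. s \<in> S \<Longrightarrow> t \<in> S \<Longrightarrow> f s - g t \<le> c s t)
        \<Longrightarrow> (\<Sum>s\<in>S. p s * f s) - (\<Sum>t\<in>S. q t * g t) \<le> V"
  shows "\<exists>\<pi>. (\<forall>s t. 0 \<le> \<pi> (s, t)) \<and> (\<forall>s\<in>S. (\<Sum>t\<in>S. \<pi> (s, t)) = p s) \<and>
     (\<forall>t\<in>S. (\<Sum>s\<in>S. \<pi> (s, t)) = q t) \<and> (\<Sum>(s, t)\<in>S \<times> S. \<pi> (s, t) * c s t) \<le> V"
proof -
  define K where "K = PiE UNIV (\<lambda>z. if z \<in> S \<times> S then {0..4::real} else {0})"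
  define E where "E \<pi> = (\<Sum>s\<in>S. ((\<Sum>t\<in>S. \<pi> (s, t)) - p s)\<^sup>2)
     + (\<Sum>t\<in>S. ((\<Sum>s\<in>S. \<pi> (s, t)) - q t)\<^sup>2)" for \<pi>
  define F where "F \<pi> = E \<pi> + max 0 ((\<Sum>(s, t)\<in>S \<times> S. \<pi> (s, t) * c s t) - V)" for \<pi>
  have E_nonneg: "0 \<le> E \<pi>" for \<pi> by (simp add: E_def sum_nonneg)
  have "0 \<le> V" using dual[of "\<lambda>_. 0" "\<lambda>_. 0"] c by simp
  have "compact K" unfolding K_def by (intro compact_box_fun) auto
  moreover have "K \<noteq> {}" by (auto simp: K_def PiE_eq_empty_iff)
  moreover have "continuous_on K F"
    unfolding F_def E_def case_prod_unfold
    by (intro continuous_intros continuous_on_coordinate)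
  ultimately obtain \<pi> where \<pi>: "\<pi> \<in> K" and min: "\<And>\<rho>. \<rho> \<in> K \<Longrightarrow> F \<pi> \<le> F \<rho>"
    using continuous_attains_inf[of K F] by blast
  have "F \<pi> \<le> e" if "0 < e" for e
  proof -
    \<comment> \<open>This value is used as the penalty parameter, so that the guaranteed defect,
      parameter times \<open>V\<close>, is below \<open>e\<close>; the added 1 covers
      \<open>V = 0\<close>.\<close>
    have pos: "0 < e / (V + 1)" using that \<open>0 \<le> V\<close> by simp
    have "\<exists>\<rho>\<in>K. (\<Sum>(s, t)\<in>S \<times> S. \<rho> (s, t) * c s t) \<le> V \<and> E \<rho> \<le> e / (V + 1) * V"
      unfolding K_def E_def
      by (rule penalised_minimiser[OF S _ _ pq(3,4)]) (fact pq c dual pos)+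
    then obtain \<rho> where \<rho>: "\<rho> \<in> K" "(\<Sum>(s, t)\<in>S \<times> S. \<rho> (s, t) * c s t) \<le> V" "E \<rho> \<le> e / (V + 1) * V"
      by blast
    have "F \<pi> \<le> F \<rho>" by (rule min[OF \<rho>(1)])
    also have "\<dots> \<le> e / (V + 1) * V" using \<rho> by (simp add: F_def)
    also have "\<dots> \<le> e" using that \<open>0 \<le> V\<close> by (simp add: field_simps)
    finally show ?thesis .
  qed
  then have "F \<pi> \<le> 0" by (rule field_le_epsilon[of _ 0, simplified])
  then have "E \<pi> = 0" and V: "(\<Sum>(s, t)\<in>S \<times> S. \<pi> (s, t) * c s t) \<le> V"
    using E_nonneg[of \<pi>] unfolding F_def by linarith+
  then have "(\<Sum>s\<in>S. ((\<Sum>t\<in>S. \<pi> (s, t)) - p s)\<^sup>2) = 0" "(\<Sum>t\<in>S. ((\<Sum>s\<in>S. \<pi> (s, t)) - q t)\<^sup>2) = 0"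
    unfolding E_def by (simp_all add: add_nonneg_eq_0_iff sum_nonneg)
  then have "\<forall>s\<in>S. (\<Sum>t\<in>S. \<pi> (s, t)) = p s" "\<forall>t\<in>S. (\<Sum>s\<in>S. \<pi> (s, t)) = q t"
    using S by (simp_all add: sum_nonneg_eq_0_iff)
  moreover have "0 \<le> \<pi> z" for z
    using \<pi> unfolding K_def by (rule box_nonneg)
  ultimately show ?thesis using V by blast
qed

section \<open>Transport-entropy inequalities imply concentration\<close>

text \<open>A finite product of countable discrete spaces is again discrete. All sections and
  partial integrals in the induction over the number of factors are therefore measurable, which is
  the gain from passing to cells.\<close>

lemma measurable_PiM_countable:
  fixes m :: "'k::countable measure"
  assumes "sets m = UNIV" "finite I"
  shows "f \<in> borel_measurable (PiM I (\<lambda>_. m))"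
proof -
  have "sets (PiM I (\<lambda>_. m)) = sets (PiM I (\<lambda>_. count_space (UNIV :: 'k set)))"
    using assms by (intro sets_PiM_cong) auto
  also have "\<dots> = sets (count_space (PiE I (\<lambda>_. UNIV)))"
    using assms by (subst count_space_PiM_finite) auto
  finally show ?thesis
    using sets_eq_imp_space_eq by (auto simp: measurable_def)
qed

text \<open>These are the functions exp f with f bounded, written in \<open>ennreal\<close>. The
  class is stable under integrating out a coordinate against a probability measure and under
  positive scaling, so the induction on the dimension stays inside it; and its logarithms are
  bounded test functions.\<close>

definition two_sided_bounded :: "('a \<Rightarrow> ennreal) \<Rightarrow> bool" where
  "two_sided_bounded U \<longleftrightarrow> (\<exists>l u. 0 < l \<and> u < \<infinity> \<and> (\<forall>x. l \<le> U x \<and> U x \<le> u))"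

lemma two_sided_bounded_nn_integral:
  assumes "prob_space m" "two_sided_bounded U"
  shows "two_sided_bounded (\<lambda>x. \<integral>\<^sup>+ y. U (g x y) \<partial>m)"
proof -
  interpret prob_space m by fact
  obtain l u where lu: "0 < l" "u < \<infinity>" "\<And>x. l \<le> U x" "\<And>x. U x \<le> u"
    using assms(2) by (auto simp: two_sided_bounded_def)
  have "l \<le> (\<integral>\<^sup>+ y. U (g x y) \<partial>m)" "(\<integral>\<^sup>+ y. U (g x y) \<partial>m) \<le> u" for x
    using nn_integral_mono[of m "\<lambda>_. l" "\<lambda>y. U (g x y)"] nn_integral_mono[of m "\<lambda>y. U (g x y)" "\<lambda>_. u"] lu
    by (simp_all add: emeasure_space_1)
  with lu show ?thesis unfolding two_sided_bounded_def by blast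
qed

lemma two_sided_bounded_cmult:
  assumes "0 < c" "two_sided_bounded U"
  shows "two_sided_bounded (\<lambda>x. ennreal c * U x)"
proof -
  obtain l u where "0 < l" "u < \<infinity>" "\<And>x. l \<le> U x" "\<And>x. U x \<le> u"
    using assms(2) by (auto simp: two_sided_bounded_def)
  then have "0 < ennreal c * l" "ennreal c * u < \<infinity>" "\<And>x. ennreal c * l \<le> ennreal c * U x"
    "\<And>x. ennreal c * U x \<le> ennreal c * u"
    using assms(1) by (auto intro: mult_left_mono simp: ennreal_zero_less_mult_iff ennreal_mult_less_top)
  then show ?thesis unfolding two_sided_bounded_def by blast
qed

lemma two_sided_bounded_comp: "two_sided_bounded U \<Longrightarrow> two_sided_bounded (\<lambda>x. U (g x))"
  unfolding two_sided_bounded_def by blast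

text \<open>Property (tau) in multiplicative form, with U = exp f, V = exp (-g) and K = exp cost, so
  that additivity of the cost becomes a product of kernels. For frozen first n coordinates, the
  one-dimensional case in the last coordinate shows that the partial integrals of U and V satisfy
  the same hypothesis with one factor less.\<close>

lemma property_tau_tensorises:
  fixes m :: "'k::countable measure" and K :: "'k \<Rightarrow> 'k \<Rightarrow> real" and n :: nat
  assumes m: "prob_space m" "sets m = UNIV" and K: "\<And>x y. 0 < K x y"
    and base: "\<And>U V. two_sided_bounded U \<Longrightarrow> two_sided_bounded V \<Longrightarrow> (\<And>x y. U x * V y \<le> ennreal (K x y))
        \<Longrightarrow> (\<integral>\<^sup>+ x. U x \<partial>m) * (\<integral>\<^sup>+ x. V x \<partial>m) \<le> 1"
  shows "two_sided_bounded U \<Longrightarrow> two_sided_bounded V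
      \<Longrightarrow> (\<And>x y. x \<in> PiE {..<n} (\<lambda>_. UNIV) \<Longrightarrow> y \<in> PiE {..<n} (\<lambda>_. UNIV)
          \<Longrightarrow> U x * V y \<le> ennreal (\<Prod>i<n. K (x i) (y i)))
      \<Longrightarrow> (\<integral>\<^sup>+ x. U x \<partial>PiM {..<n} (\<lambda>_. m)) * (\<integral>\<^sup>+ x. V x \<partial>PiM {..<n} (\<lambda>_. m)) \<le> 1"
proof (induction n arbitrary: U V)
  case 0
  interpret product_sigma_finite "\<lambda>_::nat. m"
    using m(1) by (simp add: product_sigma_finite_def prob_space_imp_sigma_finite)
  have "W \<in> borel_measurable (count_space {\<lambda>_. undefined})" for W :: "(nat \<Rightarrow> 'k) \<Rightarrow> ennreal"
    by simp
  with "0.prems"(3)[of "\<lambda>_. undefined" "\<lambda>_. undefined"] show ?case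
    by (simp add: PiM_empty nn_integral_count_space_finite)
next
  case (Suc n)
  interpret product_sigma_finite "\<lambda>_::nat. m"
    using m(1) by (simp add: product_sigma_finite_def prob_space_imp_sigma_finite)
  have space_m: "space m = UNIV" using m(2) sets_eq_imp_space_eq[of m "count_space UNIV"] by simp
  have meas: "f \<in> borel_measurable m" for f :: "'k \<Rightarrow> ennreal"
    using m(2) space_m by (auto simp: measurable_def)
  have iterate: "(\<integral>\<^sup>+ x. W x \<partial>PiM {..<Suc n} (\<lambda>_. m))
      = (\<integral>\<^sup>+ x. \<integral>\<^sup>+ a. W (x(n := a)) \<partial>m \<partial>PiM {..<n} (\<lambda>_. m))" for W :: "(nat \<Rightarrow> 'k) \<Rightarrow> ennreal"
    unfolding lessThan_Suc
    by (rule product_nn_integral_insert) (auto intro: measurable_PiM_countable[OF m(2)])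
  have "(\<integral>\<^sup>+ a. U (x(n := a)) \<partial>m) * (\<integral>\<^sup>+ b. V (y(n := b)) \<partial>m) \<le> ennreal (\<Prod>i<n. K (x i) (y i))"
    if xy: "x \<in> PiE {..<n} (\<lambda>_. UNIV)" "y \<in> PiE {..<n} (\<lambda>_. UNIV)" for x y
  proof -
    define c where "c = (\<Prod>i<n. K (x i) (y i))"
    have c: "0 < c" unfolding c_def using K by (intro prod_pos) auto
    have "(\<integral>\<^sup>+ a. ennreal (1 / c) * U (x(n := a)) \<partial>m) * (\<integral>\<^sup>+ b. V (y(n := b)) \<partial>m) \<le> 1"
    proof (rule base)
      show "two_sided_bounded (\<lambda>a. ennreal (1 / c) * U (x(n := a)))"
        using c two_sided_bounded_comp[OF Suc.prems(1)] by (rule two_sided_bounded_cmult[of "1 / c", simplified])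
      show "two_sided_bounded (\<lambda>b. V (y(n := b)))"
        using Suc.prems(2) by (rule two_sided_bounded_comp)
      fix a b
      have "U (x(n := a)) * V (y(n := b)) \<le> ennreal (\<Prod>i<Suc n. K ((x(n := a)) i) ((y(n := b)) i))"
        using xy by (intro Suc.prems(3)) (auto simp: PiE_iff extensional_def)
      also have "(\<Prod>i<Suc n. K ((x(n := a)) i) ((y(n := b)) i)) = c * K a b"
        by (simp add: c_def)
      finally have "ennreal (1 / c) * (U (x(n := a)) * V (y(n := b))) \<le> ennreal (1 / c) * ennreal (c * K a b)"
        by (rule mult_left_mono) simp
      also have "\<dots> = ennreal (K a b)"
        using c K[of a b] by (simp flip: ennreal_mult)
      finally show "ennreal (1 / c) * U (x(n := a)) * V (y(n := b)) \<le> ennreal (K a b)"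
        by (simp add: mult.assoc)
    qed
    then have "ennreal c * (ennreal (1 / c) * ((\<integral>\<^sup>+ a. U (x(n := a)) \<partial>m) * (\<integral>\<^sup>+ b. V (y(n := b)) \<partial>m))) \<le> ennreal c * 1"
      by (intro mult_left_mono) (simp_all add: nn_integral_cmult[OF meas] mult.assoc)
    moreover have "ennreal c * ennreal (1 / c) = 1"
      using c by (simp flip: ennreal_mult)
    ultimately show ?thesis
      unfolding c_def[symmetric] by (simp add: mult.assoc[symmetric])
  qed
  then show ?case
    unfolding iterate
    by (rule Suc.IH[OF two_sided_bounded_nn_integral[OF m(1) Suc.prems(1)]
          two_sided_bounded_nn_integral[OF m(1) Suc.prems(2)]])
qed

section \<open>Entropy of exponential densities and weak duality\<close>

lemma integral_le_nn_integral:
  assumes "integrable M u"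
  shows "ennreal (\<integral>x. u x \<partial>M) \<le> (\<integral>\<^sup>+ x. ennreal (u x) \<partial>M)"
proof -
  have "ennreal (\<integral>x. u x \<partial>M) \<le> ennreal (\<integral>x. max 0 (u x) \<partial>M)"
    using assms by (intro ennreal_leI integral_mono) auto
  also have "\<dots> = (\<integral>\<^sup>+ x. ennreal (max 0 (u x)) \<partial>M)"
    using assms by (intro nn_integral_eq_integral[symmetric]) auto
  finally show ?thesis by (simp add: max.commute)
qed

lemma rel_entropy_eq_integral:
  assumes ac: "absolutely_continuous \<mu> \<nu>"
    and int: "integrable \<nu> (\<lambda>x. ln (enn2real (RN_deriv \<mu> \<nu> x)))"
  shows "rel_entropy \<nu> \<mu> = ereal (\<integral>x. ln (enn2real (RN_deriv \<mu> \<nu> x)) \<partial>\<nu>)"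
proof -
  define u where "u x = ln (enn2real (RN_deriv \<mu> \<nu> x))" for x
  have u: "integrable \<nu> u" using int by (simp add: u_def[abs_def])
  have *: "enn2ereal (\<integral>\<^sup>+ x. ennreal (max 0 (v x)) \<partial>\<nu>) = ereal (\<integral>x. max 0 (v x) \<partial>\<nu>)"
    if "integrable \<nu> v" for v :: "_ \<Rightarrow> real"
    using that by (subst nn_integral_eq_integral) (auto intro: enn2ereal_ennreal integral_nonneg)
  have "rel_entropy \<nu> \<mu> = ereal (\<integral>x. max 0 (u x) \<partial>\<nu>) - ereal (\<integral>x. max 0 (- u x) \<partial>\<nu>)"
    unfolding rel_entropy_def Let_def u_def[symmetric] *[OF u]
    using *[of "\<lambda>x. - u x"] u ac by simp
  also have "\<dots> = ereal (\<integral>x. max 0 (u x) - max 0 (- u x) \<partial>\<nu>)"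
    using u by simp
  also have "(\<lambda>x. max 0 (u x) - max 0 (- u x)) = u" by auto
  finally show ?thesis by (simp add: u_def[abs_def])
qed

lemma bounded_integrable:
  assumes "prob_space M" "f \<in> borel_measurable M" "\<And>x. \<bar>f x\<bar> \<le> (B::real)"
  shows "integrable M f"
proof -
  interpret prob_space M by fact
  show ?thesis using assms(2,3) by (intro integrable_const_bound[of _ B]) auto
qed

text \<open>The logarithm of the density is h - ln Z almost everywhere, which makes the entropy
  explicit; boundedness of h keeps Z positive and all integrals finite.\<close>

lemma gibbs_density:
  fixes h :: "'a \<Rightarrow> real"
  assumes M: "prob_space \<mu>" and h: "h \<in> borel_measurable \<mu>" "\<And>x. \<bar>h x\<bar> \<le> B"
  defines "Z \<equiv> \<integral>x. exp (h x) \<partial>\<mu>"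
  defines "\<nu> \<equiv> density \<mu> (\<lambda>x. ennreal (exp (h x) / Z))"
  shows "0 < Z" "prob_space \<nu>" "rel_entropy \<nu> \<mu> = ereal ((\<integral>x. h x \<partial>\<nu>) - ln Z)"
proof -
  interpret prob_space \<mu> by fact
  note h(1)[measurable]
  have int: "integrable \<mu> (\<lambda>x. exp (h x))"
    using h(2) by (intro bounded_integrable[OF M, of _ "exp B"]) (auto simp: abs_le_iff)
  have "exp (- B) \<le> Z"
  proof -
    have "(\<integral>x. exp (- B) \<partial>\<mu>) \<le> Z"
      unfolding Z_def using h(2) int by (intro integral_mono) (auto simp: abs_le_iff minus_le_iff)
    then show ?thesis by (simp add: prob_space)
  qed
  then show Z: "0 < Z" using exp_gt_zero[of "- B"] by linarith
  have "(\<integral>\<^sup>+ x. ennreal (exp (h x) / Z) \<partial>\<mu>) = 1"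
    using int Z by (subst nn_integral_eq_integral) (auto simp: Z_def)
  then show \<nu>: "prob_space \<nu>"
    by (intro prob_spaceI) (simp add: \<nu>_def emeasure_density)
  have sets: "sets \<nu> = sets \<mu>" by (simp add: \<nu>_def)
  have ac: "absolutely_continuous \<mu> \<nu>"
    unfolding \<nu>_def by (intro absolutely_continuousI_density) auto
  have "AE x in \<mu>. ennreal (exp (h x) / Z) = RN_deriv \<mu> \<nu> x"
    by (intro RN_deriv_unique) (auto simp: \<nu>_def)
  then have "AE x in \<nu>. ennreal (exp (h x) / Z) = RN_deriv \<mu> \<nu> x"
    by (rule absolutely_continuous_AE[OF sets ac])
  then have AE: "AE x in \<nu>. ln (enn2real (RN_deriv \<mu> \<nu> x)) = h x - ln Z"
  proof eventually_elim
    case (elim x)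
    then have "enn2real (RN_deriv \<mu> \<nu> x) = exp (h x) / Z"
      using Z by (metis enn2real_ennreal divide_nonneg_pos exp_ge_zero)
    then show ?case using Z by (simp add: ln_div)
  qed
  have h_int: "integrable \<nu> h" using h \<nu> sets by (intro bounded_integrable) auto
  interpret \<nu>: prob_space \<nu> by fact
  have meas: "(\<lambda>x. ln (enn2real (RN_deriv \<mu> \<nu> x))) \<in> borel_measurable \<nu>"
    by (subst measurable_cong_sets[OF sets refl]) measurable
  have "integrable \<nu> (\<lambda>x. ln (enn2real (RN_deriv \<mu> \<nu> x)))"
    using h_int AE meas by (subst integrable_cong_AE[where g = "\<lambda>x. h x - ln Z"]) auto
  from rel_entropy_eq_integral[OF ac this]
  show "rel_entropy \<nu> \<mu> = ereal ((\<integral>x. h x \<partial>\<nu>) - ln Z)"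
    using integral_cong_AE[OF meas _ AE] h_int by (simp add: \<nu>.prob_space)
qed

lemma weak_duality:
  assumes \<nu>: "prob_space \<nu>" "sets \<nu> = sets borel" and \<mu>: "prob_space \<mu>" "sets \<mu> = sets borel"
    and f: "f \<in> borel_measurable borel" "\<And>x. \<bar>f x\<bar> \<le> B"
    and g: "g \<in> borel_measurable borel" "\<And>x. \<bar>g x\<bar> \<le> B"
    and fg: "\<And>x y. f x - g y \<le> cost p (x - y)"
  shows "ennreal ((\<integral>x. f x \<partial>\<nu>) - (\<integral>x. g x \<partial>\<mu>)) \<le> transport_cost p \<nu> \<mu>"
  unfolding transport_cost_def
proof (rule INF_greatest)
  fix \<pi> assume "\<pi> \<in> couplings \<nu> \<mu>"
  then have \<pi>: "prob_space \<pi>" "sets \<pi> = sets (\<nu> \<Otimes>\<^sub>M \<mu>)" "distr \<pi> \<nu> fst = \<nu>" "distr \<pi> \<mu> snd = \<mu>"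
    by (auto simp: couplings_def)
  have m: "fst \<in> measurable \<pi> \<nu>" "snd \<in> measurable \<pi> \<mu>"
    by (auto simp: measurable_cong_sets[OF \<pi>(2) refl])
  have f': "f \<in> borel_measurable \<nu>" and g': "g \<in> borel_measurable \<mu>"
    using f(1) g(1) by (simp_all add: measurable_cong_sets[OF \<nu>(2) refl] measurable_cong_sets[OF \<mu>(2) refl])
  have int: "integrable \<pi> (\<lambda>z. f (fst z))" "integrable \<pi> (\<lambda>z. g (snd z))"
    using f(2) g(2) measurable_compose[OF m(1) f'] measurable_compose[OF m(2) g']
    by (auto intro: bounded_integrable[OF \<pi>(1)])
  have "(\<integral>x. f x \<partial>\<nu>) = (\<integral>z. f (fst z) \<partial>\<pi>)"
    by (subst \<pi>(3)[symmetric]) (rule integral_distr[OF m(1) f'])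
  moreover have "(\<integral>x. g x \<partial>\<mu>) = (\<integral>z. g (snd z) \<partial>\<pi>)"
    by (subst \<pi>(4)[symmetric]) (rule integral_distr[OF m(2) g'])
  ultimately have "ennreal ((\<integral>x. f x \<partial>\<nu>) - (\<integral>x. g x \<partial>\<mu>)) = ennreal (\<integral>z. f (fst z) - g (snd z) \<partial>\<pi>)"
    using int by simp
  also have "\<dots> \<le> (\<integral>\<^sup>+ z. ennreal (f (fst z) - g (snd z)) \<partial>\<pi>)"
    using int by (intro integral_le_nn_integral) auto
  also have "\<dots> \<le> (\<integral>\<^sup>+ xy. ennreal (\<Sum>j\<in>UNIV. alpha_p p (fst xy $ j - snd xy $ j)) \<partial>\<pi>)"
    using fg by (intro nn_integral_mono ennreal_leI) (simp add: cost_def)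
  finally show "ennreal ((\<integral>x. f x \<partial>\<nu>) - (\<integral>x. g x \<partial>\<mu>))
      \<le> (\<integral>\<^sup>+ xy. ennreal (\<Sum>j\<in>UNIV. alpha_p p (fst xy $ j - snd xy $ j)) \<partial>\<pi>)" .
qed

text \<open>For the density proportional to exp (f / C), C times the entropy is the mean of f under
  it minus C ln Z. That mean of f also appears in the weak duality bound and cancels, leaving C ln Z
  at most the \<open>\<mu>\<close>-mean of g.\<close>

lemma transport_entropy_imp_exp_moment:
  assumes \<mu>: "prob_space \<mu>" "sets \<mu> = sets borel" and C: "0 < C" "transport_entropy \<mu> p C"
    and f: "f \<in> borel_measurable borel" "\<And>x. \<bar>f x\<bar> \<le> B"
    and g: "g \<in> borel_measurable borel" "\<And>x. \<bar>g x\<bar> \<le> B"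
    and fg: "\<And>x y. f x - g y \<le> cost p (x - y)"
  shows "(\<integral>x. exp (f x / C) \<partial>\<mu>) \<le> exp ((\<integral>x. g x \<partial>\<mu>) / C)"
proof -
  define Z where "Z = (\<integral>x. exp (f x / C) \<partial>\<mu>)"
  define \<nu> where "\<nu> = density \<mu> (\<lambda>x. ennreal (exp (f x / C) / Z))"
  have h: "(\<lambda>x. f x / C) \<in> borel_measurable \<mu>"
    using f(1) by (simp add: measurable_cong_sets[OF \<mu>(2) refl])
  have "\<bar>f x / C\<bar> \<le> B / C" for x using f(2)[of x] C(1) by (simp add: divide_right_mono)
  note gd = gibbs_density[OF \<mu>(1) h this, folded Z_def, folded \<nu>_def]
  have sets: "sets \<nu> = sets borel" by (simp add: \<nu>_def \<mu>(2))
  let ?D = "(\<integral>x. f x \<partial>\<nu>) - (\<integral>x. g x \<partial>\<mu>)"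
  \<comment> \<open>\<open>ennreal\<close> truncates negative numbers to 0, so only this inequality
    holds; it has the direction required.\<close>
  have "ereal ?D \<le> enn2ereal (ennreal ?D)"
    by (cases "0 \<le> ?D") (auto simp: enn2ereal_ennreal ennreal_neg zero_ennreal.rep_eq)
  also have "\<dots> \<le> enn2ereal (transport_cost p \<nu> \<mu>)"
    using weak_duality[OF gd(2) sets \<mu> f g fg] by (simp add: less_eq_ennreal.rep_eq)
  also have "\<dots> \<le> ereal C * rel_entropy \<nu> \<mu>"
    using C(2) gd(2) sets unfolding transport_entropy_def by blast
  also have "\<dots> = ereal ((\<integral>x. f x \<partial>\<nu>) - C * ln Z)"
    unfolding gd(3) using C(1) by (simp add: field_simps)
  finally have "ln Z \<le> (\<integral>x. g x \<partial>\<mu>) / C"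
    using C(1) by (simp add: field_simps)
  then show ?thesis using gd(1) unfolding Z_def[symmetric] by (metis exp_le_cancel_iff exp_ln)
qed

section \<open>Minkowski enlargements and additive cost\<close>

text \<open>The p-th power of \<open>lp_norm\<close> for positive p. Being additive over coordinates
  and homogeneous of degree p, it turns membership in a scaled ball into a condition that can be
  compared with the cost.\<close>

definition total_pow :: "nat \<Rightarrow> real \<Rightarrow> (nat \<Rightarrow> real^'d) \<Rightarrow> real" where
  "total_pow n p u = (\<Sum>i<n. \<Sum>j\<in>UNIV. \<bar>u i $ j\<bar> powr p)"

lemma total_pow_nonneg: "0 \<le> total_pow n p u"
  by (simp add: total_pow_def sum_nonneg)

lemma lp_norm_le_1_iff:
  assumes "0 < p"
  shows "lp_norm n p u \<le> 1 \<longleftrightarrow> total_pow n p u \<le> 1"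
proof (cases "total_pow n p u \<le> 1")
  case True
  then have "total_pow n p u powr (1 / p) \<le> 1"
    using assms total_pow_nonneg[of n p u] by (intro powr_le1) auto
  with True show ?thesis by (simp add: lp_norm_def total_pow_def[symmetric])
next
  case False
  then have "1 < total_pow n p u powr (1 / p)" using assms by (intro gr_one_powr) auto
  with False show ?thesis by (simp add: lp_norm_def total_pow_def[symmetric])
qed

lemma total_pow_scale: "0 \<le> c \<Longrightarrow> total_pow n p (\<lambda>i. c *\<^sub>R u i) = c powr p * total_pow n p u"
  by (simp add: total_pow_def abs_mult powr_mult sum_distrib_left)

lemma total_pow_restrict: "total_pow n p (restrict u {..<n}) = total_pow n p u"
  by (simp add: total_pow_def)

lemma scale_unit_ball_imp:
  assumes "0 < p" "0 \<le> c" "u \<in> scale_set n c (unit_ball_p n p)"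
  shows "total_pow n p u \<le> c powr p"
proof -
  obtain y where y: "u = restrict (\<lambda>i. c *\<^sub>R y i) {..<n}" "lp_norm n p y \<le> 1"
    using assms(3) by (auto simp: scale_set_def unit_ball_p_def)
  then have "total_pow n p y \<le> 1" using assms(1) by (simp add: lp_norm_le_1_iff)
  then have "c powr p * total_pow n p y \<le> c powr p * 1" by (intro mult_left_mono) auto
  then show ?thesis using assms(2) by (simp add: y(1) total_pow_restrict total_pow_scale)
qed

lemma scale_unit_ballI:
  assumes "0 < p" "0 < c" "u \<in> PiE {..<n} (\<lambda>_. UNIV)" "total_pow n p u \<le> c powr p"
  shows "u \<in> scale_set n c (unit_ball_p n p)"
proof -
  let ?y = "restrict (\<lambda>i. (1 / c) *\<^sub>R u i) {..<n}"
  have "total_pow n p ?y = (1 / c) powr p * total_pow n p u"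
    using assms(2) by (subst total_pow_restrict) (rule total_pow_scale, simp)
  also have "\<dots> \<le> (1 / c) powr p * c powr p"
    using assms(4) by (intro mult_left_mono) auto
  also have "\<dots> = 1" using assms(2) by (simp flip: powr_mult)
  finally have "?y \<in> unit_ball_p n p" using assms(1) by (simp add: unit_ball_p_def lp_norm_le_1_iff)
  moreover have "u = restrict (\<lambda>i. c *\<^sub>R ?y i) {..<n}"
    using assms(2,3) by (auto simp: PiE_iff extensional_def fun_eq_iff)
  ultimately show ?thesis unfolding scale_set_def by blast
qed

abbreviation enlargement :: "nat \<Rightarrow> real \<Rightarrow> real \<Rightarrow> (nat \<Rightarrow> real^'d) set \<Rightarrow> (nat \<Rightarrow> real^'d) set" where
  "enlargement n p r A \<equiv> mink_sum n (mink_sum n A (scale_set n (sqrt r) (unit_ball_p n 2)))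
     (scale_set n (r powr (1/p)) (unit_ball_p n p))"

text \<open>The displacement is u + v, so \<open>cost_add2\<close> gives a factor 2.
  \<open>alpha_p\<close> is below the square, used for u, and below the p-th power, used for v; both
  totals are at most r, whence 2 (r + r).\<close>

lemma enlargement_imp_cost:
  fixes A :: "(nat \<Rightarrow> real^'d) set"
  assumes p: "1 \<le> p" "p \<le> 2" and "0 \<le> r" "x \<in> enlargement n p r A"
  shows "\<exists>a\<in>A. (\<Sum>i<n. cost p (x i - a i)) \<le> 4 * r"
proof -
  obtain a u v where auv: "a \<in> A" "u \<in> scale_set n (sqrt r) (unit_ball_p n 2)"
    "v \<in> scale_set n (r powr (1/p)) (unit_ball_p n p)"
    "x = restrict (\<lambda>i. restrict (\<lambda>i. a i + u i) {..<n} i + v i) {..<n}"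
    using assms(4) by (auto simp: mink_sum_def)
  have u: "total_pow n 2 u \<le> r" and v: "total_pow n p v \<le> r"
    using scale_unit_ball_imp[OF _ _ auv(2)] scale_unit_ball_imp[OF _ _ auv(3)] \<open>0 \<le> r\<close> p
    by (simp_all add: powr_powr powr_numeral)
  have "(\<Sum>i<n. cost p (x i - a i)) \<le> (\<Sum>i<n. 2 * (cost p (u i) + cost p (v i)))"
    using p cost_add2[of p "u _" "v _"] by (intro sum_mono) (simp add: auv(4))
  also have "\<dots> = 2 * ((\<Sum>i<n. cost p (u i)) + (\<Sum>i<n. cost p (v i)))"
    by (simp add: sum_distrib_left sum.distrib)
  also have "\<dots> \<le> 2 * (total_pow n 2 u + total_pow n p v)"
    unfolding cost_def total_pow_def
    by (intro mult_left_mono add_mono sum_mono) (simp_all add: alpha_p_def powr_numeral)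
  also have "\<dots> \<le> 4 * r" using u v by simp
  finally show ?thesis using auv(1) by blast
qed

text \<open>After trimming \<open>3 * \<epsilon>\<close> from the modulus of each coordinate of x -
  a, a remainder at most 1 has \<open>alpha_p\<close> equal to its square and goes to the l2 ball,
  while a larger one has \<open>alpha_p\<close> equal to its p-th power and goes to the lp ball.
  What was trimmed also goes to the l2 ball, where its norm is at most
  \<open>3 * \<epsilon> * sqrt (n * CARD('d))\<close>; this is why the radius has to grow from r to
  r'.\<close>

lemma cost_imp_enlargement:
  fixes A :: "(nat \<Rightarrow> real^'d) set"
  assumes p: "1 \<le> p" "p \<le> 2" and r: "0 \<le> r" "r < r'"
    and \<epsilon>: "0 \<le> \<epsilon>" "3 * \<epsilon> * sqrt (n * CARD('d)) \<le> sqrt r' - sqrt r"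
    and a: "a \<in> A" "a \<in> PiE {..<n} (\<lambda>_. UNIV)" and x: "x \<in> PiE {..<n} (\<lambda>_. UNIV)"
    and small: "(\<Sum>i<n. \<Sum>j\<in>UNIV. alpha_p p (max 0 (\<bar>x i $ j - a i $ j\<bar> - 3 * \<epsilon>))) \<le> r"
  shows "x \<in> enlargement n p r' A"
proof -
  define t where "t i j = max 0 (\<bar>x i $ j - a i $ j\<bar> - 3 * \<epsilon>)" for i j
  define w where "w i j = (if t i j \<le> 1 then 0 else sgn (x i $ j - a i $ j) * t i j)" for i j
  define v where "v = restrict (\<lambda>i. \<chi> j. w i j) {..<n}"
  define u where "u = restrict (\<lambda>i. \<chi> j. x i $ j - a i $ j - w i j) {..<n}"
  have t_nonneg: "0 \<le> t i j" for i j by (simp add: t_def)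
  have w_abs: "\<bar>w i j\<bar> = (if t i j \<le> 1 then 0 else t i j)" for i j
    using t_nonneg[of i j] \<epsilon>(1) by (auto simp: w_def t_def abs_mult abs_sgn_eq)
  have u_abs: "\<bar>x i $ j - a i $ j - w i j\<bar> \<le> (if t i j \<le> 1 then t i j else 0) + 3 * \<epsilon>" for i j
    using \<epsilon>(1) by (auto simp: w_def t_def sgn_if)
  have "total_pow n p v \<le> (\<Sum>i<n. \<Sum>j\<in>UNIV. alpha_p p (t i j))"
    unfolding total_pow_def v_def using p t_nonneg
    by (intro sum_mono) (auto simp: w_abs alpha_p_ge_1 alpha_p_nonneg)
  also have "\<dots> \<le> r'" using small r by (simp add: t_def)
  finally have "total_pow n p v \<le> (r' powr (1/p)) powr p"
    using r p by (simp add: powr_powr)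
  then have v: "v \<in> scale_set n (r' powr (1/p)) (unit_ball_p n p)"
    using r p by (intro scale_unit_ballI) (auto simp: v_def)
  let ?I = "{..<n} \<times> (UNIV :: 'd set)"
  have "sqrt (total_pow n 2 u) = L2_set (\<lambda>(i, j). x i $ j - a i $ j - w i j) ?I"
    by (simp add: L2_set_def total_pow_def u_def sum.cartesian_product case_prod_unfold powr_numeral)
  also have "\<dots> \<le> L2_set (\<lambda>(i, j). (if t i j \<le> 1 then t i j else 0) + 3 * \<epsilon>) ?I"
  proof -
    have "(x i $ j - a i $ j - w i j)\<^sup>2 \<le> ((if t i j \<le> 1 then t i j else 0) + 3 * \<epsilon>)\<^sup>2" for i j
      using power_mono[OF u_abs[of i j] abs_ge_zero, of 2] by simp
    then show ?thesis
      unfolding L2_set_def by (intro real_sqrt_le_mono sum_mono) (simp add: case_prod_unfold)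
  qed
  also have "\<dots> = L2_set (\<lambda>z. (case z of (i, j) \<Rightarrow> if t i j \<le> 1 then t i j else 0) + 3 * \<epsilon>) ?I"
    by (simp add: case_prod_unfold)
  also have "\<dots> \<le> L2_set (\<lambda>(i, j). if t i j \<le> 1 then t i j else 0) ?I + L2_set (\<lambda>_. 3 * \<epsilon>) ?I"
    by (rule L2_set_triangle_ineq)
  also have "L2_set (\<lambda>(i, j). if t i j \<le> 1 then t i j else 0) ?I \<le> sqrt r"
  proof -
    have "(\<Sum>(i, j)\<in>?I. (if t i j \<le> 1 then t i j else 0)\<^sup>2) \<le> (\<Sum>(i, j)\<in>?I. alpha_p p (t i j))"
      using p t_nonneg by (intro sum_mono) (auto simp: alpha_p_le_1 alpha_p_nonneg)
    also have "\<dots> \<le> r" using small by (simp add: t_def sum.cartesian_product)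
    finally show ?thesis by (simp add: L2_set_def case_prod_unfold)
  qed
  also have "L2_set (\<lambda>_. 3 * \<epsilon>) ?I = 3 * \<epsilon> * sqrt (n * CARD('d))"
    using \<epsilon>(1) by (simp add: L2_set_def real_sqrt_mult card_cartesian_product)
  finally have "sqrt (total_pow n 2 u) \<le> sqrt r'" using \<epsilon>(2) by linarith
  then have "total_pow n 2 u \<le> sqrt r' powr 2" using r by (simp add: powr_numeral)
  then have u: "u \<in> scale_set n (sqrt r') (unit_ball_p n 2)"
    using r by (intro scale_unit_ballI) (auto simp: u_def)
  have "x = restrict (\<lambda>i. restrict (\<lambda>i. a i + u i) {..<n} i + v i) {..<n}"
    using x a(2) by (auto simp: fun_eq_iff u_def v_def vec_eq_iff PiE_iff extensional_def)
  then show ?thesis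
    using a(1) u v unfolding mink_sum_def by blast
qed

section \<open>Discretisation by a grid of cubes\<close>

definition cell :: "real \<Rightarrow> real^'d \<Rightarrow> int^'d" where
  "cell \<epsilon> x = (\<chi> j. \<lfloor>x $ j / \<epsilon>\<rfloor>)"

text \<open>The shift \<open>s\<close> compensates the rounding: with \<open>s = 1\<close> the cost of two cells is a lower bound
  for the cost of their points, and two such steps dominate half the cost with \<open>s = 2\<close>.\<close>

definition cell_cost :: "real \<Rightarrow> real \<Rightarrow> real \<Rightarrow> int^'d \<Rightarrow> int^'d \<Rightarrow> real" where
  "cell_cost p \<epsilon> s k l = (\<Sum>j\<in>UNIV. alpha_p p (\<epsilon> * max 0 (\<bar>real_of_int (k $ j - l $ j)\<bar> - s)))"

lemma cell_cost_nonneg: "0 \<le> cell_cost p \<epsilon> s k l"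
  by (simp add: cell_cost_def sum_nonneg alpha_p_nonneg)

lemma measurable_cell [measurable]:
  "cell \<epsilon> \<in> measurable (borel :: (real^'d) measure) (count_space UNIV)"
proof -
  have "(cell \<epsilon> :: real^'d \<Rightarrow> _) -` {k} \<inter> space borel = {x \<in> space borel. \<forall>j. \<lfloor>x $ j / \<epsilon>\<rfloor> = k $ j}" for k
    by (auto simp: cell_def vec_eq_iff)
  moreover have "{x \<in> space borel. \<forall>j. \<lfloor>x $ j / \<epsilon>\<rfloor> = k $ j} \<in> sets (borel :: (real^'d) measure)" for k
    by measurable
  ultimately show ?thesis
    by (simp add: measurable_count_space_eq_countable del: space_borel)
qed

lemma cell_diff:
  assumes "0 < \<epsilon>"
  shows "\<epsilon> * (\<bar>real_of_int (cell \<epsilon> x $ j - cell \<epsilon> y $ j)\<bar> - 1) \<le> \<bar>x $ j - y $ j\<bar>"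
    and "\<bar>x $ j - y $ j\<bar> \<le> \<epsilon> * (\<bar>real_of_int (cell \<epsilon> x $ j - cell \<epsilon> y $ j)\<bar> + 1)"
proof -
  define X Y where "X = x $ j / \<epsilon>" "Y = y $ j / \<epsilon>"
  have "x $ j - y $ j = \<epsilon> * (X - Y)"
    using assms by (simp add: X_Y_def right_diff_distrib)
  then have eq: "\<bar>x $ j - y $ j\<bar> = \<epsilon> * \<bar>X - Y\<bar>"
    using assms by (simp add: abs_mult)
  have "\<bar>real_of_int (\<lfloor>X\<rfloor> - \<lfloor>Y\<rfloor>)\<bar> - 1 \<le> \<bar>X - Y\<bar>" "\<bar>X - Y\<bar> \<le> \<bar>real_of_int (\<lfloor>X\<rfloor> - \<lfloor>Y\<rfloor>)\<bar> + 1"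
    by linarith+
  then show "\<epsilon> * (\<bar>real_of_int (cell \<epsilon> x $ j - cell \<epsilon> y $ j)\<bar> - 1) \<le> \<bar>x $ j - y $ j\<bar>"
    "\<bar>x $ j - y $ j\<bar> \<le> \<epsilon> * (\<bar>real_of_int (cell \<epsilon> x $ j - cell \<epsilon> y $ j)\<bar> + 1)"
    using assms unfolding eq by (simp_all add: cell_def X_Y_def[symmetric])
qed

lemma cell_cost_le_cost:
  assumes "0 < \<epsilon>" "0 \<le> p"
  shows "cell_cost p \<epsilon> 1 (cell \<epsilon> x) (cell \<epsilon> y) \<le> cost p (x - y)"
  unfolding cell_cost_def cost_def
proof (intro sum_mono alpha_p_mono)
  fix j
  show "\<bar>\<epsilon> * max 0 (\<bar>real_of_int (cell \<epsilon> x $ j - cell \<epsilon> y $ j)\<bar> - 1)\<bar> \<le> \<bar>(x - y) $ j\<bar>"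
    using cell_diff(1)[OF assms(1), of x j y] assms(1) by (auto simp: max_def abs_mult)
qed (use assms in simp)

lemma cell_cost_triangle:
  fixes k l z :: "int^'d"
  assumes "0 < \<epsilon>" "0 \<le> p" "p \<le> 2"
  shows "cell_cost p \<epsilon> 2 k l \<le> 2 * (cell_cost p \<epsilon> 1 k z + cell_cost p \<epsilon> 1 z l)"
  unfolding cell_cost_def sum.distrib[symmetric] sum_distrib_left
proof (rule sum_mono)
  fix j
  let ?m = "\<lambda>(k :: int^'d) l s. \<epsilon> * max 0 (\<bar>real_of_int (k $ j - l $ j)\<bar> - s)"
  have "alpha_p p (?m k l 2) \<le> alpha_p p (?m k z 1 + ?m z l 1)"
  proof (rule alpha_p_mono[OF assms(2)])
    have "max 0 (\<bar>real_of_int (k $ j - l $ j)\<bar> - 2)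
        \<le> max 0 (\<bar>real_of_int (k $ j - z $ j)\<bar> - 1) + max 0 (\<bar>real_of_int (z $ j - l $ j)\<bar> - 1)"
      by linarith
    then show "\<bar>?m k l 2\<bar> \<le> \<bar>?m k z 1 + ?m z l 1\<bar>"
      using assms(1) by (simp add: abs_mult flip: distrib_left)
  qed
  also have "\<dots> \<le> 2 * (alpha_p p (?m k z 1) + alpha_p p (?m z l 1))"
    by (rule alpha_p_add2[OF assms(2,3)])
  finally show "alpha_p p (?m k l 2) \<le> 2 * (alpha_p p (?m k z 1) + alpha_p p (?m z l 1))" .
qed

lemma two_sided_bounded_ln:
  assumes "two_sided_bounded U"
  obtains F B where "\<And>x. U x = ennreal (exp (F x))" "\<And>x. \<bar>F x\<bar> \<le> (B :: real)"
proof -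
  obtain l u where lu: "0 < l" "u < \<infinity>" "\<And>x. l \<le> U x" "\<And>x. U x \<le> u"
    using assms by (auto simp: two_sided_bounded_def)
  have "l < \<infinity>" using lu(2) lu(3,4)[of undefined] by (metis le_less_trans)
  then have l: "0 < enn2real l" using lu(1) by (simp add: enn2real_positive_iff)
  have le: "enn2real l \<le> enn2real (U x)" "enn2real (U x) \<le> enn2real u" "U x < \<infinity>" for x
    using lu(2) lu(3,4)[of x] by (auto intro!: enn2real_mono intro: le_less_trans)
  show thesis
  proof
    fix x
    show "U x = ennreal (exp (ln (enn2real (U x))))"
      using l le[of x] by simp
    show "\<bar>ln (enn2real (U x))\<bar> \<le> \<bar>ln (enn2real l)\<bar> + \<bar>ln (enn2real u)\<bar>"
      using l le(1,2)[of x] ln_le_cancel_iff[of "enn2real l" "enn2real (U x)"]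
        ln_le_cancel_iff[of "enn2real (U x)" "enn2real u"] by linarith
  qed
qed

text \<open>The transport inequality is used for the pairs (C F, G) and (C H, -G), where F and H are
  the logarithms of U and V. Since G occurs with both signs, its means cancel when the two
  exponential moments are multiplied. The 2 in 2 C pays for reaching l from k through the
  intermediate cell z.\<close>

lemma property_tau_cells:
  fixes \<mu> :: "(real^'d) measure"
  assumes \<mu>: "prob_space \<mu>" "sets \<mu> = sets borel" and C: "0 < C" "transport_entropy \<mu> p C"
    and p: "1 \<le> p" "p \<le> 2" and \<epsilon>: "0 < \<epsilon>"
    and U: "two_sided_bounded U" and V: "two_sided_bounded V"
    and UV: "\<And>k l. U k * V l \<le> ennreal (exp (cell_cost p \<epsilon> 2 k l / (2 * C)))"
  defines "m \<equiv> distr \<mu> (count_space UNIV) (cell \<epsilon>)"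
  shows "(\<integral>\<^sup>+ k. U k \<partial>m) * (\<integral>\<^sup>+ k. V k \<partial>m) \<le> 1"
proof -
  have cell_meas: "cell \<epsilon> \<in> measurable \<mu> (count_space UNIV)"
    by (simp add: measurable_cong_sets[OF \<mu>(2) refl])
  obtain F B1 where F: "\<And>x. U x = ennreal (exp (F x))" "\<And>x. \<bar>F x\<bar> \<le> B1"
    using two_sided_bounded_ln[OF U] by metis
  obtain H B2 where H: "\<And>x. V x = ennreal (exp (H x))" "\<And>x. \<bar>H x\<bar> \<le> B2"
    using two_sided_bounded_ln[OF V] by metis
  define B where "B = max (C * B1) (C * B2)"
  have B: "\<bar>C * F x\<bar> \<le> B" "\<bar>C * H x\<bar> \<le> B" for x
    using C(1) F(2)[of x] H(2)[of x] by (auto simp: B_def abs_mult le_max_iff_disj)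
  have FH: "C * F k + C * H l \<le> cell_cost p \<epsilon> 1 k z + cell_cost p \<epsilon> 1 z l" for k l z
  proof -
    have "F k + H l \<le> cell_cost p \<epsilon> 2 k l / (2 * C)"
      using UV[of k l] unfolding F(1) H(1) by (simp flip: ennreal_mult exp_add)
    then have "C * F k + C * H l \<le> cell_cost p \<epsilon> 2 k l / 2"
      using C(1) by (simp add: field_simps)
    then show ?thesis using cell_cost_triangle[of \<epsilon> p k l z] \<epsilon> p by simp
  qed
  \<comment> \<open>The infimum convolution of -C H with the cell cost, hence the largest function
    admissible for the pair (C H, -G); \<open>FH\<close> says that it is also large enough for the
    pair (C F, G). As a function on countably many cells it needs no measurability argument.\<close>
  define G where "G z = (INF l. cell_cost p \<epsilon> 1 z l - C * H l)" for z
  have bdd: "bdd_below (range (\<lambda>l. cell_cost p \<epsilon> 1 z l - C * H l))" for z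
  proof (rule bdd_belowI2)
    fix l show "- B \<le> cell_cost p \<epsilon> 1 z l - C * H l"
      using B(2)[of l] cell_cost_nonneg[of p \<epsilon> 1 z l] by linarith
  qed
  have G_le: "G z \<le> cell_cost p \<epsilon> 1 z l - C * H l" for z l
    unfolding G_def by (rule cINF_lower[OF bdd]) simp
  have le_G: "C * F k - cell_cost p \<epsilon> 1 k z \<le> G z" for k z
    unfolding G_def using FH[of k _ z] by (intro cINF_greatest) (auto simp: algebra_simps)
  have G_abs: "\<bar>G z\<bar> \<le> B" for z
  proof -
    have "cell_cost p \<epsilon> 1 z z = 0" by (simp add: cell_cost_def alpha_p_zero)
    then show ?thesis using G_le[of z z] le_G[of z z] B[of z] by linarith
  qed
  have meas: "(\<lambda>x. W (cell \<epsilon> x)) \<in> borel_measurable borel" for W :: "int^'d \<Rightarrow> real"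
    by measurable
  have \<mu>_meas: "(\<lambda>x. W (cell \<epsilon> x)) \<in> borel_measurable \<mu>" for W :: "int^'d \<Rightarrow> real"
    using measurable_compose[OF cell_meas, of W] by simp
  have 1: "(\<integral>x. exp (C * F (cell \<epsilon> x) / C) \<partial>\<mu>) \<le> exp ((\<integral>x. G (cell \<epsilon> x) \<partial>\<mu>) / C)"
  proof (rule transport_entropy_imp_exp_moment[OF \<mu> C, where B = B])
    fix x y
    show "C * F (cell \<epsilon> x) - G (cell \<epsilon> y) \<le> cost p (x - y)"
      using le_G[of "cell \<epsilon> x" "cell \<epsilon> y"] cell_cost_le_cost[OF \<epsilon>, of p x y] p by simp
  qed (use B(1) G_abs meas[of "\<lambda>k. C * F k"] meas[of G] in auto)
  have 2: "(\<integral>x. exp (C * H (cell \<epsilon> x) / C) \<partial>\<mu>) \<le> exp ((\<integral>x. - G (cell \<epsilon> x) \<partial>\<mu>) / C)"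
  proof (rule transport_entropy_imp_exp_moment[OF \<mu> C, where B = B])
    fix x y
    show "C * H (cell \<epsilon> x) - - G (cell \<epsilon> y) \<le> cost p (x - y)"
      using G_le[of "cell \<epsilon> y" "cell \<epsilon> x"] cell_cost_le_cost[OF \<epsilon>, of p y x] p
      by (simp add: cost_commute[of p x])
  qed (use B(2) G_abs meas[of "\<lambda>k. C * H k"] meas[of "\<lambda>k. - G k"] in auto)
  have conv: "(\<integral>\<^sup>+ k. ennreal (exp (W k)) \<partial>m) = ennreal (\<integral>x. exp (C * W (cell \<epsilon> x) / C) \<partial>\<mu>)"
    if "\<And>k. \<bar>W k\<bar> \<le> b" for W b
  proof -
    have "integrable \<mu> (\<lambda>x. exp (W (cell \<epsilon> x)))"
      using that \<mu>_meas[of W] by (intro bounded_integrable[OF \<mu>(1), of _ "exp b"]) (auto simp: abs_le_iff)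
    then show ?thesis
      unfolding m_def using C(1) by (simp add: nn_integral_distr[OF cell_meas] nn_integral_eq_integral)
  qed
  have "(\<integral>\<^sup>+ k. U k \<partial>m) * (\<integral>\<^sup>+ k. V k \<partial>m)
      = ennreal ((\<integral>x. exp (C * F (cell \<epsilon> x) / C) \<partial>\<mu>) * (\<integral>x. exp (C * H (cell \<epsilon> x) / C) \<partial>\<mu>))"
    unfolding F(1) H(1) conv[OF F(2)] conv[OF H(2)] by (rule ennreal_mult[symmetric]) simp_all
  also have "\<dots> \<le> ennreal (exp ((\<integral>x. G (cell \<epsilon> x) \<partial>\<mu>) / C) * exp ((\<integral>x. - G (cell \<epsilon> x) \<partial>\<mu>) / C))"
    by (intro ennreal_leI mult_mono 1 2) simp_all
  also have "\<dots> = 1" by (simp flip: exp_add)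
  finally show ?thesis .
qed

section \<open>Concentration from property (tau) on cells\<close>

text \<open>The gap between r and r' leaves room for the grid, and an arbitrary measurable superset
  \<open>E\<close> stands for the enlargement, so that measurability of the latter is never at
  issue.\<close>

lemma enlargement_bound:
  fixes \<mu> :: "(real^'d) measure"
  assumes \<mu>: "prob_space \<mu>" "sets \<mu> = sets borel" and C: "0 < C" "transport_entropy \<mu> p C"
    and p: "1 \<le> p" "p \<le> 2" and n: "1 \<le> n" and r: "0 \<le> r" "r < r'"
    and A: "A \<in> sets (PiM {..<n} (\<lambda>_. \<mu>))" "1/2 \<le> measure (PiM {..<n} (\<lambda>_. \<mu>)) A"
    and E: "E \<in> sets (PiM {..<n} (\<lambda>_. \<mu>))" "enlargement n p r' A \<subseteq> E"
  shows "1 - 2 * exp (- (r / (2 * C))) \<le> measure (PiM {..<n} (\<lambda>_. \<mu>)) E"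
proof -
  \<comment> \<open>The mesh for which the rounding error in l2 norm uses up exactly the slack
    \<open>sqrt r' - sqrt r\<close>.\<close>
  define \<epsilon> where "\<epsilon> = (sqrt r' - sqrt r) / (3 * sqrt (n * CARD('d)))"
  have \<epsilon>: "0 < \<epsilon>" "3 * \<epsilon> * sqrt (n * CARD('d)) \<le> sqrt r' - sqrt r"
    using n r by (auto simp: \<epsilon>_def)
  define R where "R = r / (2 * C)"
  have R: "0 \<le> R" using r C by (simp add: R_def)
  define m where "m = distr \<mu> (count_space UNIV) (cell \<epsilon>)"
  have cell_meas: "cell \<epsilon> \<in> measurable \<mu> (count_space UNIV)"
    by (simp add: measurable_cong_sets[OF \<mu>(2) refl])
  have m: "prob_space m" "sets m = UNIV"
    using \<mu>(1) cell_meas by (auto simp: m_def intro: prob_space.prob_space_distr)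
  define M where "M = PiM {..<n} (\<lambda>_. \<mu>)"
  define N where "N = PiM {..<n} (\<lambda>_. m)"
  interpret M: prob_space M unfolding M_def using \<mu>(1) by (intro prob_space_PiM)
  have space_\<mu>: "space \<mu> = UNIV" using sets_eq_imp_space_eq[OF \<mu>(2)] by simp
  have space_M: "space M = PiE {..<n} (\<lambda>_. UNIV)" by (simp add: M_def space_PiM space_\<mu>)
  have space_N: "space N = PiE {..<n} (\<lambda>_. UNIV)" by (simp add: N_def space_PiM m_def)
  have sets_N: "X \<in> sets N" if "X \<subseteq> PiE {..<n} (\<lambda>_. UNIV)" for X
  proof -
    have "(indicator X :: _ \<Rightarrow> ennreal) \<in> borel_measurable N"
      unfolding N_def by (rule measurable_PiM_countable[OF m(2)]) simp
    then have "X \<inter> space N \<in> sets N" by (simp add: borel_measurable_indicator_iff)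
    then show ?thesis using that by (simp add: space_N Int_absorb2)
  qed
  define c :: "(nat \<Rightarrow> real^'d) \<Rightarrow> nat \<Rightarrow> int^'d" where "c = compose {..<n} (cell \<epsilon>)"
  have cell_meas': "cell \<epsilon> \<in> measurable \<mu> m"
    using cell_meas by (simp add: m_def)
  have "distr \<mu> m (cell \<epsilon>) = m"
    unfolding m_def by (rule distr_cong) auto
  then have N_distr: "N = distr M N c"
    unfolding N_def M_def c_def using m(1) \<mu>(1) cell_meas'
    by (subst distr_PiM_finite_prob_space') auto
  have c_meas: "c \<in> measurable M N"
    unfolding c_def M_def N_def compose_def
    by (intro measurable_restrict measurable_compose[OF _ cell_meas'] measurable_component_singleton)
  define A' where "A' = c ` A"
  define D where "D = {k \<in> PiE {..<n} (\<lambda>_. UNIV). \<forall>l\<in>A'. r < (\<Sum>i<n. cell_cost p \<epsilon> 2 (k i) (l i))}"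
  have A_sub: "A \<subseteq> PiE {..<n} (\<lambda>_. UNIV)" using sets.sets_into_space[OF A(1)] space_M by (simp add: M_def)
  have c_PiE: "c x \<in> PiE {..<n} (\<lambda>_. UNIV)" for x by (simp add: c_def compose_def)
  have A'_sets: "A' \<in> sets N" and D_sets: "D \<in> sets N"
    using c_PiE by (auto simp: A'_def D_def intro!: sets_N)
  \<comment> \<open>In additive terms: f is R on \<open>D\<close> and 0 elsewhere, g is 0 on
    \<open>A'\<close> and R elsewhere. Then f - g is positive only from \<open>D\<close> to
    \<open>A'\<close>, where the cost exceeds r = 2 C R.\<close>
  define U where "U k = ennreal (if k \<in> D then exp R else 1)" for k
  define V where "V l = ennreal (if l \<in> A' then 1 else exp (- R))" for l
  have emeasure_N: "emeasure N X = emeasure M (c -` X \<inter> space M)" if "X \<in> sets N" for X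
    using that c_meas by (subst N_distr) (simp add: emeasure_distr)
  have "(\<integral>\<^sup>+ k. U k \<partial>N) * (\<integral>\<^sup>+ l. V l \<partial>N) \<le> 1"
    unfolding N_def
  proof (rule property_tau_tensorises[OF m, where K = "\<lambda>k l. exp (cell_cost p \<epsilon> 2 k l / (2 * C))"])
    show "two_sided_bounded U"
      unfolding two_sided_bounded_def U_def using R
      by (intro exI[of _ "ennreal 1"] exI[of _ "ennreal (exp R)"]) (auto simp del: ennreal_1)
    show "two_sided_bounded V"
      unfolding two_sided_bounded_def V_def using R
      by (intro exI[of _ "ennreal (exp (- R))"] exI[of _ "ennreal 1"]) (auto simp del: ennreal_1)
    fix k l :: "nat \<Rightarrow> int^'d" assume kl: "k \<in> PiE {..<n} (\<lambda>_. UNIV)" "l \<in> PiE {..<n} (\<lambda>_. UNIV)"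
    let ?s = "\<Sum>i<n. cell_cost p \<epsilon> 2 (k i) (l i)"
    have eq: "(\<Prod>i<n. exp (cell_cost p \<epsilon> 2 (k i) (l i) / (2 * C))) = exp (?s / (2 * C))"
      by (simp add: exp_sum[symmetric] sum_divide_distrib)
    have s: "0 \<le> ?s / (2 * C)" using C by (simp add: sum_nonneg cell_cost_nonneg)
    have "r / (2 * C) \<le> ?s / (2 * C)" if "k \<in> D" "l \<in> A'"
      using that C unfolding D_def by (intro divide_right_mono) auto
    then have "U k * V l \<le> ennreal (exp (max 0 (if k \<in> D \<and> l \<in> A' then R else 0)))"
      using R by (auto simp: U_def V_def ennreal_mult[symmetric] exp_add[symmetric] simp del: ennreal_1 intro!: ennreal_leI)
    also have "\<dots> \<le> ennreal (exp (?s / (2 * C)))"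
      using s \<open>k \<in> D \<Longrightarrow> l \<in> A' \<Longrightarrow> r / (2 * C) \<le> ?s / (2 * C)\<close> by (intro ennreal_leI) (auto simp: R_def)
    finally show "U k * V l \<le> ennreal (\<Prod>i<n. exp (cell_cost p \<epsilon> 2 (k i) (l i) / (2 * C)))"
      unfolding eq .
  next
    show "(\<integral>\<^sup>+ x. U x \<partial>m) * (\<integral>\<^sup>+ x. V x \<partial>m) \<le> 1"
      if "two_sided_bounded U" "two_sided_bounded V"
        "\<And>x y. U x * V y \<le> ennreal (exp (cell_cost p \<epsilon> 2 x y / (2 * C)))" for U V
      using property_tau_cells[OF \<mu> C p \<epsilon>(1) that] unfolding m_def .
  qed simp
  moreover have "ennreal (exp R) * emeasure N D \<le> (\<integral>\<^sup>+ k. U k \<partial>N)"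
  proof -
    have "ennreal (exp R) * emeasure N D = (\<integral>\<^sup>+ k. ennreal (exp R) * indicator D k \<partial>N)"
      using D_sets by (simp add: nn_integral_cmult_indicator)
    also have "\<dots> \<le> (\<integral>\<^sup>+ k. U k \<partial>N)"
      by (intro nn_integral_mono) (simp add: U_def indicator_def)
    finally show ?thesis .
  qed
  \<comment> \<open>The mass 1/2 of \<open>A\<close> entering here is the origin of b = 2.\<close>
  moreover have "ennreal (1/2) \<le> (\<integral>\<^sup>+ l. V l \<partial>N)"
  proof -
    have "ennreal (1/2) \<le> emeasure M A"
      using A(2) unfolding M_def[symmetric] M.emeasure_eq_measure by (intro ennreal_leI)
    also have "\<dots> \<le> emeasure M (c -` A' \<inter> space M)"
      using A_sub measurable_sets[OF c_meas] A'_sets space_M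
      by (intro emeasure_mono) (auto simp: A'_def)
    also have "\<dots> = (\<integral>\<^sup>+ l. indicator A' l \<partial>N)"
      using A'_sets by (simp add: emeasure_N)
    also have "\<dots> \<le> (\<integral>\<^sup>+ l. V l \<partial>N)"
      by (intro nn_integral_mono) (simp add: V_def indicator_def)
    finally show ?thesis .
  qed
  ultimately have "ennreal (exp R) * emeasure N D * ennreal (1/2) \<le> 1"
    by (meson mult_mono order_trans zero_le)
  moreover have "emeasure N D = ennreal (measure M (c -` D \<inter> space M))"
    using emeasure_N[OF D_sets] by (simp add: M.emeasure_eq_measure)
  ultimately have "exp R * measure M (c -` D \<inter> space M) * (1/2) \<le> 1"
    by (simp add: ennreal_mult[symmetric] del: ennreal_half)
  then have D_le: "measure M (c -` D \<inter> space M) \<le> 2 * exp (- R)"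
    by (simp add: exp_minus field_simps)
  \<comment> \<open>Rounding loses one mesh width and the shift 2 in the cell cost two more, so each
    modulus of x - a, reduced by \<open>3 * \<epsilon>\<close>, is controlled by the cell cost. A
    point with cell cost at most r from \<open>A\<close> thus lies in the enlargement, hence in
    \<open>E\<close>.\<close>
  have "space M - E \<subseteq> c -` D \<inter> space M"
  proof
    fix x assume x: "x \<in> space M - E"
    have "r < (\<Sum>i<n. cell_cost p \<epsilon> 2 (c x i) (c a i))" if a: "a \<in> A" for a
    proof (rule ccontr)
      assume "\<not> ?thesis"
      then have le: "(\<Sum>i<n. cell_cost p \<epsilon> 2 (cell \<epsilon> (x i)) (cell \<epsilon> (a i))) \<le> r"
        by (simp add: c_def compose_def)
      have "(\<Sum>i<n. \<Sum>j\<in>UNIV. alpha_p p (max 0 (\<bar>x i $ j - a i $ j\<bar> - 3 * \<epsilon>)))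
          \<le> (\<Sum>i<n. cell_cost p \<epsilon> 2 (cell \<epsilon> (x i)) (cell \<epsilon> (a i)))"
        unfolding cell_cost_def
      proof (intro sum_mono alpha_p_mono)
        fix i j
        define b where "b = \<bar>real_of_int (cell \<epsilon> (x i) $ j - cell \<epsilon> (a i) $ j)\<bar>"
        have "\<epsilon> * (b - 2) \<le> \<epsilon> * max 0 (b - 2)" "0 \<le> \<epsilon> * max 0 (b - 2)"
          using \<epsilon>(1) by (auto intro: mult_left_mono)
        then show "\<bar>max 0 (\<bar>x i $ j - a i $ j\<bar> - 3 * \<epsilon>)\<bar>
            \<le> \<bar>\<epsilon> * max 0 (\<bar>real_of_int (cell \<epsilon> (x i) $ j - cell \<epsilon> (a i) $ j)\<bar> - 2)\<bar>"
          using cell_diff(2)[OF \<epsilon>(1), of "x i" j "a i"]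
          unfolding b_def[symmetric] by (simp add: algebra_simps)
      qed (use p in simp)
      with le have "x \<in> enlargement n p r' A"
        using a A_sub x space_M \<epsilon> p r by (intro cost_imp_enlargement[of p r r' \<epsilon> n a]) auto
      then show False using E(2) x by auto
    qed
    then show "x \<in> c -` D \<inter> space M"
      using x c_PiE by (auto simp: D_def A'_def)
  qed
  then have "measure M (space M - E) \<le> 2 * exp (- R)"
    using D_le measurable_sets[OF c_meas] D_sets
    by (intro order_trans[OF M.finite_measure_mono D_le]) auto
  then show ?thesis
    using M.prob_compl[of E] E(1) by (simp add: M_def R_def)
qed

text \<open>The outer measure is an infimum over measurable supersets. Each superset of the
  r-enlargement stays fixed while smaller radii s increase to r, and continuity of the exponential
  removes the loss of radius.\<close>

theorem transport_entropy_imp_concentration: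
  fixes \<mu> :: "(real^'d) measure"
  assumes \<mu>: "prob_space \<mu>" "sets \<mu> = sets borel" and p: "1 \<le> p" "p \<le> 2"
    and C: "0 < C" "transport_entropy \<mu> p C"
  shows "concentration \<mu> p (1 / (2 * C)) 2"
  unfolding concentration_def
proof (intro allI ballI impI)
  fix n :: nat and A and r :: real
  assume n: "1 \<le> n" and A: "A \<in> sets (PiM {..<n} (\<lambda>_. \<mu>))" "1/2 \<le> measure (PiM {..<n} (\<lambda>_. \<mu>)) A"
    and r: "0 \<le> r"
  interpret M: prob_space "PiM {..<n} (\<lambda>_. \<mu>)" using \<mu>(1) by (intro prob_space_PiM)
  show "ennreal (1 - 2 * exp (- (1 / (2 * C)) * r)) \<le> outer_measure_of (PiM {..<n} (\<lambda>_. \<mu>)) (enlargement n p r A)"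
    unfolding outer_measure_of_def
  proof (rule INF_greatest)
    fix E assume "E \<in> {E \<in> sets (PiM {..<n} (\<lambda>_. \<mu>)). enlargement n p r A \<subseteq> E}"
    then have E: "E \<in> sets (PiM {..<n} (\<lambda>_. \<mu>))" "enlargement n p r A \<subseteq> E" by auto
    have "1 - 2 * exp (- (r / (2 * C))) \<le> measure (PiM {..<n} (\<lambda>_. \<mu>)) E"
    \<comment> \<open>For r = 0 there is no smaller nonnegative radius, but the bound is 1 - 2 <
      0.\<close>
    proof (cases "r = 0")
      case False
      have "((\<lambda>s. 1 - 2 * exp (- (s / (2 * C)))) \<longlongrightarrow> 1 - 2 * exp (- (r / (2 * C)))) (at_left r)"
        using C(1) by (intro tendsto_intros) auto
      moreover have "\<forall>\<^sub>F s in at_left r. 0 < s \<and> s < r"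
        using False r by (intro eventually_at_leftI[of 0]) auto
      then have "\<forall>\<^sub>F s in at_left r. 1 - 2 * exp (- (s / (2 * C))) \<le> measure (PiM {..<n} (\<lambda>_. \<mu>)) E"
        by eventually_elim (use enlargement_bound[OF \<mu> C p n _ _ A E] in auto)
      ultimately show ?thesis by (rule tendsto_upperbound) simp
    qed (simp add: order_trans[OF _ measure_nonneg])
    then show "ennreal (1 - 2 * exp (- (1 / (2 * C)) * r)) \<le> emeasure (PiM {..<n} (\<lambda>_. \<mu>)) E"
      by (auto simp: M.emeasure_eq_measure intro!: ennreal_leI)
  qed
qed

section \<open>Concentration implies transport-entropy inequalities\<close>

lemma nn_integral_rectangles:
  fixes \<nu> :: "'a measure" and \<mu> :: "'b measure" and v :: "'c \<Rightarrow> 'd \<Rightarrow> real"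
  assumes "prob_space \<nu>" "prob_space \<mu>" "finite S" "finite T"
    and v: "\<And>s t. 0 \<le> v s t"
    and X: "\<And>s. s \<in> S \<Longrightarrow> X s \<in> sets \<nu>" and Y: "\<And>t. t \<in> T \<Longrightarrow> Y t \<in> sets \<mu>"
  shows "(\<integral>\<^sup>+ z. ennreal (\<Sum>s\<in>S. \<Sum>t\<in>T. v s t * indicator (X s \<times> Y t) z) \<partial>(\<nu> \<Otimes>\<^sub>M \<mu>))
    = ennreal (\<Sum>s\<in>S. \<Sum>t\<in>T. v s t * measure \<nu> (X s) * measure \<mu> (Y t))"
proof -
  interpret \<nu>: prob_space \<nu> by fact
  interpret \<mu>: prob_space \<mu> by fact
  have "(\<integral>\<^sup>+ z. ennreal (\<Sum>s\<in>S. \<Sum>t\<in>T. v s t * indicator (X s \<times> Y t) z) \<partial>(\<nu> \<Otimes>\<^sub>M \<mu>))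
      = (\<integral>\<^sup>+ z. (\<Sum>s\<in>S. \<Sum>t\<in>T. ennreal (v s t) * indicator (X s \<times> Y t) z) \<partial>(\<nu> \<Otimes>\<^sub>M \<mu>))"
    using v by (intro nn_integral_cong)
      (simp add: sum_nonneg ennreal_mult ennreal_indicator flip: sum_ennreal)
  also have "\<dots> = (\<Sum>s\<in>S. \<Sum>t\<in>T. ennreal (v s t) * emeasure (\<nu> \<Otimes>\<^sub>M \<mu>) (X s \<times> Y t))"
    using X Y by (simp add: nn_integral_sum nn_integral_cmult_indicator)
  also have "\<dots> = (\<Sum>s\<in>S. \<Sum>t\<in>T. ennreal (v s t * measure \<nu> (X s) * measure \<mu> (Y t)))"
    using X Y v by (intro sum.cong refl)
      (simp add: \<mu>.emeasure_pair_measure_Times \<nu>.emeasure_eq_measure \<mu>.emeasure_eq_measure ennreal_mult mult.assoc)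
  also have "\<dots> = ennreal (\<Sum>s\<in>S. \<Sum>t\<in>T. v s t * measure \<nu> (X s) * measure \<mu> (Y t))"
    using v by (simp add: sum_nonneg)
  finally show ?thesis .
qed

text \<open>On each rectangle of cells the mass prescribed by the finite plan is spread
  proportionally to the product measure. The coupling is thus a density that is constant on
  rectangles, and its marginals come from summing the plan over rows or columns.\<close>

lemma coupling_from_cells:
  fixes \<nu> :: "'a measure" and \<mu> :: "'a measure" and \<rho> :: "'a \<Rightarrow> 'b" and h :: "'b \<Rightarrow> 'b \<Rightarrow> real"
  assumes \<nu>: "prob_space \<nu>" and \<mu>: "prob_space \<mu>" and S: "finite S" "range \<rho> \<subseteq> S"
    and space: "space \<nu> = UNIV" "space \<mu> = UNIV"
    and X: "\<And>s. \<rho> -` {s} \<in> sets \<nu>" "\<And>s. \<rho> -` {s} \<in> sets \<mu>"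
    and \<pi>: "\<And>s t. 0 \<le> \<pi> (s, t)"
      "\<And>s. s \<in> S \<Longrightarrow> (\<Sum>t\<in>S. \<pi> (s, t)) = measure \<nu> (\<rho> -` {s})"
      "\<And>t. t \<in> S \<Longrightarrow> (\<Sum>s\<in>S. \<pi> (s, t)) = measure \<mu> (\<rho> -` {t})"
    and h: "\<And>s t. 0 \<le> h s t"
  shows "\<exists>\<Gamma> \<in> couplings \<nu> \<mu>. (\<lambda>z. h (\<rho> (fst z)) (\<rho> (snd z))) \<in> borel_measurable \<Gamma> \<and>
    (\<integral>\<^sup>+ z. ennreal (h (\<rho> (fst z)) (\<rho> (snd z))) \<partial>\<Gamma>) \<le> ennreal (\<Sum>(s, t)\<in>S \<times> S. \<pi> (s, t) * h s t)"
proof -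
  interpret \<nu>: prob_space \<nu> by fact
  interpret \<mu>: prob_space \<mu> by fact
  let ?X = "\<lambda>s. \<rho> -` {s}"
  define p where "p s = measure \<nu> (?X s)" for s
  define q where "q t = measure \<mu> (?X t)" for t
  \<comment> \<open>If a cell is null, the quotient is 0 by convention. No mass is lost, because the
    marginal condition then forces the plan to vanish there as well (\<open>\<pi>0\<close>).\<close>
  define v where "v s t = \<pi> (s, t) / (p s * q t)" for s t
  have v: "0 \<le> v s t" for s t by (simp add: v_def \<pi>(1) p_def q_def)
  have [measurable]: "?X s \<in> sets \<nu>" "?X s \<in> sets \<mu>" for s using X by auto
  have UNIV_sets: "UNIV \<in> sets \<nu>" "UNIV \<in> sets \<mu>"
    using sets.top[of \<nu>] sets.top[of \<mu>] space by auto
  have \<pi>0: "\<pi> (s, t) = 0" if "p s = 0 \<or> q t = 0" "s \<in> S" "t \<in> S" for s t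
    using that \<pi>(2)[of s] \<pi>(3)[of t] \<pi>(1) S(1) unfolding p_def[symmetric] q_def[symmetric]
    by (auto simp: sum_nonneg_eq_0_iff)
  have v_pq: "v s t * p s * q t = \<pi> (s, t)" if "s \<in> S" "t \<in> S" for s t
    using \<pi>0[OF _ that] by (auto simp: v_def)
  define w where "w z = (\<Sum>s\<in>S. \<Sum>t\<in>S. v s t * indicator (?X s \<times> ?X t) z)" for z
  have w_meas [measurable]: "w \<in> borel_measurable (\<nu> \<Otimes>\<^sub>M \<mu>)"
    unfolding w_def by measurable
  define \<Gamma> where "\<Gamma> = density (\<nu> \<Otimes>\<^sub>M \<mu>) (\<lambda>z. ennreal (w z))"
  have sets_\<Gamma>: "sets \<Gamma> = sets (\<nu> \<Otimes>\<^sub>M \<mu>)" by (simp add: \<Gamma>_def)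
  have rect: "emeasure \<Gamma> (E \<times> F) = ennreal (\<Sum>s\<in>S. \<Sum>t\<in>S. v s t * measure \<nu> (E \<inter> ?X s) * measure \<mu> (F \<inter> ?X t))"
    if [measurable]: "E \<in> sets \<nu>" "F \<in> sets \<mu>" for E F
  proof -
    have "emeasure \<Gamma> (E \<times> F) = (\<integral>\<^sup>+ z. ennreal (w z) * indicator (E \<times> F) z \<partial>(\<nu> \<Otimes>\<^sub>M \<mu>))"
      unfolding \<Gamma>_def by (rule emeasure_density) auto
    also have "\<dots> = (\<integral>\<^sup>+ z. ennreal (\<Sum>s\<in>S. \<Sum>t\<in>S. v s t * indicator ((E \<inter> ?X s) \<times> (F \<inter> ?X t)) z) \<partial>(\<nu> \<Otimes>\<^sub>M \<mu>))"
    proof (intro nn_integral_cong)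
      fix z
      have "w z * indicator (E \<times> F) z = (\<Sum>s\<in>S. \<Sum>t\<in>S. v s t * indicator ((E \<inter> ?X s) \<times> (F \<inter> ?X t)) z)"
        unfolding w_def sum_distrib_right by (intro sum.cong refl) (auto simp: indicator_def)
      moreover have "ennreal (w z) * indicator (E \<times> F) z = ennreal (w z * indicator (E \<times> F) z)"
        by (simp add: indicator_def)
      ultimately show "ennreal (w z) * indicator (E \<times> F) z
          = ennreal (\<Sum>s\<in>S. \<Sum>t\<in>S. v s t * indicator ((E \<inter> ?X s) \<times> (F \<inter> ?X t)) z)"
        by simp
    qed
    finally show ?thesis
      using nn_integral_rectangles[OF \<nu> \<mu> S(1) S(1) v, of "\<lambda>s. E \<inter> ?X s" "\<lambda>t. F \<inter> ?X t"] by simp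
  qed
  have cover: "(\<Sum>s\<in>S. measure M (E \<inter> ?X s)) = measure M E"
    if M: "prob_space M" "\<And>s. ?X s \<in> sets M" and E: "E \<in> sets M" for M E
  proof -
    interpret M: prob_space M by fact
    have "measure M (\<Union>s\<in>S. E \<inter> ?X s) = (\<Sum>s\<in>S. measure M (E \<inter> ?X s))"
      using S(1) M E by (intro M.finite_measure_finite_Union) (auto simp: disjoint_family_on_def)
    moreover have "(\<Union>s\<in>S. E \<inter> ?X s) = E" using S(2) by auto
    ultimately show ?thesis by simp
  qed
  have fst_marginal: "emeasure \<Gamma> (E \<times> UNIV) = emeasure \<nu> E" if E: "E \<in> sets \<nu>" for E
  proof -
    have "(\<Sum>t\<in>S. v s t * measure \<nu> (E \<inter> ?X s) * measure \<mu> (UNIV \<inter> ?X t)) = measure \<nu> (E \<inter> ?X s)"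
      if s: "s \<in> S" for s
    proof (cases "p s = 0")
      case True
      then have "measure \<nu> (E \<inter> ?X s) = 0"
        using \<nu>.finite_measure_mono[of "E \<inter> ?X s" "?X s"] measure_nonneg[of \<nu> "E \<inter> ?X s"] by (simp add: p_def)
      then show ?thesis by simp
    next
      case False
      have "(\<Sum>t\<in>S. v s t * measure \<nu> (E \<inter> ?X s) * measure \<mu> (UNIV \<inter> ?X t))
          = (\<Sum>t\<in>S. (v s t * p s * q t) * (measure \<nu> (E \<inter> ?X s) / p s))"
        using False by (intro sum.cong refl) (simp add: q_def)
      also have "\<dots> = (\<Sum>t\<in>S. \<pi> (s, t)) * (measure \<nu> (E \<inter> ?X s) / p s)"
        unfolding sum_distrib_right using s by (intro sum.cong refl) (simp add: v_pq)
      also have "\<dots> = measure \<nu> (E \<inter> ?X s)" using False \<pi>(2)[OF s] by (simp add: p_def)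
      finally show ?thesis .
    qed
    then show ?thesis
      using cover[OF \<nu> X(1) E] by (simp add: rect[OF E UNIV_sets(2)] \<nu>.emeasure_eq_measure)
  qed
  have snd_marginal: "emeasure \<Gamma> (UNIV \<times> F) = emeasure \<mu> F" if F: "F \<in> sets \<mu>" for F
  proof -
    have "(\<Sum>s\<in>S. v s t * measure \<nu> (UNIV \<inter> ?X s) * measure \<mu> (F \<inter> ?X t)) = measure \<mu> (F \<inter> ?X t)"
      if t: "t \<in> S" for t
    proof (cases "q t = 0")
      case True
      then have "measure \<mu> (F \<inter> ?X t) = 0"
        using \<mu>.finite_measure_mono[of "F \<inter> ?X t" "?X t"] measure_nonneg[of \<mu> "F \<inter> ?X t"] by (simp add: q_def)
      then show ?thesis by simp
    next
      case False
      have "(\<Sum>s\<in>S. v s t * measure \<nu> (UNIV \<inter> ?X s) * measure \<mu> (F \<inter> ?X t))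
          = (\<Sum>s\<in>S. (v s t * p s * q t) * (measure \<mu> (F \<inter> ?X t) / q t))"
        using False by (intro sum.cong refl) (simp add: p_def)
      also have "\<dots> = (\<Sum>s\<in>S. \<pi> (s, t)) * (measure \<mu> (F \<inter> ?X t) / q t)"
        unfolding sum_distrib_right using t by (intro sum.cong refl) (simp add: v_pq)
      also have "\<dots> = measure \<mu> (F \<inter> ?X t)" using False \<pi>(3)[OF t] by (simp add: q_def)
      finally show ?thesis .
    qed
    then show ?thesis
      using cover[OF \<mu> X(2) F]
      by (simp add: rect[OF UNIV_sets(1) F] \<mu>.emeasure_eq_measure sum.swap[of _ S S])
  qed
  have space_\<Gamma>: "space \<Gamma> = UNIV" by (simp add: \<Gamma>_def space_pair_measure space)
  have "prob_space \<Gamma>"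
    using fst_marginal[of UNIV] sets.top[of \<nu>] \<nu>.emeasure_space_1
    by (intro prob_spaceI) (simp add: space_\<Gamma> space)
  moreover have "distr \<Gamma> \<nu> fst = \<nu>"
  proof (rule measure_eqI)
    fix E assume "E \<in> sets (distr \<Gamma> \<nu> fst)"
    moreover have "(fst -` E :: ('a \<times> 'a) set) = E \<times> UNIV" by auto
    ultimately show "emeasure (distr \<Gamma> \<nu> fst) E = emeasure \<nu> E"
      using fst_marginal[of E]
      by (subst emeasure_distr) (auto simp: space_\<Gamma> measurable_cong_sets[OF sets_\<Gamma> refl])
  qed simp
  moreover have "distr \<Gamma> \<mu> snd = \<mu>"
  proof (rule measure_eqI)
    fix F assume "F \<in> sets (distr \<Gamma> \<mu> snd)"
    moreover have "(snd -` F :: ('a \<times> 'a) set) = UNIV \<times> F" by auto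
    ultimately show "emeasure (distr \<Gamma> \<mu> snd) F = emeasure \<mu> F"
      using snd_marginal[of F]
      by (subst emeasure_distr) (auto simp: space_\<Gamma> measurable_cong_sets[OF sets_\<Gamma> refl])
  qed simp
  ultimately have "\<Gamma> \<in> couplings \<nu> \<mu>" using sets_\<Gamma> by (simp add: couplings_def)
  moreover have h_eq: "h (\<rho> (fst z)) (\<rho> (snd z)) = (\<Sum>s\<in>S. \<Sum>t\<in>S. h s t * indicator (?X s \<times> ?X t) z)" for z
  proof -
    have "(\<Sum>s\<in>S. \<Sum>t\<in>S. h s t * indicator (?X s \<times> ?X t) z)
        = (\<Sum>s\<in>S. \<Sum>t\<in>S. if s = \<rho> (fst z) then (if t = \<rho> (snd z) then h s t else 0) else 0)"
      by (intro sum.cong refl) (cases "fst z \<in> ?X s"; cases "snd z \<in> ?X t"; simp add: indicator_times)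
    also have "\<dots> = (\<Sum>s\<in>S. if s = \<rho> (fst z) then (\<Sum>t\<in>S. if t = \<rho> (snd z) then h s t else 0) else 0)"
      by (intro sum.cong refl) auto
    also have "\<dots> = h (\<rho> (fst z)) (\<rho> (snd z))" using S by (auto simp: sum.delta)
    finally show ?thesis by simp
  qed
  moreover have "(\<lambda>z. h (\<rho> (fst z)) (\<rho> (snd z))) \<in> borel_measurable \<Gamma>"
    unfolding h_eq measurable_cong_sets[OF sets_\<Gamma> refl] by measurable
  moreover have "(\<integral>\<^sup>+ z. ennreal (h (\<rho> (fst z)) (\<rho> (snd z))) \<partial>\<Gamma>) \<le> ennreal (\<Sum>(s, t)\<in>S \<times> S. \<pi> (s, t) * h s t)"
  proof -
    have "(\<integral>\<^sup>+ z. ennreal (h (\<rho> (fst z)) (\<rho> (snd z))) \<partial>\<Gamma>)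
        = (\<integral>\<^sup>+ z. ennreal (w z) * ennreal (h (\<rho> (fst z)) (\<rho> (snd z))) \<partial>(\<nu> \<Otimes>\<^sub>M \<mu>))"
      unfolding \<Gamma>_def by (rule nn_integral_density) (unfold h_eq, measurable)
    also have "\<dots> = (\<integral>\<^sup>+ z. ennreal (\<Sum>s\<in>S. \<Sum>t\<in>S. v s t * h s t * indicator (?X s \<times> ?X t) z) \<partial>(\<nu> \<Otimes>\<^sub>M \<mu>))"
    proof (intro nn_integral_cong)
      fix z
      have "0 \<le> w z" unfolding w_def using v by (intro sum_nonneg) auto
      moreover have "w z * h (\<rho> (fst z)) (\<rho> (snd z)) = (\<Sum>s\<in>S. \<Sum>t\<in>S. v s t * h s t * indicator (?X s \<times> ?X t) z)"
        unfolding w_def sum_distrib_right by (intro sum.cong refl) (auto simp: indicator_def)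
      ultimately show "ennreal (w z) * ennreal (h (\<rho> (fst z)) (\<rho> (snd z)))
          = ennreal (\<Sum>s\<in>S. \<Sum>t\<in>S. v s t * h s t * indicator (?X s \<times> ?X t) z)"
        using h by (simp flip: ennreal_mult)
    qed
    also have "\<dots> = ennreal (\<Sum>s\<in>S. \<Sum>t\<in>S. v s t * h s t * p s * q t)"
      unfolding p_def q_def using v h by (intro nn_integral_rectangles \<nu> \<mu> S) auto
    also have "(\<Sum>s\<in>S. \<Sum>t\<in>S. v s t * h s t * p s * q t) = (\<Sum>s\<in>S. \<Sum>t\<in>S. \<pi> (s, t) * h s t)"
      by (intro sum.cong refl) (simp add: v_pq[symmetric] mult_ac)
    finally show ?thesis by (simp add: sum.cartesian_product)
  qed
  ultimately show ?thesis by blast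
qed

section \<open>Exponential tails and exponential moments\<close>

text \<open>A layer-cake bound over integer levels: where k < X and X is at most k + 1, the
  integrand is at most exp (t (k + 1)), and the tail bound makes the sum a geometric series with
  ratio \<open>exp (t - \<alpha>)\<close>. The result involves X only through its tail constants, so
  it is uniform in the dimension when X is a sum over coordinates.\<close>

lemma exp_moment_of_tail:
  assumes M: "prob_space M" and X [measurable]: "X \<in> borel_measurable M"
    and t: "0 < t" "t < \<alpha>" and b: "0 \<le> b"
    and tail: "\<And>s. 0 \<le> s \<Longrightarrow> measure M {x \<in> space M. s < X x} \<le> b * exp (- \<alpha> * s)"
  shows "(\<integral>\<^sup>+ x. ennreal (exp (t * X x)) \<partial>M) \<le> ennreal (1 + b * exp t / (1 - exp (t - \<alpha>)))"
proof -
  interpret prob_space M by fact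
  define e where "e k x = ennreal (exp (t * (real k + 1))) * indicator {x \<in> space M. real k < X x} x" for k x
  have "ennreal (exp (t * X x)) \<le> 1 + (\<Sum>k. e k x)" if x: "x \<in> space M" for x
  proof (cases "X x \<le> 0")
    case True
    then have "ennreal (exp (t * X x)) \<le> ennreal 1"
      using t by (intro ennreal_leI) (simp add: mult_nonneg_nonpos)
    then show ?thesis by (simp add: add_increasing2)
  next
    case False
    define k where "k = nat (\<lceil>X x\<rceil> - 1)"
    have "1 \<le> \<lceil>X x\<rceil>" using False by simp
    then have "real k = of_int \<lceil>X x\<rceil> - 1" by (simp add: k_def)
    then have k: "real k < X x" "X x \<le> real k + 1" by linarith+
    have "ennreal (exp (t * X x)) \<le> e k x"
      using k t x by (auto simp: e_def intro!: ennreal_leI)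
    also have "e k x \<le> (\<Sum>k. e k x)"
      using sum_le_suminf[of "\<lambda>k. e k x" "{k}"] by simp
    finally show ?thesis by (simp add: add_increasing)
  qed
  then have "(\<integral>\<^sup>+ x. ennreal (exp (t * X x)) \<partial>M) \<le> (\<integral>\<^sup>+ x. 1 + (\<Sum>k. e k x) \<partial>M)"
    by (rule nn_integral_mono)
  also have "\<dots> = 1 + (\<Sum>k. \<integral>\<^sup>+ x. e k x \<partial>M)"
    unfolding e_def by (simp add: nn_integral_add nn_integral_suminf emeasure_space_1)
  also have "(\<Sum>k. \<integral>\<^sup>+ x. e k x \<partial>M) \<le> (\<Sum>k. ennreal (b * exp t * exp (t - \<alpha>) ^ k))"
  proof (intro suminf_le summableI)
    fix k
    have "(\<integral>\<^sup>+ x. e k x \<partial>M) = ennreal (exp (t * (real k + 1))) * ennreal (measure M {x \<in> space M. real k < X x})"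
      unfolding e_def by (simp add: nn_integral_cmult_indicator emeasure_eq_measure)
    also have "\<dots> \<le> ennreal (exp (t * (real k + 1))) * ennreal (b * exp (- \<alpha> * real k))"
      using tail[of "real k"] by (intro mult_left_mono ennreal_leI) auto
    also have "\<dots> = ennreal (b * exp t * exp (t - \<alpha>) ^ k)"
      using b by (simp add: ennreal_mult[symmetric] exp_of_nat_mult[symmetric] exp_add[symmetric] algebra_simps)
    finally show "(\<integral>\<^sup>+ x. e k x \<partial>M) \<le> ennreal (b * exp t * exp (t - \<alpha>) ^ k)" .
  qed
  also have "(\<Sum>k. ennreal (b * exp t * exp (t - \<alpha>) ^ k)) = ennreal (b * exp t * (1 / (1 - exp (t - \<alpha>))))"
  proof -
    have "norm (exp (t - \<alpha>)) < 1" using t by simp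
    from sums_mult[OF geometric_sums[OF this], of "b * exp t"] show ?thesis
      using b t by (intro sums_unique[symmetric] sums_ennreal[THEN iffD2]) (auto intro!: divide_nonneg_nonneg)
  qed
  finally show ?thesis
    using b t by (subst ennreal_plus) (auto intro!: divide_nonneg_pos)
qed

lemma concentration_tail:
  fixes \<mu> :: "(real^'d) measure" and n :: nat
  assumes \<mu>: "prob_space \<mu>" "sets \<mu> = sets borel" and p: "1 \<le> p" "p \<le> 2"
    and conc: "concentration \<mu> p a b" and n: "1 \<le> n" and \<kappa>: "0 \<le> \<kappa>"
    and f: "f \<in> borel_measurable borel" and \<phi>: "\<phi> \<in> borel_measurable borel"
    and f\<phi>: "\<And>x y. f x \<le> \<phi> y + \<kappa> * cost p (x - y)"
    and half: "1/2 \<le> measure (PiM {..<n} (\<lambda>_. \<mu>)) {x \<in> space (PiM {..<n} (\<lambda>_. \<mu>)). (\<Sum>i<n. \<phi> (x i)) \<le> s0}"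
    and r: "0 \<le> r"
  shows "measure (PiM {..<n} (\<lambda>_. \<mu>)) {x \<in> space (PiM {..<n} (\<lambda>_. \<mu>)). s0 + 4 * \<kappa> * r < (\<Sum>i<n. f (x i))}
    \<le> b * exp (- a * r)"
proof -
  define M where "M = PiM {..<n} (\<lambda>_. \<mu>)"
  interpret prob_space M unfolding M_def using \<mu>(1) by (intro prob_space_PiM)
  have [measurable]: "f \<in> borel_measurable \<mu>" "\<phi> \<in> borel_measurable \<mu>"
    using f \<phi> by (simp_all add: measurable_cong_sets[OF \<mu>(2) refl])
  have [measurable]: "(\<lambda>x. \<Sum>i<n. f (x i)) \<in> borel_measurable M" "(\<lambda>x. \<Sum>i<n. \<phi> (x i)) \<in> borel_measurable M"
    unfolding M_def by measurable
  have space_M: "space M = PiE {..<n} (\<lambda>_. UNIV)"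
    using sets_eq_imp_space_eq[OF \<mu>(2)] by (simp add: M_def space_PiM)
  define A where "A = {x \<in> space M. (\<Sum>i<n. \<phi> (x i)) \<le> s0}"
  define E where "E = {x \<in> space M. (\<Sum>i<n. f (x i)) \<le> s0 + 4 * \<kappa> * r}"
  have A: "A \<in> sets M" and E: "E \<in> sets M" unfolding A_def E_def by measurable
  have "enlargement n p r A \<subseteq> E"
  proof
    fix x assume x: "x \<in> enlargement n p r A"
    then obtain y where y: "y \<in> A" "(\<Sum>i<n. cost p (x i - y i)) \<le> 4 * r"
      using enlargement_imp_cost[OF p r x] by blast
    have "(\<Sum>i<n. f (x i)) \<le> (\<Sum>i<n. \<phi> (y i) + \<kappa> * cost p (x i - y i))"
      by (intro sum_mono f\<phi>)
    also have "\<dots> = (\<Sum>i<n. \<phi> (y i)) + \<kappa> * (\<Sum>i<n. cost p (x i - y i))"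
      by (simp add: sum.distrib sum_distrib_left)
    also have "\<dots> \<le> s0 + \<kappa> * (4 * r)"
      using y \<kappa> by (intro add_mono mult_left_mono) (auto simp: A_def)
    finally have "(\<Sum>i<n. f (x i)) \<le> s0 + 4 * \<kappa> * r" by simp
    moreover obtain z where "x = restrict z {..<n}" using x unfolding mink_sum_def by blast
    ultimately show "x \<in> E" by (simp add: E_def space_M)
  qed
  then have "outer_measure_of M (enlargement n p r A) \<le> outer_measure_of M E"
    by (rule outer_measure_of_mono)
  moreover have "ennreal (1 - b * exp (- a * r)) \<le> outer_measure_of M (enlargement n p r A)"
    using conc n A r half unfolding concentration_def M_def A_def by blast
  ultimately have "ennreal (1 - b * exp (- a * r)) \<le> emeasure M E"
    using E by (metis order_trans outer_measure_of_eq)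
  then have "1 - b * exp (- a * r) \<le> measure M E"
    by (simp add: emeasure_eq_measure)
  moreover have "{x \<in> space M. s0 + 4 * \<kappa> * r < (\<Sum>i<n. f (x i))} = space M - E"
    by (auto simp: E_def)
  ultimately show ?thesis
    using prob_compl[OF E] by (simp add: M_def)
qed

text \<open>Concentration for n = 1, started from a sublevel set of the cost of mass above 1/2. The
  cost at x is at most 2 cost at y plus 2 cost of x - y, so \<open>\<kappa> = 2\<close> and the tail
  decays at rate a / 8; the exponent a / 16 is half of it. This moment supplies the integrability of
  the unbounded test functions used later.\<close>

lemma concentration_cost_moment:
  fixes \<mu> :: "(real^'d) measure"
  assumes \<mu>: "prob_space \<mu>" "sets \<mu> = sets borel" and p: "1 \<le> p" "p \<le> 2"
    and ab: "0 < a" "0 \<le> b" and conc: "concentration \<mu> p a b"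
  shows "(\<integral>\<^sup>+ x. ennreal (exp (a / 16 * cost p x)) \<partial>\<mu>) < \<infinity>"
proof -
  define M where "M = PiM {..<1::nat} (\<lambda>_. \<mu>)"
  interpret M: prob_space M unfolding M_def using \<mu>(1) by (intro prob_space_PiM)
  interpret product_sigma_finite "\<lambda>_::nat. \<mu>"
    using \<mu>(1) by (simp add: product_sigma_finite_def prob_space_imp_sigma_finite)
  have [measurable]: "cost p \<in> borel_measurable \<mu>"
    by (simp add: measurable_cong_sets[OF \<mu>(2) refl])
  have [measurable]: "(\<lambda>x. cost p (x 0)) \<in> borel_measurable M"
    unfolding M_def by measurable
  define A where "A k = {x \<in> space M. 2 * cost p (x 0) \<le> real k}" for k
  have "(\<lambda>k. measure M (A k)) \<longlonglongrightarrow> measure M (\<Union>k. A k)"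
  proof (rule M.finite_Lim_measure_incseq)
    show "range A \<subseteq> sets M" unfolding A_def by auto
    show "incseq A" by (auto simp: incseq_def A_def)
  qed
  moreover have "(\<Union>k. A k) = space M" using real_arch_simple by (auto simp: A_def)
  ultimately have "(\<lambda>k. measure M (A k)) \<longlonglongrightarrow> 1" by (simp add: M.prob_space)
  then have "\<forall>\<^sub>F k in sequentially. 1/2 < measure M (A k)" by (rule order_tendstoD) simp
  then obtain k where k: "1/2 < measure M (A k)" by (auto simp: eventually_sequentially)
  have tail: "measure M {x \<in> space M. real k + 8 * r < cost p (x 0)} \<le> b * exp (- a * r)" if "0 \<le> r" for r
  proof -
    have "cost p x \<le> 2 * cost p y + 2 * cost p (x - y)" for x y :: "real^'d"
      using cost_add2[of p "x - y" y] p by simp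
    moreover have "1/2 \<le> measure M {x \<in> space M. (\<Sum>i<1. 2 * cost p (x i)) \<le> real k}"
      using k by (simp add: A_def)
    ultimately show ?thesis
      using concentration_tail[OF \<mu> p conc, of 1 2 "cost p" "\<lambda>x. 2 * cost p x" "real k" r] that
      by (simp add: M_def)
  qed
  have "(\<integral>\<^sup>+ x. ennreal (exp (a / 16 * (cost p (x 0) - real k))) \<partial>M)
      \<le> ennreal (1 + b * exp (a / 16) / (1 - exp (a / 16 - a / 8)))"
  proof (rule exp_moment_of_tail[OF M.prob_space_axioms])
    show "measure M {x \<in> space M. s < cost p (x 0) - real k} \<le> b * exp (- (a / 8) * s)" if "0 \<le> s" for s
      using tail[of "s / 8"] that by (simp add: algebra_simps)
  qed (use ab in auto)
  also have "(\<integral>\<^sup>+ x. ennreal (exp (a / 16 * (cost p (x 0) - real k))) \<partial>M)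
      = (\<integral>\<^sup>+ x. ennreal (exp (a / 16 * (cost p x - real k))) \<partial>\<mu>)"
    using product_nn_integral_singleton[of "\<lambda>x. ennreal (exp (a / 16 * (cost p x - real k)))" 0]
    by (simp add: M_def lessThan_Suc)
  finally have "ennreal (exp (a / 16 * k)) * (\<integral>\<^sup>+ x. ennreal (exp (a / 16 * (cost p x - real k))) \<partial>\<mu>) < \<infinity>"
    by (auto simp: ennreal_mult_less_top le_less_trans)
  also have "ennreal (exp (a / 16 * k)) * (\<integral>\<^sup>+ x. ennreal (exp (a / 16 * (cost p x - real k))) \<partial>\<mu>)
      = (\<integral>\<^sup>+ x. ennreal (exp (a / 16 * k)) * ennreal (exp (a / 16 * (cost p x - real k))) \<partial>\<mu>)"
    by (rule nn_integral_cmult[symmetric]) measurable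
  also have "\<dots> = (\<integral>\<^sup>+ x. ennreal (exp (a / 16 * cost p x)) \<partial>\<mu>)"
    by (simp only: ennreal_mult[symmetric] exp_ge_zero exp_add[symmetric] distrib_left[symmetric]) simp
  finally show ?thesis .
qed

section \<open>Law of large numbers and the n-th root argument\<close>

lemma sum_second_moment:
  fixes \<mu> :: "'a measure" and \<psi> :: "'a \<Rightarrow> real"
  assumes \<mu>: "prob_space \<mu>" and \<psi>: "integrable \<mu> \<psi>" "integrable \<mu> (\<lambda>x. (\<psi> x)\<^sup>2)" "(\<integral>x. \<psi> x \<partial>\<mu>) = 0"
  shows "integrable (PiM {..<n} (\<lambda>_. \<mu>)) (\<lambda>x. (\<Sum>i<n. \<psi> (x i))\<^sup>2)"
    and "(\<integral>x. (\<Sum>i<n. \<psi> (x i))\<^sup>2 \<partial>PiM {..<n} (\<lambda>_. \<mu>)) = real n * (\<integral>x. (\<psi> x)\<^sup>2 \<partial>\<mu>)"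
proof -
  interpret \<mu>: prob_space \<mu> by fact
  interpret product_sigma_finite "\<lambda>_::nat. \<mu>"
    using \<mu> by (simp add: product_sigma_finite_def prob_space_imp_sigma_finite)
  let ?M = "PiM {..<n} (\<lambda>_. \<mu>)"
  \<comment> \<open>Writes \<open>\<psi> (x i) * \<psi> (x j)\<close> as a product over all
    coordinates, in the same form on and off the diagonal, so that the product formula for integrals
    covers both cases.\<close>
  define g where "g i j k y = (if k = i then \<psi> y else 1) * (if k = j then \<psi> y else 1)" for i j k :: nat and y
  have g_prod: "(\<Prod>k<n. g i j k (x k)) = \<psi> (x i) * \<psi> (x j)" if "i < n" "j < n" for i j x
    using that by (simp add: g_def prod.distrib prod.delta)
  have g_cases: "g i j k = (if k = i \<and> k = j then (\<lambda>y. (\<psi> y)\<^sup>2) else if k = i \<or> k = j then \<psi> else (\<lambda>_. 1))" for i j k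
    by (auto simp: g_def power2_eq_square fun_eq_iff)
  have g_int: "integrable \<mu> (g i j k)" for i j k
    using \<psi> by (simp add: g_cases)
  have prod_int: "integrable ?M (\<lambda>x. \<psi> (x i) * \<psi> (x j))" if "i < n" "j < n" for i j
    using product_integrable_prod[of "{..<n}" "g i j"] g_int that by (simp add: g_prod)
  have prod_eq: "(\<integral>x. \<psi> (x i) * \<psi> (x j) \<partial>?M) = (if i = j then (\<integral>x. (\<psi> x)\<^sup>2 \<partial>\<mu>) else 0)"
    if "i < n" "j < n" for i j
  proof -
    have "(\<integral>x. \<psi> (x i) * \<psi> (x j) \<partial>?M) = (\<Prod>k<n. integral\<^sup>L \<mu> (g i j k))"
      using product_integral_prod[of "{..<n}" "g i j"] g_int that by (simp add: g_prod)
    also have "\<dots> = (if i = j then (\<integral>x. (\<psi> x)\<^sup>2 \<partial>\<mu>) else 0)"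
    proof (cases "i = j")
      case True
      then have "(\<Prod>k<n. integral\<^sup>L \<mu> (g i j k)) = (\<Prod>k<n. if k = i then (\<integral>x. (\<psi> x)\<^sup>2 \<partial>\<mu>) else 1)"
        by (intro prod.cong refl) (auto simp: g_cases \<mu>.prob_space)
      then show ?thesis using True that by (simp add: prod.delta)
    next
      case False
      then have "integral\<^sup>L \<mu> (g i j i) = 0" using \<psi>(3) by (simp add: g_cases)
      then show ?thesis using False that by (intro prod_zero[THEN trans]) auto
    qed
    finally show ?thesis .
  qed
  have sq: "(\<Sum>i<n. \<psi> (x i))\<^sup>2 = (\<Sum>i<n. \<Sum>j<n. \<psi> (x i) * \<psi> (x j))" for x
    by (simp add: power2_eq_square sum_product)
  show "integrable ?M (\<lambda>x. (\<Sum>i<n. \<psi> (x i))\<^sup>2)"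
    unfolding sq using prod_int by (intro Bochner_Integration.integrable_sum) auto
  have "(\<integral>x. (\<Sum>i<n. \<psi> (x i))\<^sup>2 \<partial>?M) = (\<Sum>i<n. \<integral>x. (\<Sum>j<n. \<psi> (x i) * \<psi> (x j)) \<partial>?M)"
    unfolding sq using prod_int
    by (intro Bochner_Integration.integral_sum Bochner_Integration.integrable_sum) auto
  also have "\<dots> = (\<Sum>i<n. \<Sum>j<n. \<integral>x. \<psi> (x i) * \<psi> (x j) \<partial>?M)"
    using prod_int by (intro sum.cong refl Bochner_Integration.integral_sum) auto
  also have "\<dots> = (\<Sum>i<n. \<Sum>j<n. if i = j then (\<integral>x. (\<psi> x)\<^sup>2 \<partial>\<mu>) else 0)"
    by (intro sum.cong refl) (simp add: prod_eq)
  finally show "(\<integral>x. (\<Sum>i<n. \<psi> (x i))\<^sup>2 \<partial>?M) = real n * (\<integral>x. (\<psi> x)\<^sup>2 \<partial>\<mu>)"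
    by (simp add: sum.delta)
qed

text \<open>Chebyshev: the variance of the sum grows like n, the square of the allowed deviation
  like n^2.\<close>

lemma eventually_half_mean:
  fixes \<mu> :: "'a measure" and \<phi> :: "'a \<Rightarrow> real"
  assumes \<mu>: "prob_space \<mu>" and \<phi>: "integrable \<mu> \<phi>" "integrable \<mu> (\<lambda>x. (\<phi> x)\<^sup>2)" and \<eta>: "0 < \<eta>"
  shows "\<forall>\<^sub>F n in sequentially. 1/2 \<le> measure (PiM {..<n} (\<lambda>_. \<mu>))
    {x \<in> space (PiM {..<n} (\<lambda>_. \<mu>)). (\<Sum>i<n. \<phi> (x i)) \<le> real n * ((\<integral>x. \<phi> x \<partial>\<mu>) + \<eta>)}"
proof -
  interpret \<mu>: prob_space \<mu> by fact
  define m where "m = (\<integral>x. \<phi> x \<partial>\<mu>)"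
  define \<psi> where "\<psi> x = \<phi> x - m" for x
  have \<psi>2_eq: "(\<lambda>x. (\<psi> x)\<^sup>2) = (\<lambda>x. (\<phi> x)\<^sup>2 - 2 * m * \<phi> x + m\<^sup>2)"
    by (simp add: \<psi>_def power2_diff algebra_simps)
  have \<psi>: "integrable \<mu> \<psi>" "integrable \<mu> (\<lambda>x. (\<psi> x)\<^sup>2)" "(\<integral>x. \<psi> x \<partial>\<mu>) = 0"
    using \<phi> by (simp_all add: \<psi>2_eq) (simp_all add: \<psi>_def[abs_def] m_def \<mu>.prob_space)
  define v where "v = (\<integral>x. (\<psi> x)\<^sup>2 \<partial>\<mu>)"
  have v: "0 \<le> v" unfolding v_def by simp
  \<comment> \<open>The Chebyshev bound \<open>v / (n * \<eta>\<^sup>2)\<close> is at most 1/2 from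
    here on; the added 1 guarantees n > 0.\<close>
  obtain N where N: "2 * v / \<eta>\<^sup>2 + 1 \<le> real N" using real_arch_simple by blast
  show ?thesis
  proof (rule eventually_sequentiallyI)
    fix n assume n: "N \<le> n"
    have "0 \<le> 2 * v / \<eta>\<^sup>2" using v by simp
    then have n_pos: "0 < n" using N n by (intro gr0I) auto
    let ?M = "PiM {..<n} (\<lambda>_. \<mu>)"
    interpret M: prob_space ?M using \<mu> by (intro prob_space_PiM)
    have [measurable]: "\<psi> \<in> borel_measurable \<mu>" "\<phi> \<in> borel_measurable \<mu>" using \<psi> \<phi> by auto
    let ?B = "{x \<in> space ?M. (real n * \<eta>)\<^sup>2 \<le> (\<Sum>i<n. \<psi> (x i))\<^sup>2}"
    let ?A = "{x \<in> space ?M. (\<Sum>i<n. \<phi> (x i)) \<le> real n * (m + \<eta>)}"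
    have "measure ?M ?B \<le> (\<integral>x. (\<Sum>i<n. \<psi> (x i))\<^sup>2 \<partial>?M) / (real n * \<eta>)\<^sup>2"
      using sum_second_moment(1)[OF \<mu> \<psi>] n_pos \<eta>
      by (intro integral_Markov_inequality_measure[where A = "{}"]) auto
    also have "\<dots> = v / (n * \<eta>\<^sup>2)"
      unfolding sum_second_moment(2)[OF \<mu> \<psi>] v_def[symmetric]
      using n_pos by (simp add: power2_eq_square)
    also have "\<dots> \<le> 1/2"
    proof -
      have "2 * v / \<eta>\<^sup>2 \<le> real n" using N n by linarith
      then show ?thesis using n_pos \<eta> by (simp add: field_simps)
    qed
    finally have B: "measure ?M ?B \<le> 1/2" .
    have "space ?M - ?A \<subseteq> ?B"
    proof
      fix x assume x: "x \<in> space ?M - ?A"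
      then have "real n * \<eta> \<le> (\<Sum>i<n. \<psi> (x i))"
        by (auto simp: \<psi>_def sum_subtractf algebra_simps)
      then show "x \<in> ?B" using x \<eta> by (auto intro!: power_mono)
    qed
    then have "measure ?M (space ?M - ?A) \<le> 1/2"
      using B by (intro order_trans[OF M.finite_measure_mono B]) auto
    moreover have "?A \<in> sets ?M" by measurable
    ultimately show "1/2 \<le> measure ?M {x \<in> space ?M. (\<Sum>i<n. \<phi> (x i)) \<le> real n * ((\<integral>x. \<phi> x \<partial>\<mu>) + \<eta>)}"
      using M.prob_compl[of ?A] by (simp add: m_def)
  qed
qed

text \<open>The n-th root argument without roots: a bound on all large powers, however big, has no
  influence on the base. Here the constant b disappears.\<close>

lemma bounded_powers_le_1:
  fixes J :: ennreal
  assumes "\<forall>\<^sub>F n in sequentially. J ^ n \<le> ennreal K"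
  shows "J \<le> 1"
proof (rule ccontr)
  assume "\<not> J \<le> 1"
  then have "1 < J" by simp
  obtain N where N: "\<And>n. N \<le> n \<Longrightarrow> J ^ n \<le> ennreal K"
    using assms by (auto simp: eventually_sequentially)
  show False
  proof (cases J)
    case (real j)
    with \<open>1 < J\<close> have j: "1 < j" by (simp add: one_less_ennreal)
    obtain n where n: "max 0 K < j ^ n" using real_arch_pow[OF j] by blast
    have "j ^ n \<le> j ^ (max n N)" using j by (intro power_increasing) auto
    moreover have "ennreal (j ^ max n N) \<le> ennreal K"
      using N[of "max n N"] real by (simp add: ennreal_power)
    then have "j ^ max n N \<le> max 0 K" unfolding ennreal_le_iff2 by linarith
    ultimately show False using n by linarith
  next
    case top
    then show False using N[of "Suc N"] by (simp add: top_power_ennreal top_unique)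
  qed
qed

text \<open>The slack \<open>\<eta>\<close> in the mean gives the starting set mass 1/2 for large n.
  A level s above \<open>real n * (m + \<eta>)\<close> corresponds to the radius
  \<open>s / (4 * \<kappa>)\<close>, hence the decay rate \<open>a / (4 * \<kappa>)\<close> below
  which t must stay. By independence, the moment of the sum is the n-th power of the one-coordinate
  moment \<open>J\<close>.\<close>

lemma concentration_imp_exp_moment:
  fixes \<mu> :: "(real^'d) measure"
  assumes \<mu>: "prob_space \<mu>" "sets \<mu> = sets borel" and p: "1 \<le> p" "p \<le> 2"
    and ab: "0 < a" "0 \<le> b" and conc: "concentration \<mu> p a b"
    and \<kappa>: "0 < \<kappa>" and t: "0 < t" "t < a / (4 * \<kappa>)"
    and f: "f \<in> borel_measurable borel" and \<phi>: "\<phi> \<in> borel_measurable borel"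
    and \<phi>_int: "integrable \<mu> \<phi>" "integrable \<mu> (\<lambda>x. (\<phi> x)\<^sup>2)"
    and f\<phi>: "\<And>x y. f x \<le> \<phi> y + \<kappa> * cost p (x - y)"
  shows "(\<integral>\<^sup>+ x. ennreal (exp (t * f x)) \<partial>\<mu>) \<le> ennreal (exp (t * (\<integral>x. \<phi> x \<partial>\<mu>)))"
proof -
  define m where "m = (\<integral>x. \<phi> x \<partial>\<mu>)"
  have [measurable]: "f \<in> borel_measurable \<mu>"
    using f by (simp add: measurable_cong_sets[OF \<mu>(2) refl])
  interpret product_sigma_finite "\<lambda>_::nat. \<mu>"
    using \<mu>(1) by (simp add: product_sigma_finite_def prob_space_imp_sigma_finite)
  have bound: "(\<integral>\<^sup>+ x. ennreal (exp (t * f x)) \<partial>\<mu>) \<le> ennreal (exp (t * (m + \<eta>)))" if \<eta>: "0 < \<eta>" for \<eta>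
  proof -
    define J where "J = (\<integral>\<^sup>+ x. ennreal (exp (t * (f x - (m + \<eta>)))) \<partial>\<mu>)"
    define K where "K = 1 + b * exp t / (1 - exp (t - a / (4 * \<kappa>)))"
    have "\<forall>\<^sub>F n in sequentially. J ^ n \<le> ennreal K"
      using eventually_half_mean[OF \<mu>(1) \<phi>_int \<eta>] eventually_ge_at_top[of 1]
    proof eventually_elim
      case (elim n)
      let ?M = "PiM {..<n} (\<lambda>_. \<mu>)"
      interpret M: prob_space ?M using \<mu> by (intro prob_space_PiM)
      let ?X = "\<lambda>x. (\<Sum>i<n. f (x i)) - real n * (m + \<eta>)"
      have "J ^ n = (\<integral>\<^sup>+ x. (\<Prod>i<n. ennreal (exp (t * (f (x i) - (m + \<eta>))))) \<partial>?M)"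
        unfolding J_def by (subst product_nn_integral_prod) auto
      also have "\<dots> = (\<integral>\<^sup>+ x. ennreal (exp (t * ?X x)) \<partial>?M)"
        by (intro nn_integral_cong)
          (simp add: prod_ennreal exp_sum[symmetric] sum_distrib_left[symmetric] sum_subtractf)
      also have "\<dots> \<le> ennreal K"
        unfolding K_def
      proof (rule exp_moment_of_tail[OF M.prob_space_axioms _ t ab(2)])
        fix s :: real assume s: "0 \<le> s"
        have "{x \<in> space ?M. s < ?X x} = {x \<in> space ?M. real n * (m + \<eta>) + 4 * \<kappa> * (s / (4 * \<kappa>)) < (\<Sum>i<n. f (x i))}"
          using \<kappa> by auto
        then show "measure ?M {x \<in> space ?M. s < ?X x} \<le> b * exp (- (a / (4 * \<kappa>)) * s)"
          using concentration_tail[OF \<mu> p conc elim(2) _ f \<phi> f\<phi> elim(1), of "s / (4 * \<kappa>)"] \<kappa> s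
          by (simp add: m_def)
      qed measurable
      finally show ?case .
    qed
    then have "J \<le> 1" by (rule bounded_powers_le_1)
    then have "ennreal (exp (t * (m + \<eta>))) * J \<le> ennreal (exp (t * (m + \<eta>))) * 1"
      by (intro mult_left_mono) auto
    also have "ennreal (exp (t * (m + \<eta>))) * J
        = (\<integral>\<^sup>+ x. ennreal (exp (t * (m + \<eta>))) * ennreal (exp (t * (f x - (m + \<eta>)))) \<partial>\<mu>)"
      unfolding J_def by (rule nn_integral_cmult[symmetric]) measurable
    also have "\<dots> = (\<integral>\<^sup>+ x. ennreal (exp (t * f x)) \<partial>\<mu>)"
      by (simp add: ennreal_mult[symmetric] exp_add[symmetric] algebra_simps)
    finally show ?thesis by simp
  qed
  have "((\<lambda>\<eta>. ennreal (exp (t * (m + \<eta>)))) \<longlongrightarrow> ennreal (exp (t * (m + 0)))) (at_right 0)"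
    by (intro tendsto_intros tendsto_ennrealI)
  moreover have "\<forall>\<^sub>F \<eta> in at_right 0. (\<integral>\<^sup>+ x. ennreal (exp (t * f x)) \<partial>\<mu>) \<le> ennreal (exp (t * (m + \<eta>)))"
    using bound by (intro eventually_at_rightI[of 0 1]) auto
  ultimately have "(\<integral>\<^sup>+ x. ennreal (exp (t * f x)) \<partial>\<mu>) \<le> ennreal (exp (t * (m + 0)))"
    by (rule tendsto_lowerbound) simp
  then show ?thesis by (simp add: m_def)
qed

section \<open>Relative entropy and the Gibbs variational principle\<close>

text \<open>Since -ln y is at most 1 / y - 1, changing measure bounds the integral of the negative
  part of the logarithm by 1. Finite entropy then makes the positive part finite too, and the
  difference in the definition is a genuine integral. The change of measure is only an inequality
  because the set where the density vanishes contributes to the \<open>\<mu>\<close>-integral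
  alone.\<close>

lemma finite_entropy_integrable_ln:
  fixes \<mu> \<nu> :: "'a measure"
  assumes \<mu>: "prob_space \<mu>" and \<nu>: "prob_space \<nu>" "sets \<nu> = sets \<mu>" and H: "rel_entropy \<nu> \<mu> < \<infinity>"
  shows "absolutely_continuous \<mu> \<nu>"
    and "AE x in \<nu>. 0 < enn2real (RN_deriv \<mu> \<nu> x)"
    and "\<And>g. g \<in> borel_measurable \<mu> \<Longrightarrow>
       (\<integral>\<^sup>+ x. ennreal (exp (g x) / enn2real (RN_deriv \<mu> \<nu> x)) \<partial>\<nu>) \<le> (\<integral>\<^sup>+ x. ennreal (exp (g x)) \<partial>\<mu>)"
    and "integrable \<nu> (\<lambda>x. ln (enn2real (RN_deriv \<mu> \<nu> x)))"
    and "rel_entropy \<nu> \<mu> = ereal (\<integral>x. ln (enn2real (RN_deriv \<mu> \<nu> x)) \<partial>\<nu>)"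
proof -
  interpret \<mu>: prob_space \<mu> by fact
  interpret \<nu>: prob_space \<nu> by fact
  define F where "F = RN_deriv \<mu> \<nu>"
  define u where "u x = ln (enn2real (F x))" for x
  show ac: "absolutely_continuous \<mu> \<nu>"
    using H by (auto simp: rel_entropy_def split: if_splits)
  have F [measurable]: "F \<in> borel_measurable \<mu>" by (simp add: F_def)
  have dens: "density \<mu> F = \<nu>" unfolding F_def by (rule \<mu>.density_RN_deriv[OF ac \<nu>(2)])
  have "AE x in \<mu>. F x \<noteq> \<infinity>"
    unfolding F_def using \<mu>.RN_deriv_finite[OF \<nu>.sigma_finite_measure_axioms ac \<nu>(2)] .
  then have "AE x in density \<mu> F. 0 < enn2real (F x)"
    by (subst AE_density) (auto simp: enn2real_positive_iff less_top elim: eventually_mono)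
  then have pos: "AE x in \<nu>. 0 < enn2real (F x)" unfolding dens .
  then show "AE x in \<nu>. 0 < enn2real (RN_deriv \<mu> \<nu> x)" by (simp add: F_def)
  have change: "(\<integral>\<^sup>+ x. ennreal (exp (g x) / enn2real (F x)) \<partial>\<nu>) \<le> (\<integral>\<^sup>+ x. ennreal (exp (g x)) \<partial>\<mu>)"
    if [measurable]: "g \<in> borel_measurable \<mu>" for g
  proof -
    have "(\<integral>\<^sup>+ x. ennreal (exp (g x) / enn2real (F x)) \<partial>\<nu>)
        = (\<integral>\<^sup>+ x. F x * ennreal (exp (g x) / enn2real (F x)) \<partial>\<mu>)"
      unfolding dens[symmetric] by (rule nn_integral_density) auto
    also have "\<dots> \<le> (\<integral>\<^sup>+ x. ennreal (exp (g x)) \<partial>\<mu>)"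
    proof (intro nn_integral_mono)
      fix x
      show "F x * ennreal (exp (g x) / enn2real (F x)) \<le> ennreal (exp (g x))"
        by (cases "F x") (auto simp: ennreal_mult[symmetric])
    qed
    finally show ?thesis .
  qed
  then show "\<And>g. g \<in> borel_measurable \<mu> \<Longrightarrow>
       (\<integral>\<^sup>+ x. ennreal (exp (g x) / enn2real (RN_deriv \<mu> \<nu> x)) \<partial>\<nu>) \<le> (\<integral>\<^sup>+ x. ennreal (exp (g x)) \<partial>\<mu>)"
    by (simp add: F_def)
  have u_meas [measurable]: "u \<in> borel_measurable \<nu>"
    unfolding measurable_cong_sets[OF \<nu>(2) refl] u_def[abs_def] by measurable
  define P where "P = (\<integral>\<^sup>+ x. ennreal (max 0 (u x)) \<partial>\<nu>)"
  define N where "N = (\<integral>\<^sup>+ x. ennreal (max 0 (- u x)) \<partial>\<nu>)"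
  have H_eq: "rel_entropy \<nu> \<mu> = enn2ereal P - enn2ereal N"
    using ac by (simp add: rel_entropy_def P_def N_def u_def F_def Let_def)
  have "N \<le> (\<integral>\<^sup>+ x. ennreal (exp 0 / enn2real (F x)) \<partial>\<nu>)"
    unfolding N_def
  proof (intro nn_integral_mono ennreal_leI)
    fix x
    show "max 0 (- u x) \<le> exp 0 / enn2real (F x)"
    \<comment> \<open>At a zero of the real density both sides are 0, as \<open>ln 0 = 0\<close> and
      division by zero gives 0.\<close>
    proof (cases "enn2real (F x) = 0")
      case False
      then have pos: "0 < enn2real (F x)" using enn2real_nonneg[of "F x"] by linarith
      then have "ln (1 / enn2real (F x)) \<le> 1 / enn2real (F x) - 1" by (intro ln_le_minus_one) simp
      then show ?thesis using pos by (simp add: u_def ln_div)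
    qed (simp add: u_def)
  qed
  also have "\<dots> \<le> 1" using change[of "\<lambda>_. 0"] by (simp add: \<mu>.emeasure_space_1)
  finally have N: "N < \<infinity>" by (simp add: le_less_trans)
  have P: "P < \<infinity>"
    using H unfolding H_eq by (cases P; cases N) (auto simp: enn2ereal_ennreal)
  have "(\<integral>\<^sup>+ x. ennreal (norm (u x)) \<partial>\<nu>) = (\<integral>\<^sup>+ x. ennreal (max 0 (u x)) + ennreal (max 0 (- u x)) \<partial>\<nu>)"
    by (intro nn_integral_cong) (auto simp: ennreal_plus[symmetric] max_def simp del: ennreal_plus)
  also have "\<dots> = P + N" unfolding P_def N_def by (rule nn_integral_add) auto
  finally have "integrable \<nu> u" using P N by (auto intro!: integrableI_bounded)
  then show int: "integrable \<nu> (\<lambda>x. ln (enn2real (RN_deriv \<mu> \<nu> x)))" by (simp add: u_def[abs_def] F_def)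
  show "rel_entropy \<nu> \<mu> = ereal (\<integral>x. ln (enn2real (RN_deriv \<mu> \<nu> x)) \<partial>\<nu>)"
    by (rule rel_entropy_eq_integral[OF ac int])
qed

text \<open>Young's inequality for the conjugate pair y ln y - y and exp u, divided by y. It is
  applied pointwise with y the density of \<open>\<nu>\<close>.\<close>

lemma young_ln: "0 < y \<Longrightarrow> u \<le> ln y - 1 + exp u / (y :: real)"
proof -
  assume y: "0 < y"
  have "1 + (u - ln y) \<le> exp (u - ln y)" by (rule exp_ge_add_one_self)
  then show ?thesis using y by (simp add: exp_diff)
qed

text \<open>Young's inequality is integrated with u = g - z: the additive constant -1 cancels
  against the integral of \<open>w\<close>, which is at most 1 by the normalisation
  \<open>Z\<close>.\<close>

lemma gibbs_variational:
  fixes \<mu> \<nu> :: "'a measure"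
  assumes \<mu>: "prob_space \<mu>" and \<nu>: "prob_space \<nu>" "sets \<nu> = sets \<mu>" and H: "rel_entropy \<nu> \<mu> = ereal h"
    and g: "g \<in> borel_measurable \<mu>" "integrable \<nu> g"
    and Z: "(\<integral>\<^sup>+ x. ennreal (exp (g x)) \<partial>\<mu>) \<le> ennreal (exp z)"
  shows "(\<integral>x. g x \<partial>\<nu>) \<le> h + z"
proof -
  interpret \<nu>: prob_space \<nu> by fact
  define u where "u x = ln (enn2real (RN_deriv \<mu> \<nu> x))" for x
  define w where "w x = exp (g x - z) / enn2real (RN_deriv \<mu> \<nu> x)" for x
  have "rel_entropy \<nu> \<mu> < \<infinity>" using H by simp
  note fin = finite_entropy_integrable_ln[OF \<mu> \<nu> this]
  have u: "integrable \<nu> u" "(\<integral>x. u x \<partial>\<nu>) = h"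
    using fin(4,5) H by (simp_all add: u_def[abs_def])
  have [measurable]: "g \<in> borel_measurable \<mu>" by fact
  have "(\<integral>\<^sup>+ x. ennreal (w x) \<partial>\<nu>) \<le> (\<integral>\<^sup>+ x. ennreal (exp (g x - z)) \<partial>\<mu>)"
    unfolding w_def by (rule fin(3)) measurable
  also have "\<dots> = (\<integral>\<^sup>+ x. ennreal (exp (- z)) * ennreal (exp (g x)) \<partial>\<mu>)"
    by (simp add: ennreal_mult[symmetric] exp_add[symmetric])
  also have "\<dots> = ennreal (exp (- z)) * (\<integral>\<^sup>+ x. ennreal (exp (g x)) \<partial>\<mu>)"
    by (rule nn_integral_cmult) measurable
  also have "\<dots> \<le> ennreal (exp (- z)) * ennreal (exp z)"
    using Z by (rule mult_left_mono) simp
  also have "\<dots> = 1" by (simp add: ennreal_mult[symmetric] exp_add[symmetric])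
  finally have w_le: "(\<integral>\<^sup>+ x. ennreal (w x) \<partial>\<nu>) \<le> 1" .
  have w_nonneg: "0 \<le> w x" for x by (simp add: w_def)
  have w_meas: "w \<in> borel_measurable \<nu>"
    unfolding measurable_cong_sets[OF \<nu>(2) refl] w_def[abs_def] by measurable
  have w: "integrable \<nu> w"
    using w_le w_meas w_nonneg by (intro integrableI_nonneg) (auto simp: le_less_trans)
  have "(\<integral>x. w x \<partial>\<nu>) \<le> 1"
    using w_le nn_integral_eq_integral[OF w] w_nonneg by simp
  have "(\<integral>x. g x \<partial>\<nu>) \<le> (\<integral>x. u x + (z - 1) + w x \<partial>\<nu>)"
  proof (rule integral_mono_AE)
    show "AE x in \<nu>. g x \<le> u x + (z - 1) + w x"
      using fin(2)
    proof eventually_elim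
      case (elim x)
      from young_ln[OF elim, of "g x - z"] show ?case by (simp add: u_def w_def)
    qed
  qed (use g u w in auto)
  also have "\<dots> = h + (z - 1) + (\<integral>x. w x \<partial>\<nu>)"
    using u w by (simp add: \<nu>.prob_space)
  finally show ?thesis using \<open>(\<integral>x. w x \<partial>\<nu>) \<le> 1\<close> by simp
qed

text \<open>The same Young inequality used as a domination: t g is at most the modulus of the
  log-density plus a weight that is integrable by the exponential moment.\<close>

lemma finite_entropy_integrable:
  fixes \<mu> \<nu> :: "'a measure"
  assumes \<mu>: "prob_space \<mu>" and \<nu>: "prob_space \<nu>" "sets \<nu> = sets \<mu>" and H: "rel_entropy \<nu> \<mu> < \<infinity>"
    and g: "g \<in> borel_measurable \<mu>" "\<And>x. 0 \<le> g x"
    and t: "0 < t" and Z: "(\<integral>\<^sup>+ x. ennreal (exp (t * g x)) \<partial>\<mu>) < \<infinity>"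
  shows "integrable \<nu> g"
proof -
  define u where "u x = ln (enn2real (RN_deriv \<mu> \<nu> x))" for x
  define w where "w x = exp (t * g x) / enn2real (RN_deriv \<mu> \<nu> x)" for x
  note fin = finite_entropy_integrable_ln[OF \<mu> \<nu> H]
  have [measurable]: "g \<in> borel_measurable \<mu>" by fact
  have "(\<integral>\<^sup>+ x. ennreal (w x) \<partial>\<nu>) \<le> (\<integral>\<^sup>+ x. ennreal (exp (t * g x)) \<partial>\<mu>)"
    unfolding w_def by (rule fin(3)) measurable
  then have "(\<integral>\<^sup>+ x. ennreal (w x) \<partial>\<nu>) < \<infinity>" using Z by (rule le_less_trans)
  moreover have "w \<in> borel_measurable \<nu>"
    unfolding measurable_cong_sets[OF \<nu>(2) refl] w_def[abs_def] by measurable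
  ultimately have w: "integrable \<nu> w" by (intro integrableI_nonneg) (auto simp: w_def)
  have "integrable \<nu> (\<lambda>x. t * g x)"
  proof (rule Bochner_Integration.integrable_bound)
    show "integrable \<nu> (\<lambda>x. \<bar>u x\<bar> + w x)"
      using fin(4) w by (simp add: u_def)
    show "AE x in \<nu>. norm (t * g x) \<le> norm (\<bar>u x\<bar> + w x)"
      using fin(2)
    proof eventually_elim
      case (elim x)
      from young_ln[OF elim, of "t * g x"] have "t * g x \<le> \<bar>u x\<bar> + w x"
        by (simp add: u_def w_def)
      then show ?case using t g(2)[of x] by simp
    qed
    show "(\<lambda>x. t * g x) \<in> borel_measurable \<nu>"
      unfolding measurable_cong_sets[OF \<nu>(2) refl] by measurable
  qed
  then show ?thesis using t by simp
qed

section \<open>Approximation by simple functions\<close>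

lemma simple_approximation:
  "\<exists>\<rho> :: nat \<Rightarrow> real^'d \<Rightarrow> real^'d. (\<forall>i. simple_function borel (\<rho> i)) \<and>
    (\<forall>x. (\<lambda>i. \<rho> i x) \<longlonglongrightarrow> x) \<and> (\<forall>i x. norm (x - \<rho> i x) \<le> 3 * norm x)"
proof -
  obtain \<rho> :: "nat \<Rightarrow> real^'d \<Rightarrow> real^'d" where \<rho>: "\<And>i. simple_function borel (\<rho> i)"
    "\<And>x. (\<lambda>i. \<rho> i x) \<longlonglongrightarrow> x" "\<And>i x. dist (\<rho> i x) 0 \<le> 2 * dist x 0"
    using borel_measurable_implies_sequence_metric[of "\<lambda>x. x" "borel :: (real^'d) measure" 0] by auto
  have "norm (x - \<rho> i x) \<le> 3 * norm x" for i x
    using norm_triangle_ineq4[of x "\<rho> i x"] \<rho>(3)[of i x] by simp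
  with \<rho>(1,2) show ?thesis by blast
qed

text \<open>The 9 is 3^2 from \<open>alpha_p_mult_le\<close>, and the two passages between cost and
  norm contribute a dimension factor each. With \<open>y = x - \<rho> i x\<close> this is the
  domination for the approximation error.\<close>

lemma cost_le_cost_norm:
  fixes x y :: "real^'d"
  assumes "0 \<le> p" "p \<le> 2" "norm y \<le> 3 * norm x"
  shows "cost p y \<le> 9 * CARD('d)\<^sup>2 * cost p x"
proof -
  have "cost p y \<le> CARD('d) * alpha_p p (norm y)"
    using assms by (intro cost_le_alpha_p_norm)
  also have "\<dots> \<le> CARD('d) * alpha_p p (3 * norm x)"
    using assms by (intro mult_left_mono alpha_p_mono) auto
  also have "\<dots> \<le> CARD('d) * (3\<^sup>2 * (CARD('d) * cost p x))"
    using alpha_p_mult_le[of 3 p "norm x"] alpha_p_norm_le_cost[OF assms(1,2), of x] assms(2)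
    by (intro mult_left_mono) auto
  finally show ?thesis by (simp add: power2_eq_square algebra_simps)
qed

lemma cost_approximation_tendsto:
  fixes M :: "(real^'d) measure"
  assumes p: "0 \<le> p" "p \<le> 2" and M: "sets M = sets borel" "integrable M (cost p)"
    and \<rho>: "\<And>i. simple_function borel (\<rho> i)" "\<And>x. (\<lambda>i. \<rho> i x) \<longlonglongrightarrow> x"
      "\<And>i x. norm (x - \<rho> i x) \<le> 3 * norm x"
  shows "(\<lambda>i. \<integral>x. cost p (x - \<rho> i x) \<partial>M) \<longlonglongrightarrow> 0"
proof -
  have \<rho>_meas [measurable]: "\<rho> i \<in> borel_measurable borel" for i
    using \<rho>(1) by (rule borel_measurable_simple_function)
  have "(\<lambda>i. \<integral>x. cost p (x - \<rho> i x) \<partial>M) \<longlonglongrightarrow> (\<integral>x. 0 \<partial>M)"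
  proof (rule integral_dominated_convergence)
    show "integrable M (\<lambda>x. 9 * CARD('d)\<^sup>2 * cost p x)" using M(2) by simp
    show "(\<lambda>x. cost p (x - \<rho> i x)) \<in> borel_measurable M" for i
      unfolding measurable_cong_sets[OF M(1) refl] by measurable
    show "AE x in M. norm (cost p (x - \<rho> i x)) \<le> 9 * CARD('d)\<^sup>2 * cost p x" for i
      using cost_le_cost_norm[OF p \<rho>(3)] by (simp add: cost_nonneg)
    show "AE x in M. (\<lambda>i. cost p (x - \<rho> i x)) \<longlonglongrightarrow> 0"
    proof (rule AE_I2)
      fix x
      have "(\<lambda>i. CARD('d) * (norm (x - \<rho> i x))\<^sup>2) \<longlonglongrightarrow> CARD('d) * (norm (x - x))\<^sup>2"
        by (intro tendsto_intros \<rho>(2))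
      then have lim: "(\<lambda>i. CARD('d) * (norm (x - \<rho> i x))\<^sup>2) \<longlonglongrightarrow> 0" by simp
      have le: "cost p z \<le> CARD('d) * (norm z)\<^sup>2" for z :: "real^'d"
        using cost_le_alpha_p_norm[OF p(1), of z]
        by (rule order_trans) (intro mult_left_mono, auto simp: alpha_p_def)
      show "(\<lambda>i. cost p (x - \<rho> i x)) \<longlonglongrightarrow> 0"
        by (rule tendsto_sandwich[OF _ _ tendsto_const lim]) (simp_all add: cost_nonneg le)
    qed
  qed simp
  then show ?thesis by simp
qed

text \<open>Finite duality is applied to the images of both measures under the simple function, and
  \<open>coupling_from_cells\<close> lifts the plan to the measures themselves. The factor 3 comes
  from cutting x - y at the two rounded points. Only potentials on the finite range have to be
  tested in \<open>dual\<close>.\<close>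

lemma transport_cost_le_cells:
  fixes \<nu> \<mu> :: "(real^'d) measure"
  assumes \<nu>: "prob_space \<nu>" "sets \<nu> = sets borel" and \<mu>: "prob_space \<mu>" "sets \<mu> = sets borel"
    and p: "0 \<le> p" "p \<le> 2" and \<rho>: "simple_function borel \<rho>"
    and int: "integrable \<nu> (\<lambda>x. cost p (x - \<rho> x))" "integrable \<mu> (\<lambda>x. cost p (x - \<rho> x))"
    and dual: "\<And>f g. (\<And>s t. s \<in> range \<rho> \<Longrightarrow> t \<in> range \<rho> \<Longrightarrow> f s - g t \<le> cost p (s - t))
        \<Longrightarrow> (\<integral>x. f (\<rho> x) \<partial>\<nu>) - (\<integral>y. g (\<rho> y) \<partial>\<mu>) \<le> V"
  shows "transport_cost p \<nu> \<mu>
    \<le> ennreal (3 * ((\<integral>x. cost p (x - \<rho> x) \<partial>\<nu>) + V + (\<integral>y. cost p (y - \<rho> y) \<partial>\<mu>)))"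
proof -
  interpret \<nu>: prob_space \<nu> by fact
  interpret \<mu>: prob_space \<mu> by fact
  have space: "space \<nu> = UNIV" "space \<mu> = UNIV"
    using sets_eq_imp_space_eq[OF \<nu>(2)] sets_eq_imp_space_eq[OF \<mu>(2)] by auto
  define S where "S = range \<rho>"
  have S: "finite S" using simple_functionD(1)[OF \<rho>] by (simp add: S_def)
  have cells: "\<rho> -` {s} \<in> sets borel" for s using simple_functionD(2)[OF \<rho>, of "{s}"] by simp
  have \<rho>_meas [measurable]: "\<rho> \<in> borel_measurable borel"
    using \<rho> by (rule borel_measurable_simple_function)
  have simple_integral: "(\<integral>x. f (\<rho> x) \<partial>M) = (\<Sum>s\<in>S. measure M (\<rho> -` {s}) * f s)"
    if M: "prob_space M" "sets M = sets borel" for M and f :: "real^'d \<Rightarrow> real"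
  proof -
    interpret prob_space M by fact
    have "(\<integral>x. f (\<rho> x) \<partial>M) = (\<integral>x. (\<Sum>s\<in>S. indicator (\<rho> -` {s}) x * f s) \<partial>M)"
    proof (intro Bochner_Integration.integral_cong refl)
      fix x
      have "(\<Sum>s\<in>S. indicator (\<rho> -` {s}) x * f s) = (\<Sum>s\<in>S. if s = \<rho> x then f s else 0)"
        by (intro sum.cong refl) (auto simp: indicator_def)
      then show "f (\<rho> x) = (\<Sum>s\<in>S. indicator (\<rho> -` {s}) x * f s)"
        using S by (simp add: sum.delta S_def)
    qed
    also have "\<dots> = (\<Sum>s\<in>S. \<integral>x. indicator (\<rho> -` {s}) x * f s \<partial>M)"
      using cells M(2) by (intro Bochner_Integration.integral_sum integrable_mult_left)
        (auto intro!: integrable_real_indicator simp: less_top[symmetric])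
    also have "\<dots> = (\<Sum>s\<in>S. measure M (\<rho> -` {s}) * f s)"
      using cells M(2) sets_eq_imp_space_eq[OF M(2)] by (intro sum.cong refl) simp
    finally show ?thesis .
  qed
  have total: "(\<Sum>s\<in>S. measure M (\<rho> -` {s})) = 1" if "prob_space M" "sets M = sets borel" for M
    using simple_integral[OF that, of "\<lambda>_. 1"] prob_space.prob_space[OF that(1)] by simp
  have "\<exists>\<pi>. (\<forall>s t. 0 \<le> \<pi> (s, t)) \<and> (\<forall>s\<in>S. (\<Sum>t\<in>S. \<pi> (s, t)) = measure \<nu> (\<rho> -` {s})) \<and>
     (\<forall>t\<in>S. (\<Sum>s\<in>S. \<pi> (s, t)) = measure \<mu> (\<rho> -` {t})) \<and> (\<Sum>(s, t)\<in>S \<times> S. \<pi> (s, t) * cost p (s - t)) \<le> V"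
  proof (rule finite_kantorovich_duality[OF S])
    fix f g :: "real^'d \<Rightarrow> real"
    assume "\<And>s t. s \<in> S \<Longrightarrow> t \<in> S \<Longrightarrow> f s - g t \<le> cost p (s - t)"
    then show "(\<Sum>s\<in>S. measure \<nu> (\<rho> -` {s}) * f s) - (\<Sum>t\<in>S. measure \<mu> (\<rho> -` {t}) * g t) \<le> V"
      using dual[of f g] by (simp add: simple_integral[OF \<nu>] simple_integral[OF \<mu>] S_def)
  qed (use total[OF \<nu>] total[OF \<mu>] in \<open>auto simp: cost_nonneg\<close>)
  then obtain \<pi> where \<pi>: "\<And>s t. 0 \<le> \<pi> (s, t)"
    "\<And>s. s \<in> S \<Longrightarrow> (\<Sum>t\<in>S. \<pi> (s, t)) = measure \<nu> (\<rho> -` {s})"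
    "\<And>t. t \<in> S \<Longrightarrow> (\<Sum>s\<in>S. \<pi> (s, t)) = measure \<mu> (\<rho> -` {t})"
    "(\<Sum>(s, t)\<in>S \<times> S. \<pi> (s, t) * cost p (s - t)) \<le> V"
    by blast
  have "\<exists>\<Gamma> \<in> couplings \<nu> \<mu>. (\<lambda>z. cost p (\<rho> (fst z) - \<rho> (snd z))) \<in> borel_measurable \<Gamma> \<and>
    (\<integral>\<^sup>+ z. ennreal (cost p (\<rho> (fst z) - \<rho> (snd z))) \<partial>\<Gamma>) \<le> ennreal (\<Sum>(s, t)\<in>S \<times> S. \<pi> (s, t) * cost p (s - t))"
    using cells \<nu>(2) \<mu>(2)
    by (intro coupling_from_cells[OF \<nu>(1) \<mu>(1) S _ space _ _ \<pi>(1-3) cost_nonneg]) (auto simp: S_def)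
  then obtain \<Gamma> where \<Gamma>: "\<Gamma> \<in> couplings \<nu> \<mu>" "(\<lambda>z. cost p (\<rho> (fst z) - \<rho> (snd z))) \<in> borel_measurable \<Gamma>"
    and \<Gamma>_cost: "(\<integral>\<^sup>+ z. ennreal (cost p (\<rho> (fst z) - \<rho> (snd z))) \<partial>\<Gamma>) \<le> ennreal V"
    using \<pi>(4) by (meson ennreal_leI order_trans)
  have marg: "sets \<Gamma> = sets (\<nu> \<Otimes>\<^sub>M \<mu>)" "distr \<Gamma> \<nu> fst = \<nu>" "distr \<Gamma> \<mu> snd = \<mu>"
    using \<Gamma>(1) by (auto simp: couplings_def)
  have fst_snd: "fst \<in> measurable \<Gamma> \<nu>" "snd \<in> measurable \<Gamma> \<mu>"
    by (auto simp: measurable_cong_sets[OF marg(1) refl])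
  have e_meas: "(\<lambda>x. cost p (x - \<rho> x)) \<in> borel_measurable \<nu>" "(\<lambda>x. cost p (x - \<rho> x)) \<in> borel_measurable \<mu>"
    using int by auto
  have meas: "(\<lambda>z. cost p (fst z - \<rho> (fst z))) \<in> borel_measurable \<Gamma>" "(\<lambda>z. cost p (snd z - \<rho> (snd z))) \<in> borel_measurable \<Gamma>"
    using measurable_compose[OF fst_snd(1) e_meas(1)] measurable_compose[OF fst_snd(2) e_meas(2)] by auto
  have fst_cost: "(\<integral>\<^sup>+ z. ennreal (cost p (fst z - \<rho> (fst z))) \<partial>\<Gamma>) = ennreal (\<integral>x. cost p (x - \<rho> x) \<partial>\<nu>)"
  proof -
    have "(\<integral>\<^sup>+ z. ennreal (cost p (fst z - \<rho> (fst z))) \<partial>\<Gamma>) = (\<integral>\<^sup>+ x. ennreal (cost p (x - \<rho> x)) \<partial>distr \<Gamma> \<nu> fst)"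
      using e_meas by (intro nn_integral_distr[symmetric] fst_snd) auto
    then show ?thesis unfolding marg by (simp add: nn_integral_eq_integral[OF int(1)] cost_nonneg)
  qed
  have snd_cost: "(\<integral>\<^sup>+ z. ennreal (cost p (snd z - \<rho> (snd z))) \<partial>\<Gamma>) = ennreal (\<integral>x. cost p (x - \<rho> x) \<partial>\<mu>)"
  proof -
    have "(\<integral>\<^sup>+ z. ennreal (cost p (snd z - \<rho> (snd z))) \<partial>\<Gamma>) = (\<integral>\<^sup>+ x. ennreal (cost p (x - \<rho> x)) \<partial>distr \<Gamma> \<mu> snd)"
      using e_meas by (intro nn_integral_distr[symmetric] fst_snd) auto
    then show ?thesis unfolding marg by (simp add: nn_integral_eq_integral[OF int(2)] cost_nonneg)
  qed
  have V: "0 \<le> V" using dual[of "\<lambda>_. 0" "\<lambda>_. 0"] by (simp add: cost_nonneg)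
  have "transport_cost p \<nu> \<mu> \<le> (\<integral>\<^sup>+ z. ennreal (cost p (fst z - snd z)) \<partial>\<Gamma>)"
    unfolding transport_cost_def cost_def using \<Gamma>(1) by (intro INF_lower2[of \<Gamma>]) simp_all
  also have "\<dots> \<le> (\<integral>\<^sup>+ z. ennreal 3 * (ennreal (cost p (fst z - \<rho> (fst z)))
      + ennreal (cost p (\<rho> (fst z) - \<rho> (snd z))) + ennreal (cost p (snd z - \<rho> (snd z)))) \<partial>\<Gamma>)"
  proof (intro nn_integral_mono)
    fix z :: "(real^'d) \<times> (real^'d)"
    show "ennreal (cost p (fst z - snd z)) \<le> ennreal 3 * (ennreal (cost p (fst z - \<rho> (fst z)))
      + ennreal (cost p (\<rho> (fst z) - \<rho> (snd z))) + ennreal (cost p (snd z - \<rho> (snd z))))"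
      using cost_triangle3[OF p, of "fst z" "snd z" "\<rho> (fst z)" "\<rho> (snd z)"]
      by (simp add: cost_nonneg ennreal_plus[symmetric] ennreal_mult[symmetric] ennreal_leI del: ennreal_plus ennreal_numeral)
  qed
  also have "\<dots> = ennreal 3 * ((\<integral>\<^sup>+ z. ennreal (cost p (fst z - \<rho> (fst z))) \<partial>\<Gamma>)
      + (\<integral>\<^sup>+ z. ennreal (cost p (\<rho> (fst z) - \<rho> (snd z))) \<partial>\<Gamma>) + (\<integral>\<^sup>+ z. ennreal (cost p (snd z - \<rho> (snd z))) \<partial>\<Gamma>))"
    using meas \<Gamma>(2) by (simp add: nn_integral_cmult nn_integral_add)
  also have "\<dots> \<le> ennreal 3 * (ennreal (\<integral>x. cost p (x - \<rho> x) \<partial>\<nu>) + ennreal V + ennreal (\<integral>y. cost p (y - \<rho> y) \<partial>\<mu>))"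
    unfolding fst_cost snd_cost using \<Gamma>_cost by (intro mult_left_mono add_mono) auto
  also have "\<dots> = ennreal (3 * ((\<integral>x. cost p (x - \<rho> x) \<partial>\<nu>) + V + (\<integral>y. cost p (y - \<rho> y) \<partial>\<mu>)))"
    using V by (simp add: cost_nonneg ennreal_plus[symmetric] ennreal_mult[symmetric] del: ennreal_plus ennreal_numeral)
  finally show ?thesis .
qed

section \<open>Assembly of the transport inequality\<close>

lemma square_le_exp:
  fixes c t :: real
  assumes "0 < t" "0 \<le> c"
  shows "c\<^sup>2 \<le> 2 / t\<^sup>2 * exp (t * c)"
proof -
  have "1 + t * c + (t * c)\<^sup>2 / 2 \<le> exp (t * c)" using assms by (intro exp_lower_Taylor_quadratic) simp
  then have "(t * c)\<^sup>2 / 2 \<le> exp (t * c)" using assms mult_nonneg_nonneg[of t c] by linarith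
  then show ?thesis using assms by (simp add: field_simps)
qed

theorem concentration_imp_transport_entropy:
  fixes \<mu> :: "(real^'d) measure"
  assumes \<mu>: "prob_space \<mu>" "sets \<mu> = sets borel" and p: "1 \<le> p" "p \<le> 2"
    and ab: "0 < a" "0 \<le> b" and conc: "concentration \<mu> p a b"
  shows "transport_entropy \<mu> p (288 / a)"
  unfolding transport_entropy_def
proof (intro allI impI, elim conjE)
  fix \<nu> :: "(real^'d) measure" assume \<nu>: "prob_space \<nu>" "sets \<nu> = sets borel"
  show "enn2ereal (transport_cost p \<nu> \<mu>) \<le> ereal (288 / a) * rel_entropy \<nu> \<mu>"
  proof (cases "rel_entropy \<nu> \<mu> < \<infinity>")
    case False
    then show ?thesis using ab by simp
  next
    case True
    interpret \<mu>: prob_space \<mu> by fact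
    interpret \<nu>: prob_space \<nu> by fact
    have sets_eq: "sets \<nu> = sets \<mu>" using \<nu> \<mu> by simp
    have p': "0 \<le> p" using p by simp
    obtain h where h: "rel_entropy \<nu> \<mu> = ereal h"
      using finite_entropy_integrable_ln(5)[OF \<mu>(1) \<nu>(1) sets_eq True] by blast
    \<comment> \<open>Nonnegativity of the entropy, as the variational principle for g = 0.\<close>
    have "(\<integral>x. (0 :: real) \<partial>\<nu>) \<le> h + 0"
      by (rule gibbs_variational[OF \<mu>(1) \<nu>(1) sets_eq h]) (simp_all add: \<mu>.emeasure_space_1)
    then have h_nonneg: "0 \<le> h" by simp
    have [measurable]: "cost p \<in> borel_measurable \<mu>" "cost p \<in> borel_measurable \<nu>"
      by (simp_all add: measurable_cong_sets[OF \<mu>(2) refl] measurable_cong_sets[OF \<nu>(2) refl])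
    note moment = concentration_cost_moment[OF \<mu> p ab conc]
    have c_\<nu>: "integrable \<nu> (cost p)"
      using moment ab by (intro finite_entropy_integrable[OF \<mu>(1) \<nu>(1) sets_eq True _ cost_nonneg, where t = "a / 16"]) auto
    have exp_int: "integrable \<mu> (\<lambda>x. exp (a / 16 * cost p x))"
      using moment by (intro integrableI_nonneg) auto
    \<comment> \<open>Second moments feed the law of large numbers, since the test function
      \<open>\<Phi>\<close> below contains the unbounded rounding error.\<close>
    have c2_\<mu>: "integrable \<mu> (\<lambda>x. (cost p x)\<^sup>2)"
    proof (rule Bochner_Integration.integrable_bound)
      show "integrable \<mu> (\<lambda>x. 2 / (a / 16)\<^sup>2 * exp (a / 16 * cost p x))" using exp_int by simp
      show "AE x in \<mu>. norm ((cost p x)\<^sup>2) \<le> norm (2 / (a / 16)\<^sup>2 * exp (a / 16 * cost p x))"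
        using square_le_exp[of "a / 16"] ab by (intro AE_I2) (simp add: cost_nonneg)
    qed simp
    then have c_\<mu>: "integrable \<mu> (cost p)" by (rule \<mu>.square_integrable_imp_integrable[rotated]) measurable
    obtain \<rho> :: "nat \<Rightarrow> real^'d \<Rightarrow> real^'d" where \<rho>: "\<And>i. simple_function borel (\<rho> i)"
      "\<And>x. (\<lambda>i. \<rho> i x) \<longlonglongrightarrow> x" "\<And>i x. norm (x - \<rho> i x) \<le> 3 * norm x"
      using simple_approximation by blast
    define d\<nu> where "d\<nu> i = (\<integral>x. cost p (x - \<rho> i x) \<partial>\<nu>)" for i
    define d\<mu> where "d\<mu> i = (\<integral>x. cost p (x - \<rho> i x) \<partial>\<mu>)" for i
    have bound: "transport_cost p \<nu> \<mu> \<le> ennreal (72 / a * h + 12 * (d\<nu> i + d\<mu> i))" for i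
    proof -
      let ?e = "\<lambda>x. cost p (x - \<rho> i x)"
      have \<rho>_meas [measurable]: "\<rho> i \<in> borel_measurable borel"
        using \<rho>(1) by (rule borel_measurable_simple_function)
      have e_meas [measurable]: "?e \<in> borel_measurable borel" by measurable
      then have [measurable]: "?e \<in> borel_measurable \<mu>" "?e \<in> borel_measurable \<nu>"
        by (simp_all add: measurable_cong_sets[OF \<mu>(2) refl] measurable_cong_sets[OF \<nu>(2) refl])
      have e_le: "?e x \<le> 9 * CARD('d)\<^sup>2 * cost p x" for x
        using cost_le_cost_norm[OF p' p(2) \<rho>(3)] .
      have e_\<nu>: "integrable \<nu> ?e"
        by (rule Bochner_Integration.integrable_bound[of _ "\<lambda>x. 9 * CARD('d)\<^sup>2 * cost p x"])
          (use c_\<nu> e_le in \<open>auto simp: cost_nonneg\<close>)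
      have e_\<mu>: "integrable \<mu> ?e"
        by (rule Bochner_Integration.integrable_bound[of _ "\<lambda>x. 9 * CARD('d)\<^sup>2 * cost p x"])
          (use c_\<mu> e_le in \<open>auto simp: cost_nonneg\<close>)
      have e2_\<mu>: "integrable \<mu> (\<lambda>x. (?e x)\<^sup>2)"
      proof (rule Bochner_Integration.integrable_bound)
        show "integrable \<mu> (\<lambda>x. (9 * CARD('d)\<^sup>2)\<^sup>2 * (cost p x)\<^sup>2)" using c2_\<mu> by simp
        show "AE x in \<mu>. norm ((?e x)\<^sup>2) \<le> norm ((9 * CARD('d)\<^sup>2)\<^sup>2 * (cost p x)\<^sup>2)"
          using power_mono[OF e_le cost_nonneg, of _ 2] by (intro AE_I2) (simp add: power_mult_distrib)
      qed measurable
      \<comment> \<open>The expression in the inner parentheses is the dual bound \<open>V\<close>.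
        Expanding gives 3 * 24 = 72 for the entropy and 3 * (1 + 3) = 12 for each rounding
        error.\<close>
      have "transport_cost p \<nu> \<mu> \<le> ennreal (3 * (d\<nu> i + (24 / a * h + 3 * d\<nu> i + 3 * d\<mu> i) + d\<mu> i))"
        unfolding d\<nu>_def d\<mu>_def
      proof (rule transport_cost_le_cells[OF \<nu> \<mu> p' p(2) \<rho>(1) e_\<nu> e_\<mu>])
        fix f g :: "real^'d \<Rightarrow> real"
        assume fg: "\<And>s t. s \<in> range (\<rho> i) \<Longrightarrow> t \<in> range (\<rho> i) \<Longrightarrow> f s - g t \<le> cost p (s - t)"
        have comp_meas: "(\<lambda>x. w (\<rho> i x)) \<in> borel_measurable borel" for w :: "real^'d \<Rightarrow> real"
          by (intro borel_measurable_simple_function simple_function_compose1[OF \<rho>(1)])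
        have comp_int: "integrable M (\<lambda>x. w (\<rho> i x))" if M: "prob_space M" "sets M = sets borel"
          for M and w :: "real^'d \<Rightarrow> real"
        proof -
          have "finite (range (\<lambda>x. w (\<rho> i x)))"
            using simple_functionD(1)[OF \<rho>(1), of i] by (simp add: image_image[symmetric, of w "\<rho> i"])
          then obtain B where "\<And>x. \<bar>w (\<rho> i x)\<bar> \<le> B"
            using finite_imp_bounded[of "range (\<lambda>x. w (\<rho> i x))"] by (auto simp: bounded_real)
          then show ?thesis
            using comp_meas[of w] by (intro bounded_integrable[OF M(1)]) (auto simp: measurable_cong_sets[OF M(2) refl])
        qed
        \<comment> \<open>The potentials are compatible only at the values of
          \<open>\<rho> i\<close>. Correcting them by \<open>3 * ?e\<close> yields an inequality
          valid on the whole space with \<open>\<kappa> = 3\<close>, so concentration can be used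
          for \<open>\<mu>\<close> itself rather than for its discretised image; the means change
          only by rounding errors that vanish in the limit.\<close>
        define F where "F x = f (\<rho> i x) - 3 * ?e x" for x
        define \<Phi> where "\<Phi> y = g (\<rho> i y) + 3 * ?e y" for y
        have F_meas: "F \<in> borel_measurable borel" and \<Phi>_meas: "\<Phi> \<in> borel_measurable borel"
          unfolding F_def[abs_def] \<Phi>_def[abs_def] using comp_meas[of f] comp_meas[of g] by measurable
        have F\<Phi>: "F x \<le> \<Phi> y + 3 * cost p (x - y)" for x y
        proof -
          have "f (\<rho> i x) - g (\<rho> i y) \<le> cost p (\<rho> i x - \<rho> i y)" using fg by simp
          also have "\<dots> \<le> 3 * (cost p (\<rho> i x - x) + cost p (x - y) + cost p (\<rho> i y - y))"
            by (rule cost_triangle3[OF p' p(2)])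
          finally show ?thesis
            by (simp add: F_def \<Phi>_def cost_commute[of p "\<rho> i _"])
        qed
        have \<Phi>_int: "integrable \<mu> \<Phi>"
          unfolding \<Phi>_def[abs_def] using comp_int[OF \<mu>, of g] e_\<mu> by simp
        have \<Phi>2_int: "integrable \<mu> (\<lambda>y. (\<Phi> y)\<^sup>2)"
        proof (rule Bochner_Integration.integrable_bound)
          show "integrable \<mu> (\<lambda>y. 2 * (g (\<rho> i y))\<^sup>2 + 18 * (?e y)\<^sup>2)"
            using comp_int[OF \<mu>, of "\<lambda>s. (g s)\<^sup>2"] e2_\<mu> by simp
          show "AE y in \<mu>. norm ((\<Phi> y)\<^sup>2) \<le> norm (2 * (g (\<rho> i y))\<^sup>2 + 18 * (?e y)\<^sup>2)"
          proof (rule AE_I2)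
            fix y
            have "(u + v)\<^sup>2 \<le> 2 * u\<^sup>2 + 2 * v\<^sup>2" for u v :: real
              using zero_le_power2[of "u - v"] by (simp add: power2_eq_square algebra_simps)
            from this[of "g (\<rho> i y)" "3 * ?e y"]
            show "norm ((\<Phi> y)\<^sup>2) \<le> norm (2 * (g (\<rho> i y))\<^sup>2 + 18 * (?e y)\<^sup>2)"
              by (simp add: \<Phi>_def power_mult_distrib)
          qed
        qed (use \<Phi>_meas in \<open>simp add: measurable_cong_sets[OF \<mu>(2) refl]\<close>)
        have F_int: "integrable \<nu> F"
          unfolding F_def[abs_def] using comp_int[OF \<nu>, of f] e_\<nu> by simp
        \<comment> \<open>The exponent a / 24 is half of the critical value a / (4 * 3) for
          \<open>\<kappa> = 3\<close>.\<close>
        have "(\<integral>\<^sup>+ x. ennreal (exp (a / 24 * F x)) \<partial>\<mu>) \<le> ennreal (exp (a / 24 * (\<integral>y. \<Phi> y \<partial>\<mu>)))"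
          using ab by (intro concentration_imp_exp_moment[OF \<mu> p ab conc, of 3] F_meas \<Phi>_meas \<Phi>_int \<Phi>2_int F\<Phi>) auto
        then have "(\<integral>x. a / 24 * F x \<partial>\<nu>) \<le> h + a / 24 * (\<integral>y. \<Phi> y \<partial>\<mu>)"
          using F_meas F_int
          by (intro gibbs_variational[OF \<mu>(1) \<nu>(1) sets_eq h]) (auto simp: measurable_cong_sets[OF \<mu>(2) refl])
        then have "a / 24 * (\<integral>x. F x \<partial>\<nu>) \<le> h + a / 24 * (\<integral>y. \<Phi> y \<partial>\<mu>)" by simp
        then have "(\<integral>x. F x \<partial>\<nu>) \<le> 24 / a * h + (\<integral>y. \<Phi> y \<partial>\<mu>)"
          using ab by (simp add: field_simps)
        moreover have "(\<integral>x. F x \<partial>\<nu>) = (\<integral>x. f (\<rho> i x) \<partial>\<nu>) - 3 * (\<integral>x. ?e x \<partial>\<nu>)"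
          unfolding F_def using comp_int[OF \<nu>, of f] e_\<nu> by simp
        moreover have "(\<integral>y. \<Phi> y \<partial>\<mu>) = (\<integral>y. g (\<rho> i y) \<partial>\<mu>) + 3 * (\<integral>y. ?e y \<partial>\<mu>)"
          unfolding \<Phi>_def using comp_int[OF \<mu>, of g] e_\<mu> by simp
        ultimately show "(\<integral>x. f (\<rho> i x) \<partial>\<nu>) - (\<integral>y. g (\<rho> i y) \<partial>\<mu>)
            \<le> 24 / a * h + 3 * (\<integral>x. ?e x \<partial>\<nu>) + 3 * (\<integral>y. ?e y \<partial>\<mu>)"
          by linarith
      qed
      then show ?thesis by (simp add: algebra_simps)
    qed
    have "(\<lambda>i. 72 / a * h + 12 * (d\<nu> i + d\<mu> i)) \<longlonglongrightarrow> 72 / a * h + 12 * (0 + 0)"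
      unfolding d\<nu>_def d\<mu>_def
      by (intro tendsto_intros cost_approximation_tendsto[OF p' p(2) \<nu>(2) c_\<nu> \<rho>]
          cost_approximation_tendsto[OF p' p(2) \<mu>(2) c_\<mu> \<rho>])
    then have "(\<lambda>i. ennreal (72 / a * h + 12 * (d\<nu> i + d\<mu> i))) \<longlonglongrightarrow> ennreal (72 / a * h + 12 * (0 + 0))"
      by (rule tendsto_ennrealI)
    then have "transport_cost p \<nu> \<mu> \<le> ennreal (72 / a * h + 12 * (0 + 0))"
      by (rule LIMSEQ_le_const) (use bound in blast)
    \<comment> \<open>The estimate obtained has constant 72 / a; nonnegative entropy allows the
      larger constant.\<close>
    also have "\<dots> \<le> ennreal (288 / a * h)"
      using ab h_nonneg by (intro ennreal_leI) (simp add: divide_right_mono mult_right_mono)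
    finally have "enn2ereal (transport_cost p \<nu> \<mu>) \<le> enn2ereal (ennreal (288 / a * h))"
      by (simp add: less_eq_ennreal.rep_eq)
    also have "\<dots> = ereal (288 / a * h)"
      using ab h_nonneg by (intro enn2ereal_ennreal) simp
    finally show ?thesis by (simp add: h)
  qed
qed

theorem theorem4p2:
  fixes \<mu> :: "(real^'d) measure" and p :: real
  assumes "prob_space \<mu>" and "sets \<mu> = sets borel"
    and "1 \<le> p" and "p \<le> 2"
  shows "((\<exists>a>0. \<exists>b\<ge>0. concentration \<mu> p a b) \<longleftrightarrow> (\<exists>C>0. transport_entropy \<mu> p C))
     \<and> (\<forall>a b. a > 0 \<and> b \<ge> 0 \<and> concentration \<mu> p a b \<longrightarrow> transport_entropy \<mu> p (288 / a))
     \<and> (\<forall>C. C > 0 \<and> transport_entropy \<mu> p C \<longrightarrow> concentration \<mu> p (1 / (2 * C)) 2)"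
proof (intro conjI)
  show forward: "\<forall>a b. a > 0 \<and> b \<ge> 0 \<and> concentration \<mu> p a b \<longrightarrow> transport_entropy \<mu> p (288 / a)"
    using concentration_imp_transport_entropy[OF assms] by blast
  show backward: "\<forall>C. C > 0 \<and> transport_entropy \<mu> p C \<longrightarrow> concentration \<mu> p (1 / (2 * C)) 2"
    using transport_entropy_imp_concentration[OF assms] by blast
  show "(\<exists>a>0. \<exists>b\<ge>0. concentration \<mu> p a b) \<longleftrightarrow> (\<exists>C>0. transport_entropy \<mu> p C)"
  proof
    assume "\<exists>a>0. \<exists>b\<ge>0. concentration \<mu> p a b"
    then obtain a b where "0 < a" "0 \<le> b" "concentration \<mu> p a b" by blast
    with forward show "\<exists>C>0. transport_entropy \<mu> p C" by (intro exI[of _ "288 / a"]) auto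
  next
    assume "\<exists>C>0. transport_entropy \<mu> p C"
    then obtain C where "0 < C" "transport_entropy \<mu> p C" by blast
    with backward show "\<exists>a>0. \<exists>b\<ge>0. concentration \<mu> p a b"
      by (intro exI[of _ "1 / (2 * C)"] conjI exI[of _ 2]) auto
  qed
qed

end
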